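(* The classes of dominated dcpos, weakly dominated dcpos, $2$-complete dcpos and all dcpos satisfy $$\mathbf{DOMI}\subsetneq\mathbf{WDomi}\subsetneq\mathcal R_2\subsetneq\mathbf{DCPO}.$$
   Context: Directed subsets are nonempty; a dcpo is a poset in which every directed subset has a supremum. $\mathbf{DCPO}$ is the category of dcpos and Scott-continuous maps. For dcpos $A,B$, $[A\to B]$ is the dcpo of Scott-continuous maps ordered pointwise. $\Gamma(P)$ is the complete lattice of Scott-closed subsets of a dcpo $P$ ordered by inclusion, and $\mathrm{Irr}(\Gamma(P))$ is the dcpo of nonempty irreducible Scott-closed subsets of $P$ ordered by inclusion. For Scott-closed $A,B\subseteq P$, write $A\lhd B$ if $A\subseteq{\downarrow}b$ for some $b\in B$. A dcpo $P$ is dominated if for every $B\in\mathrm{Irr}(\Gamma(P))$ the set $\nabla_{\mathrm{irr}}B=\{A\in\mathrm{Irr}(\Gamma(P)):A\lhd B\}$ is Scott closed in $\mathrm{Irr}(\Gamma(P))$. $\mathbf{DOMI}$ is the class of dominated dcpos. For a poset $Q$ and $x,y\in Q$, write $x\prec^*y$ if for every nonempty Scott-closed subset $\mathcal A\subseteq Q$ whose supremum exists, $y\le\bigvee\mathcal A$ implies $x\in\mathcal A$. An element $x$ is $C$-compact if $x\prec^*x$. $C(\Gamma(P))$ is the set of $C$-compact elements of $\Gamma(P)$, ordered by inclusion (a sub-dcpo of $\Gamma(P)$). A dcpo $P$ is weakly dominated if for every $B\in C(\Gamma(P))$ the set $\nabla_CB=\{A\in C(\Gamma(P)):A\lhd B\}$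 is Scott closed in $C(\Gamma(P))$. $\mathbf{WDomi}$ is the class of weakly dominated dcpos. Let $2=\{0<1\}$. $E_2$ is the class of all Scott-continuous maps $e:A\to B$ between dcpos such that $e^*:[B\to 2]\to[A\to 2]$, $g\mapsto g\circ e$, is an isomorphism of dcpos (equivalently, $e^{-1}$ is an order isomorphism from the lattice of Scott-open sets of $B$ onto that of $A$). $\mathcal R_2=E_2^{\perp}$ is the full subcategory of $\mathbf{DCPO}$ of all $2$-complete dcpos, i.e. of all dcpos $C$ such that for every $e:A\to B$ in $E_2$ the map $e^*:[B\to C]\to[A\to C]$, $g\mapsto g\circ e$, is an isomorphism of dcpos. (It is the least reflective full subcategory of $\mathbf{DCPO}$ containing $2$.) *)

theory Defs
  imports Main "HOL-Library.FuncSet"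
begin

text \<open>A poset is represented by its (reflexive) order relation \<open>r\<close>; its underlying set is
  \<open>Field r\<close>, and \<open>Partial_order r\<close>, \<open>under r x\<close> (the principal ideal of \<open>x\<close>) and
  \<open>Above r S\<close> (the upper bounds of \<open>S\<close>) are the library notions. The empty
  relation is the empty poset, which is a dcpo.\<close>

definition is_sup :: "'a rel \<Rightarrow> 'a set \<Rightarrow> 'a \<Rightarrow> bool" where
  "is_sup r S x \<longleftrightarrow> x \<in> Above r S \<and> (\<forall>z \<in> Above r S. (x, z) \<in> r)"

definition directed :: "'a rel \<Rightarrow> 'a set \<Rightarrow> bool" where
  "directed r D \<longleftrightarrow> D \<noteq> {} \<and> D \<subseteq> Field r \<and> (\<forall>x\<in>D. \<forall>y\<in>D. \<exists>z\<in>D. (x, z) \<in> r \<and> (y, z) \<in> r)"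

definition dcpo :: "'a rel \<Rightarrow> bool" where
  "dcpo r \<longleftrightarrow> Partial_order r \<and> (\<forall>D. directed r D \<longrightarrow> (\<exists>x. is_sup r D x))"

definition scott_closed :: "'a rel \<Rightarrow> 'a set \<Rightarrow> bool" where
  "scott_closed r S \<longleftrightarrow> S \<subseteq> Field r \<and> (\<forall>x\<in>S. under r x \<subseteq> S) \<and>
     (\<forall>D x. directed r D \<longrightarrow> D \<subseteq> S \<longrightarrow> is_sup r D x \<longrightarrow> x \<in> S)"

text \<open>Maps are taken extensional (\<open>\<rightarrow>\<^sub>E\<close>), so that equality of maps is equality of
  their values on the underlying set. Preservation of directed suprema implies monotonicity.\<close>

definition scott_maps :: "'a rel \<Rightarrow> 'b rel \<Rightarrow> ('a \<Rightarrow> 'b) set" where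
  "scott_maps r s = {f \<in> Field r \<rightarrow>\<^sub>E Field s.
     \<forall>D x. directed r D \<longrightarrow> is_sup r D x \<longrightarrow> is_sup s (f ` D) (f x)}"

definition fun_dcpo :: "'a rel \<Rightarrow> 'b rel \<Rightarrow> ('a \<Rightarrow> 'b) rel" where
  "fun_dcpo r s = relation_of (\<lambda>f g. \<forall>x\<in>Field r. (f x, g x) \<in> s) (scott_maps r s)"

definition order_iso :: "'a rel \<Rightarrow> 'b rel \<Rightarrow> ('a \<Rightarrow> 'b) \<Rightarrow> bool" where
  "order_iso r s f \<longleftrightarrow> bij_betw f (Field r) (Field s) \<and>
     (\<forall>x\<in>Field r. \<forall>y\<in>Field r. (x, y) \<in> r \<longleftrightarrow> (f x, f y) \<in> s)"

text \<open>The lattice of Scott-closed sets, and the posets of its nonempty irreducible and of its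
  \<open>C\<close>-compact elements, all ordered by inclusion.\<close>

definition Gamma :: "'a rel \<Rightarrow> 'a set rel" where
  "Gamma r = relation_of (\<subseteq>) {A. scott_closed r A}"

definition irreducible_closed :: "'a rel \<Rightarrow> 'a set \<Rightarrow> bool" where
  "irreducible_closed r A \<longleftrightarrow> scott_closed r A \<and> A \<noteq> {} \<and>
     (\<forall>F G. scott_closed r F \<longrightarrow> scott_closed r G \<longrightarrow> A \<subseteq> F \<union> G \<longrightarrow> A \<subseteq> F \<or> A \<subseteq> G)"

definition Irr_Gamma :: "'a rel \<Rightarrow> 'a set rel" where
  "Irr_Gamma r = relation_of (\<subseteq>) {A. irreducible_closed r A}"

definition prec_star :: "'a rel \<Rightarrow> 'a \<Rightarrow> 'a \<Rightarrow> bool" where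
  "prec_star q x y \<longleftrightarrow> (\<forall>S s. S \<noteq> {} \<longrightarrow> scott_closed q S \<longrightarrow> is_sup q S s \<longrightarrow> (y, s) \<in> q \<longrightarrow> x \<in> S)"

definition C_compact :: "'a rel \<Rightarrow> 'a \<Rightarrow> bool" where
  "C_compact q x \<longleftrightarrow> x \<in> Field q \<and> prec_star q x x"

definition C_Gamma :: "'a rel \<Rightarrow> 'a set rel" where
  "C_Gamma r = relation_of (\<subseteq>) {A. C_compact (Gamma r) A}"

definition lhd :: "'a rel \<Rightarrow> 'a set \<Rightarrow> 'a set \<Rightarrow> bool" where
  "lhd r A B \<longleftrightarrow> (\<exists>b\<in>B. A \<subseteq> under r b)"

definition dominated :: "'a rel \<Rightarrow> bool" where
  "dominated r \<longleftrightarrow> dcpo r \<and>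
     (\<forall>B. irreducible_closed r B \<longrightarrow>
        scott_closed (Irr_Gamma r) {A. irreducible_closed r A \<and> lhd r A B})"

definition weakly_dominated :: "'a rel \<Rightarrow> bool" where
  "weakly_dominated r \<longleftrightarrow> dcpo r \<and>
     (\<forall>B. C_compact (Gamma r) B \<longrightarrow>
        scott_closed (C_Gamma r) {A. C_compact (Gamma r) A \<and> lhd r A B})"

definition two :: "bool rel" where
  "two = {(x, y). x \<le> y}"

definition map_orthogonal :: "'a rel \<Rightarrow> 'b rel \<Rightarrow> ('a \<Rightarrow> 'b) \<Rightarrow> 'c rel \<Rightarrow> bool" where
  "map_orthogonal r s e t \<longleftrightarrow>
     order_iso (fun_dcpo s t) (fun_dcpo r t) (\<lambda>g. compose (Field r) g e)"

definition E2 :: "'a rel \<Rightarrow> 'b rel \<Rightarrow> ('a \<Rightarrow> 'b) \<Rightarrow> bool" where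
  "E2 r s e \<longleftrightarrow> dcpo r \<and> dcpo s \<and> e \<in> scott_maps r s \<and> map_orthogonal r s e two"

text \<open>A definition cannot quantify over the types carrying the dcpos \<open>A\<close> and \<open>B\<close>. Here they are
  carried by \<open>'a\<close> and \<open>'a set\<close>; the lemma \<open>two_complete_orthogonal\<close> below shows that this
  already gives orthogonality to the maps in \<open>E2\<close> between dcpos on arbitrary types.\<close>

definition two_complete :: "'a rel \<Rightarrow> bool" where
  "two_complete t \<longleftrightarrow> dcpo t \<and>
     (\<forall>(r :: 'a rel) (s :: 'a set rel) e. E2 r s e \<longrightarrow> map_orthogonal r s e t)"

text \<open>Each class is a family of sets, one for every carrier type \<open>'a\<close>. An inclusion of classes is
  asserted at all types; its strictness is the existence of a witness at some type, for which a
  concrete type of cardinality \<open>beth\<^sub>2\<close> (\<open>nat set set\<close>) is taken.\<close>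

definition DCPO :: "'a rel set" where "DCPO = {r. dcpo r}"
definition DOMI :: "'a rel set" where "DOMI = {r. dominated r}"
definition WDomi :: "'a rel set" where "WDomi = {r. weakly_dominated r}"
definition R2 :: "'a rel set" where "R2 = {r. two_complete r}"


subsection \<open>Independence of \<open>two_complete\<close> from the carrier types\<close>

lemma Field_relation_of: "(\<And>x. x \<in> A \<Longrightarrow> P x x) \<Longrightarrow> Field (relation_of P A) = A"
  by (auto simp: relation_of_def Field_def)

lemma po_refl: "Partial_order r \<Longrightarrow> x \<in> Field r \<Longrightarrow> (x, x) \<in> r"
  by (auto simp: order_on_defs refl_on_def)

lemma po_trans: "Partial_order r \<Longrightarrow> (x, y) \<in> r \<Longrightarrow> (y, z) \<in> r \<Longrightarrow> (x, z) \<in> r"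
  by (auto simp: order_on_defs dest: transD)

lemma po_antisym: "Partial_order r \<Longrightarrow> (x, y) \<in> r \<Longrightarrow> (y, x) \<in> r \<Longrightarrow> x = y"
  by (auto simp: order_on_defs dest: antisymD)

lemma is_sup_Field: "is_sup r S x \<Longrightarrow> x \<in> Field r"
  by (auto simp: is_sup_def Above_def)

lemma is_sup_upper: "is_sup r S x \<Longrightarrow> y \<in> S \<Longrightarrow> (y, x) \<in> r"
  by (auto simp: is_sup_def Above_def)

lemma is_sup_least:
  "is_sup r S x \<Longrightarrow> z \<in> Field r \<Longrightarrow> (\<And>y. y \<in> S \<Longrightarrow> (y, z) \<in> r) \<Longrightarrow> (x, z) \<in> r"
  by (auto simp: is_sup_def Above_def)

lemma is_supI:
  "x \<in> Field r \<Longrightarrow> (\<And>y. y \<in> S \<Longrightarrow> (y, x) \<in> r) \<Longrightarrow>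
   (\<And>z. z \<in> Field r \<Longrightarrow> (\<And>y. y \<in> S \<Longrightarrow> (y, z) \<in> r) \<Longrightarrow> (x, z) \<in> r) \<Longrightarrow> is_sup r S x"
  by (auto simp: is_sup_def Above_def)

lemma is_sup_unique:
  assumes "Partial_order r" "is_sup r S x" "is_sup r S y"
  shows "x = y"
proof (rule po_antisym[OF assms(1)])
  show "(x, y) \<in> r" using assms(2,3) unfolding is_sup_def by blast
  show "(y, x) \<in> r" using assms(2,3) unfolding is_sup_def by blast
qed

lemma scott_closed_lower: "scott_closed r F \<Longrightarrow> x \<in> F \<Longrightarrow> (y, x) \<in> r \<Longrightarrow> y \<in> F"
  by (auto simp: scott_closed_def under_def)

lemma scott_closed_Field: "scott_closed r F \<Longrightarrow> x \<in> F \<Longrightarrow> x \<in> Field r"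
  by (auto simp: scott_closed_def)

lemma scott_closed_sup:
  "scott_closed r F \<Longrightarrow> directed r D \<Longrightarrow> D \<subseteq> F \<Longrightarrow> is_sup r D x \<Longrightarrow> x \<in> F"
  by (auto simp: scott_closed_def)

lemma scott_closedI:
  "F \<subseteq> Field r \<Longrightarrow> (\<And>x y. x \<in> F \<Longrightarrow> (y, x) \<in> r \<Longrightarrow> y \<in> F) \<Longrightarrow>
   (\<And>D x. directed r D \<Longrightarrow> D \<subseteq> F \<Longrightarrow> is_sup r D x \<Longrightarrow> x \<in> F) \<Longrightarrow> scott_closed r F"
  by (auto simp: scott_closed_def under_def)

lemma scott_closed_all: "scott_closed r (Field r)"
  by (rule scott_closedI) (auto dest: is_sup_Field intro: FieldI1)

lemma scott_closed_Inter:
  assumes "\<S> \<noteq> {}" "\<And>F. F \<in> \<S> \<Longrightarrow> scott_closed r F"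
  shows "scott_closed r (\<Inter>\<S>)"
proof (rule scott_closedI)
  show "\<Inter>\<S> \<subseteq> Field r"
    using assms by (fastforce dest: scott_closed_Field)
  show "\<And>x y. x \<in> \<Inter>\<S> \<Longrightarrow> (y, x) \<in> r \<Longrightarrow> y \<in> \<Inter>\<S>"
    using assms(2) by (blast intro: scott_closed_lower)
  show "x \<in> \<Inter>\<S>" if "directed r D" "D \<subseteq> \<Inter>\<S>" "is_sup r D x" for D x
    using that assms(2) by (blast intro: scott_closed_sup)
qed

lemma scott_closed_under:
  assumes "Partial_order r"
  shows "scott_closed r (under r x)"
  using assms
  by (intro scott_closedI)
    (auto simp: under_def intro: po_trans FieldI1 FieldI2 elim!: is_sup_least dest: is_sup_Field,
     metis FieldI2 directed_def equals0I is_sup_least mem_Collect_eq subsetD)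

lemma scott_maps_Field: "f \<in> scott_maps r s \<Longrightarrow> x \<in> Field r \<Longrightarrow> f x \<in> Field s"
  by (auto simp: scott_maps_def)

lemma scott_maps_mono:
  assumes "Partial_order r" "f \<in> scott_maps r s" "(x, y) \<in> r"
  shows "(f x, f y) \<in> s"
proof -
  have F: "x \<in> Field r" "y \<in> Field r" using assms(3) by (auto intro: FieldI1 FieldI2)
  have "directed r {x, y}"
    using F assms(3) po_refl[OF assms(1)] by (auto simp: directed_def)
  moreover have "is_sup r {x, y} y"
    using F assms(3) po_refl[OF assms(1)] by (auto intro!: is_supI)
  ultimately have "is_sup s (f ` {x, y}) (f y)"
    using assms(2) by (auto simp: scott_maps_def)
  then show ?thesis by (auto dest: is_sup_upper)
qed

lemma directed_image:
  assumes "directed r D" "\<And>x. x \<in> Field r \<Longrightarrow> f x \<in> Field s"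
    and "\<And>x y. (x, y) \<in> r \<Longrightarrow> (f x, f y) \<in> s"
  shows "directed s (f ` D)"
  unfolding directed_def
proof (intro conjI ballI)
  show "f ` D \<noteq> {}" "f ` D \<subseteq> Field s" using assms(1,2) by (auto simp: directed_def)
  fix x y assume "x \<in> f ` D" "y \<in> f ` D"
  then obtain a b where ab: "a \<in> D" "b \<in> D" "x = f a" "y = f b" by auto
  then obtain c where "c \<in> D" "(a, c) \<in> r" "(b, c) \<in> r"
    using assms(1) unfolding directed_def by meson
  then show "\<exists>z\<in>f ` D. (x, z) \<in> s \<and> (y, z) \<in> s" using ab assms(3) by auto
qed

lemma scott_maps_directed:
  assumes "Partial_order r" "f \<in> scott_maps r s" "directed r D"
  shows "directed s (f ` D)"
  using assms(3) scott_maps_Field[OF assms(2)] scott_maps_mono[OF assms(1,2)]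
  by (rule directed_image)

lemma scott_maps_sup:
  "f \<in> scott_maps r s \<Longrightarrow> directed r D \<Longrightarrow> is_sup r D x \<Longrightarrow> is_sup s (f ` D) (f x)"
  by (auto simp: scott_maps_def)

lemma compose_eq: "x \<in> A \<Longrightarrow> compose A g f x = g (f x)"
  by (simp add: compose_def)

lemma scott_maps_compose:
  assumes "Partial_order r" "e \<in> scott_maps r s" "g \<in> scott_maps s t"
  shows "compose (Field r) g e \<in> scott_maps r t"
proof -
  have "is_sup t (compose (Field r) g e ` D) (compose (Field r) g e x)"
    if D: "directed r D" "is_sup r D x" for D x
  proof -
    have "compose (Field r) g e ` D = g ` e ` D"
      using D by (auto simp: directed_def compose_def image_iff subset_iff)
    moreover have "compose (Field r) g e x = g (e x)"
      using is_sup_Field[OF D(2)] by (simp add: compose_def)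
    moreover have "is_sup t (g ` e ` D) (g (e x))"
      by (intro scott_maps_sup[OF assms(3)] scott_maps_sup[OF assms(2)]
          scott_maps_directed[OF assms(1,2)] D)
    ultimately show ?thesis by simp
  qed
  moreover have "compose (Field r) g e \<in> Field r \<rightarrow>\<^sub>E Field t"
    using assms(2,3) by (auto simp: compose_def intro: scott_maps_Field)
  ultimately show ?thesis by (auto simp: scott_maps_def)
qed

definition pre :: "'a rel \<Rightarrow> ('a \<Rightarrow> 'b) \<Rightarrow> 'b set \<Rightarrow> 'a set" where
  "pre r f G = {x \<in> Field r. f x \<in> G}"

lemma scott_closed_pre:
  assumes "Partial_order r" "f \<in> scott_maps r s" "scott_closed s G"
  shows "scott_closed r (pre r f G)"
proof (rule scott_closedI)
  show "pre r f G \<subseteq> Field r" by (auto simp: pre_def)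
  show "\<And>x y. x \<in> pre r f G \<Longrightarrow> (y, x) \<in> r \<Longrightarrow> y \<in> pre r f G"
    using scott_maps_mono[OF assms(1,2)] scott_closed_lower[OF assms(3)]
    by (fastforce simp: pre_def intro: FieldI1)
  fix D x assume D: "directed r D" "D \<subseteq> pre r f G" "is_sup r D x"
  have "f ` D \<subseteq> G" using D(2) by (auto simp: pre_def)
  then have "f x \<in> G"
    using scott_closed_sup[OF assms(3)] scott_maps_directed[OF assms(1,2) D(1)]
      scott_maps_sup[OF assms(2) D(1,3)] by blast
  then show "x \<in> pre r f G" using is_sup_Field[OF D(3)] by (simp add: pre_def)
qed

lemma Field_fun_dcpo:
  assumes "Partial_order s"
  shows "Field (fun_dcpo r s) = scott_maps r s"
  unfolding fun_dcpo_def
  using assms by (intro Field_relation_of) (auto intro: po_refl scott_maps_Field)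

lemma fun_dcpo_iff:
  "(f, g) \<in> fun_dcpo r s \<longleftrightarrow>
     f \<in> scott_maps r s \<and> g \<in> scott_maps r s \<and> (\<forall>x\<in>Field r. (f x, g x) \<in> s)"
  by (auto simp: fun_dcpo_def relation_of_def)

lemma Field_two [simp]: "Field two = UNIV"
  by (auto simp: two_def Field_def)

lemma two_iff [simp]: "(x, y) \<in> two \<longleftrightarrow> (x \<longrightarrow> y)"
  by (auto simp: two_def)

lemma po_two: "Partial_order two"
  by (auto simp: order_on_defs refl_on_def trans_def antisym_def)

lemma Field_fun_two [simp]: "Field (fun_dcpo r two) = scott_maps r two"
  by (rule Field_fun_dcpo[OF po_two])

lemma is_sup_two: "is_sup two S x \<longleftrightarrow> (x \<longleftrightarrow> True \<in> S)"
proof -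
  have "z \<in> Above two S \<longleftrightarrow> (True \<in> S \<longrightarrow> z)" for z
    by (simp add: Above_def) (metis (full_types))
  then show ?thesis by (simp add: is_sup_def) blast
qed

lemma scott_maps_two_closed:
  assumes "Partial_order r" "g \<in> scott_maps r two"
  shows "scott_closed r {x \<in> Field r. \<not> g x}"
proof -
  have "scott_closed two {False}"
    by (rule scott_closedI) (auto simp: is_sup_two)
  from scott_closed_pre[OF assms this] show ?thesis
    by (simp add: pre_def)
qed

lemma closed_scott_maps_two:
  assumes "scott_closed r F"
  shows "(\<lambda>x\<in>Field r. x \<notin> F) \<in> scott_maps r two" (is "?g \<in> _")
proof -
  have "is_sup two (?g ` D) (?g x)" if D: "directed r D" "is_sup r D x" for D x
  proof -
    have "True \<in> ?g ` D \<longleftrightarrow> \<not> D \<subseteq> F"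
      using D(1) by (auto simp: directed_def subset_iff image_iff)
    moreover have "D \<subseteq> F \<longleftrightarrow> x \<in> F"
      using scott_closed_sup[OF assms D(1) _ D(2)] scott_closed_lower[OF assms]
        is_sup_upper[OF D(2)] by blast
    ultimately show ?thesis
      using is_sup_Field[OF D(2)] by (simp add: is_sup_two)
  qed
  then show ?thesis by (auto simp: scott_maps_def)
qed

lemma E2_lift:
  assumes "E2 r s e" "scott_closed r F"
  obtains G where "scott_closed s G" "pre r e G = F"
proof -
  from assms(1) have po: "Partial_order r" "Partial_order s" and e: "e \<in> scott_maps r s"
    and bij: "bij_betw (\<lambda>g. compose (Field r) g e) (scott_maps s two) (scott_maps r two)"
    by (auto simp: E2_def dcpo_def map_orthogonal_def order_iso_def)
  from closed_scott_maps_two[OF assms(2)] bij obtain g where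
    g: "g \<in> scott_maps s two" "compose (Field r) g e = (\<lambda>x\<in>Field r. x \<notin> F)"
    unfolding bij_betw_def by (metis (no_types, lifting) imageE)
  have "g (e x) \<longleftrightarrow> x \<notin> F" if "x \<in> Field r" for x
    using fun_cong[OF g(2), of x] that by (simp add: compose_def)
  then have "pre r e {x \<in> Field s. \<not> g x} = F"
    using scott_maps_Field[OF e] scott_closed_Field[OF assms(2)] by (auto simp: pre_def)
  with scott_maps_two_closed[OF po(2) g(1)] show ?thesis by (rule that)
qed

lemma E2_reflect:
  assumes "E2 r s e" "scott_closed s F" "scott_closed s G" "pre r e F \<subseteq> pre r e G"
  shows "F \<subseteq> G"
proof -
  let ?f = "\<lambda>x\<in>Field s. x \<notin> F" and ?g = "\<lambda>x\<in>Field s. x \<notin> G"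
  from assms(1) have po: "Partial_order r" and e: "e \<in> scott_maps r s"
    and iso: "order_iso (fun_dcpo s two) (fun_dcpo r two) (\<lambda>g. compose (Field r) g e)"
    by (auto simp: E2_def dcpo_def map_orthogonal_def)
  have fg: "?f \<in> scott_maps s two" "?g \<in> scott_maps s two"
    using assms(2,3) by (auto intro: closed_scott_maps_two)
  have "(compose (Field r) ?g e, compose (Field r) ?f e) \<in> fun_dcpo r two"
    unfolding fun_dcpo_iff
    using assms(4) scott_maps_Field[OF e] scott_maps_compose[OF po e fg(1)]
      scott_maps_compose[OF po e fg(2)]
    by (simp add: compose_eq pre_def) blast
  then have "(?g, ?f) \<in> fun_dcpo s two"
    using iso fg by (auto simp: order_iso_def)
  then show ?thesis
    using scott_closed_Field[OF assms(2)] by (auto simp: fun_dcpo_iff)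
qed

lemma orthogonalI:
  assumes "Partial_order r" "Partial_order t" "e \<in> scott_maps r s"
    and refl: "\<And>g h. g \<in> scott_maps s t \<Longrightarrow> h \<in> scott_maps s t \<Longrightarrow>
      (\<And>x. x \<in> Field r \<Longrightarrow> (g (e x), h (e x)) \<in> t) \<Longrightarrow> (\<And>y. y \<in> Field s \<Longrightarrow> (g y, h y) \<in> t)"
    and ext: "\<And>f. f \<in> scott_maps r t \<Longrightarrow>
      \<exists>g \<in> scott_maps s t. \<forall>x\<in>Field r. g (e x) = f x"
  shows "map_orthogonal r s e t"
proof -
  let ?c = "\<lambda>g. compose (Field r) g e"
  have c: "?c g \<in> scott_maps r t" if "g \<in> scott_maps s t" for g
    using scott_maps_compose[OF assms(1,3) that] .
  have ord: "(g, h) \<in> fun_dcpo s t \<longleftrightarrow> (?c g, ?c h) \<in> fun_dcpo r t"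
    if "g \<in> scott_maps s t" "h \<in> scott_maps s t" for g h
    unfolding fun_dcpo_iff
    using that c refl[OF that] scott_maps_Field[OF assms(3)] by (auto simp: compose_eq)
  have "inj_on ?c (scott_maps s t)"
  proof (rule inj_onI)
    fix g h assume gh: "g \<in> scott_maps s t" "h \<in> scott_maps s t" and eq: "?c g = ?c h"
    have "(?c g, ?c h) \<in> fun_dcpo r t" "(?c h, ?c g) \<in> fun_dcpo r t"
      using c[OF gh(1)] po_refl[OF assms(2)] eq by (auto simp: fun_dcpo_iff scott_maps_Field)
    then have "(g, h) \<in> fun_dcpo s t" "(h, g) \<in> fun_dcpo s t"
      using ord gh by auto
    then have "g y = h y" if "y \<in> Field s" for y
      using that po_antisym[OF assms(2)] by (auto simp: fun_dcpo_iff)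
    then show "g = h"
      using gh by (intro extensionalityI[of _ "Field s"]) (auto simp: scott_maps_def PiE_def)
  qed
  moreover have "?c ` scott_maps s t = scott_maps r t"
  proof
    show "?c ` scott_maps s t \<subseteq> scott_maps r t" using c by auto
    show "scott_maps r t \<subseteq> ?c ` scott_maps s t"
    proof
      fix f assume f: "f \<in> scott_maps r t"
      then obtain g where g: "g \<in> scott_maps s t" "\<And>x. x \<in> Field r \<Longrightarrow> g (e x) = f x"
        using ext by blast
      have "f = ?c g"
        using f g(2) by (intro extensionalityI[of _ "Field r"])
          (auto simp: scott_maps_def PiE_def compose_def)
      then show "f \<in> ?c ` scott_maps s t" using g(1) by auto
    qed
  qed
  ultimately show ?thesis
    using ord by (simp add: map_orthogonal_def order_iso_def bij_betw_def Field_fun_dcpo assms(2))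
qed

lemma E2I:
  assumes "dcpo r" "dcpo s" "e \<in> scott_maps r s"
    and lift: "\<And>F. scott_closed r F \<Longrightarrow> \<exists>G. scott_closed s G \<and> pre r e G = F"
    and refl: "\<And>F G. scott_closed s F \<Longrightarrow> scott_closed s G \<Longrightarrow> pre r e F \<subseteq> pre r e G \<Longrightarrow> F \<subseteq> G"
  shows "E2 r s e"
proof -
  have po: "Partial_order r" "Partial_order s" using assms(1,2) by (auto simp: dcpo_def)
  have "map_orthogonal r s e two"
  proof (rule orthogonalI[OF po(1) po_two assms(3)])
    fix g h y assume gh: "g \<in> scott_maps s two" "h \<in> scott_maps s two"
      and le: "\<And>x. x \<in> Field r \<Longrightarrow> (g (e x), h (e x)) \<in> two" and y: "y \<in> Field s"
    have "pre r e {x \<in> Field s. \<not> h x} \<subseteq> pre r e {x \<in> Field s. \<not> g x}"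
      using le by (auto simp: pre_def)
    from refl[OF _ _ this] gh show "(g y, h y) \<in> two"
      using scott_maps_two_closed[OF po(2)] y by auto
  next
    fix f assume f: "f \<in> scott_maps r two"
    from lift[OF scott_maps_two_closed[OF po(1) f]] obtain G where
      G: "scott_closed s G" "pre r e G = {x \<in> Field r. \<not> f x}" by blast
    have "(\<lambda>x\<in>Field s. x \<notin> G) (e x) = f x" if "x \<in> Field r" for x
      using that G(2) scott_maps_Field[OF assms(3)] by (auto simp: pre_def)
    then show "\<exists>g \<in> scott_maps s two. \<forall>x\<in>Field r. g (e x) = f x"
      using closed_scott_maps_two[OF G(1)] by blast
  qed
  then show ?thesis using assms by (simp add: E2_def)
qed

definition cl :: "'a rel \<Rightarrow> 'a set \<Rightarrow> 'a set" where
  "cl r S = \<Inter>{F. scott_closed r F \<and> S \<subseteq> F}"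

lemma cl_least_iff:
  "scott_closed r F \<Longrightarrow> S \<subseteq> Field r \<Longrightarrow> cl r S \<subseteq> F \<longleftrightarrow> S \<subseteq> F"
  by (auto simp: cl_def)

lemma scott_closed_cl: "S \<subseteq> Field r \<Longrightarrow> scott_closed r (cl r S)"
  unfolding cl_def by (rule scott_closed_Inter) (auto intro: scott_closed_all)

text \<open>The closure of a family of Scott-closed sets under directed suprema in \<open>Gamma r\<close>.\<close>

inductive_set gen :: "'a rel \<Rightarrow> 'a set set \<Rightarrow> 'a set set" for r T where
  base: "X \<in> T \<Longrightarrow> X \<in> gen r T"
| sup: "\<D> \<noteq> {} \<Longrightarrow> (\<And>X. X \<in> \<D> \<Longrightarrow> X \<in> gen r T) \<Longrightarrow>
    (\<And>X Y. X \<in> \<D> \<Longrightarrow> Y \<in> \<D> \<Longrightarrow> \<exists>Z\<in>\<D>. X \<subseteq> Z \<and> Y \<subseteq> Z) \<Longrightarrow> cl r (\<Union>\<D>) \<in> gen r T"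

lemma gen_closed:
  assumes "\<forall>X\<in>T. scott_closed r X" "X \<in> gen r T"
  shows "scott_closed r X"
  using assms(2)
proof induction
  case (sup \<D>)
  then have "\<Union>\<D> \<subseteq> Field r" by (meson Union_least scott_closed_def)
  then show ?case by (rule scott_closed_cl)
qed (use assms(1) in auto)

lemma gen_order:
  fixes r :: "'a rel" and T
  defines "s \<equiv> relation_of (\<subseteq>) (gen r T)"
  assumes T: "\<forall>X\<in>T. scott_closed r X"
  shows "Field s = gen r T" "(X, Y) \<in> s \<longleftrightarrow> X \<in> gen r T \<and> Y \<in> gen r T \<and> X \<subseteq> Y"
    "directed s \<D> \<Longrightarrow> is_sup s \<D> X \<longleftrightarrow> X = cl r (\<Union>\<D>)" "dcpo s"
    "directed s \<D> \<Longrightarrow> cl r (\<Union>\<D>) \<in> gen r T"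
proof -
  show F: "Field s = gen r T" unfolding s_def by (rule Field_relation_of) simp
  have iff: "(X, Y) \<in> s \<longleftrightarrow> X \<in> gen r T \<and> Y \<in> gen r T \<and> X \<subseteq> Y" for X Y
    by (auto simp: s_def relation_of_def)
  then show "(X, Y) \<in> s \<longleftrightarrow> X \<in> gen r T \<and> Y \<in> gen r T \<and> X \<subseteq> Y" .
  have clD: "cl r (\<Union>\<D>) \<in> gen r T" if "directed s \<D>" for \<D>
  proof (rule gen.sup)
    show "\<D> \<noteq> {}" "\<And>X. X \<in> \<D> \<Longrightarrow> X \<in> gen r T"
      using that by (auto simp: directed_def F)
    show "\<exists>Z\<in>\<D>. X \<subseteq> Z \<and> Y \<subseteq> Z" if "X \<in> \<D>" "Y \<in> \<D>" for X Y
      using that \<open>directed s \<D>\<close> unfolding directed_def iff by meson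
  qed
  then show "directed s \<D> \<Longrightarrow> cl r (\<Union>\<D>) \<in> gen r T" .
  have po: "Partial_order s"
    by (auto simp: order_on_defs refl_on_def trans_def antisym_def iff F dest: FieldI1 FieldI2)
  have sup: "is_sup s \<D> (cl r (\<Union>\<D>))" if D: "directed s \<D>" for \<D>
  proof (rule is_supI)
    show "cl r (\<Union>\<D>) \<in> Field s" using clD[OF D] F by simp
    show "(Y, cl r (\<Union>\<D>)) \<in> s" if "Y \<in> \<D>" for Y
      using that D clD[OF D] by (auto simp: iff directed_def F cl_def)
    fix Z assume Z: "Z \<in> Field s" "\<And>Y. Y \<in> \<D> \<Longrightarrow> (Y, Z) \<in> s"
    then have "\<Union>\<D> \<subseteq> Z" by (auto simp: iff)
    then have "cl r (\<Union>\<D>) \<subseteq> Z" using gen_closed[OF T] Z(1) F by (auto simp: cl_def)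
    then show "(cl r (\<Union>\<D>), Z) \<in> s" using Z clD[OF D] F by (simp add: iff)
  qed
  show "is_sup s \<D> X \<longleftrightarrow> X = cl r (\<Union>\<D>)" if D: "directed s \<D>"
  proof
    assume X: "is_sup s \<D> X"
    show "X = cl r (\<Union>\<D>)" by (rule is_sup_unique[OF po X sup[OF D]])
  qed (use sup[OF D] in simp)
  show "dcpo s" using po sup by (auto simp: dcpo_def)
qed

theorem two_complete_orthogonal:
  fixes t :: "'c rel" and r :: "'a rel" and s :: "'b rel"
  assumes "two_complete t" "E2 r s e"
  shows "map_orthogonal r s e t"
proof -
  have t: "dcpo t" "Partial_order t" using assms(1) by (auto simp: two_complete_def dcpo_def)
  have rs: "dcpo r" "dcpo s" "Partial_order r" "Partial_order s" and e: "e \<in> scott_maps r s"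
    using assms(2) by (auto simp: E2_def dcpo_def)
  have und: "scott_closed t (under t c)" for c by (rule scott_closed_under[OF t(2)])
  have und_sub: "under t c \<subseteq> F \<longleftrightarrow> c \<in> F" if "scott_closed t F" "c \<in> Field t" for c F
    using that po_refl[OF t(2)] scott_closed_lower[OF that(1)] by (auto simp: under_def)
  have und_inj: "c = d" if "c \<in> Field t" "d \<in> Field t" "under t c = under t d" for c d
  proof -
    have "c \<in> under t d" "d \<in> under t c"
      using that(3) po_refl[OF t(2) that(1)] po_refl[OF t(2) that(2)] by (auto simp: under_def)
    then show ?thesis by (intro po_antisym[OF t(2)]) (auto simp: under_def)
  qed
  show ?thesis
  proof (rule orthogonalI[OF rs(3) t(2) e])
    fix g h y assume gh: "g \<in> scott_maps s t" "h \<in> scott_maps s t"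
      and le: "\<And>x. x \<in> Field r \<Longrightarrow> (g (e x), h (e x)) \<in> t" and y: "y \<in> Field s"
    let ?F = "under t (h y)"
    have "pre r e (pre s h ?F) \<subseteq> pre r e (pre s g ?F)"
      using le scott_maps_Field[OF e] by (auto simp: pre_def under_def intro: po_trans[OF t(2)])
    then have "pre s h ?F \<subseteq> pre s g ?F"
      by (rule E2_reflect[OF assms(2) scott_closed_pre[OF rs(4) gh(2) und]
            scott_closed_pre[OF rs(4) gh(1) und]])
    then show "(g y, h y) \<in> t"
      using y po_refl[OF t(2) scott_maps_Field[OF gh(2) y]] by (auto simp: pre_def under_def)
  next
    fix f assume f: "f \<in> scott_maps r t"
    have "\<exists>G. scott_closed s G \<and> pre r e G = pre r f F" if "scott_closed t F" for F
      using E2_lift[OF assms(2) scott_closed_pre[OF rs(3) f that]] by metis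
    then obtain E where E: "\<And>F. scott_closed t F \<Longrightarrow> scott_closed s (E F)"
      "\<And>F. scott_closed t F \<Longrightarrow> pre r e (E F) = pre r f F" by metis
    have Ee: "e x \<in> E F \<longleftrightarrow> f x \<in> F" if "scott_closed t F" "x \<in> Field r" for x F
      using E(2)[OF that(1)] that(2) unfolding pre_def by blast
    have Emono: "E F \<subseteq> E G" if "scott_closed t F" "scott_closed t G" "F \<subseteq> G" for F G
      using that by (intro E2_reflect[OF assms(2)] E) (simp_all only: E(2), auto simp: pre_def)
    define K where "K b = \<Inter>{F. scott_closed t F \<and> b \<in> E F}" for b
    have Eall: "E (Field t) = Field s"
    proof
      show "E (Field t) \<subseteq> Field s" using E(1)[OF scott_closed_all] by (auto dest: scott_closed_Field)
      show "Field s \<subseteq> E (Field t)"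
      proof (rule E2_reflect[OF assms(2) scott_closed_all E(1)[OF scott_closed_all]])
        show "pre r e (Field s) \<subseteq> pre r e (E (Field t))"
          unfolding E(2)[OF scott_closed_all] using scott_maps_Field[OF f] by (auto simp: pre_def)
      qed
    qed
    have Kne: "{F. scott_closed t F \<and> b \<in> E F} \<noteq> {}" if "b \<in> Field s" for b
      using that Eall scott_closed_all by blast
    have Kcl: "scott_closed t (K b)" if "b \<in> Field s" for b
      unfolding K_def by (rule scott_closed_Inter[OF Kne[OF that]]) auto
    have KE: "K b \<subseteq> F \<longleftrightarrow> b \<in> E F" if b: "b \<in> Field s" and F: "scott_closed t F" for b F
    proof
      assume "b \<in> E F" then show "K b \<subseteq> F" using F by (auto simp: K_def)
    next
      assume sub: "K b \<subseteq> F"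
      let ?S = "{F. scott_closed t F \<and> b \<in> E F}"
      have "scott_closed s (\<Inter>(E ` ?S))"
        by (rule scott_closed_Inter) (use Kne[OF b] E(1) in auto)
      then have "\<Inter>(E ` ?S) \<subseteq> E (K b)"
      proof (rule E2_reflect[OF assms(2) _ E(1)[OF Kcl[OF b]]])
        show "pre r e (\<Inter>(E ` ?S)) \<subseteq> pre r e (E (K b))"
        proof
          fix x assume x: "x \<in> pre r e (\<Inter>(E ` ?S))"
          then have xr: "x \<in> Field r" by (simp add: pre_def)
          have "f x \<in> F" if "F \<in> ?S" for F
            using x that Ee[OF _ xr, of F] by (auto simp: pre_def)
          then have "f x \<in> K b" by (auto simp: K_def)
          then show "x \<in> pre r e (E (K b))"
            using Ee[OF Kcl[OF b] xr] xr by (simp add: pre_def)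
        qed
      qed
      then have "b \<in> E (K b)" by auto
      then show "b \<in> E F" using Emono[OF Kcl[OF b] F sub] by auto
    qed
    have Ke: "K (e a) = under t (f a)" if a: "a \<in> Field r" for a
    proof -
      have "K (e a) \<subseteq> F \<longleftrightarrow> under t (f a) \<subseteq> F" if F: "scott_closed t F" for F
        using KE[OF scott_maps_Field[OF e a] F] und_sub[OF F scott_maps_Field[OF f a]]
          Ee[OF F a] by simp
      from this[OF Kcl[OF scott_maps_Field[OF e a]]] this[OF und] show ?thesis by blast
    qed
    have Kmono: "K b \<subseteq> K c" if "(b, c) \<in> s" for b c
    proof -
      have bc: "b \<in> Field s" "c \<in> Field s" using that by (auto intro: FieldI1 FieldI2)
      have "c \<in> E (K c)" using KE[OF bc(2) Kcl[OF bc(2)]] by simp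
      then have "b \<in> E (K c)" using scott_closed_lower[OF E(1)[OF Kcl[OF bc(2)]]] that by blast
      then show ?thesis using KE[OF bc(1) Kcl[OF bc(2)]] by simp
    qed

    define T where "T = under t ` Field t \<union> K ` Field s"
    define q where "q = relation_of (\<subseteq>) (gen t T)"
    have T: "\<forall>X\<in>T. scott_closed t X" using und Kcl by (auto simp: T_def)
    note q = gen_order[OF T, folded q_def]
    note gcl = gen_closed[OF T]
    define n where "n = (\<lambda>c\<in>Field t. under t c)"
    have nT: "under t c \<in> gen t T" if "c \<in> Field t" for c
      using that by (intro gen.base) (simp add: T_def)
    have KT: "K b \<in> gen t T" if "b \<in> Field s" for b
      using that by (intro gen.base) (simp add: T_def)
    have gsup: "cl t (\<Union>\<D>) \<subseteq> F \<longleftrightarrow> (\<forall>X\<in>\<D>. X \<subseteq> F)"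
      if "directed q \<D>" "scott_closed t F" for \<D> F
    proof -
      have "\<forall>X\<in>\<D>. scott_closed t X"
        using that gcl by (auto simp: directed_def q(1))
      then have "\<Union>\<D> \<subseteq> Field t" by (meson Union_least scott_closed_def)
      then show ?thesis using that(2) by (simp add: cl_least_iff Sup_le_iff)
    qed
    have dir_und: "directed q (n ` D)" if D: "directed t D" for D
      using D
    proof (rule directed_image)
      show "n c \<in> Field q" if "c \<in> Field t" for c using that nT by (simp add: q(1) n_def)
      show "(n c, n d) \<in> q" if "(c, d) \<in> t" for c d
        using that nT FieldI1[OF that] FieldI2[OF that]
        by (auto simp: q(2) n_def under_def intro: po_trans[OF t(2)])
    qed
    have n: "n \<in> scott_maps t q"
    proof -
      have "is_sup q (n ` D) (n x)" if D: "directed t D" "is_sup t D x" for D x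
      proof -
        have DF: "D \<subseteq> Field t" using D(1) by (auto simp: directed_def)
        have x: "x \<in> Field t" by (rule is_sup_Field[OF D(2)])
        have "cl t (\<Union>(n ` D)) \<subseteq> F \<longleftrightarrow> n x \<subseteq> F" if F: "scott_closed t F" for F
        proof -
          have "cl t (\<Union>(n ` D)) \<subseteq> F \<longleftrightarrow> (\<forall>d\<in>D. n d \<subseteq> F)"
            using gsup[OF dir_und[OF D(1)] F] by auto
          also have "\<dots> \<longleftrightarrow> D \<subseteq> F" using DF und_sub[OF F] by (auto simp: n_def)
          also have "\<dots> \<longleftrightarrow> x \<in> F"
            using scott_closed_sup[OF F D(1) _ D(2)] scott_closed_lower[OF F]
              is_sup_upper[OF D(2)] by blast
          also have "\<dots> \<longleftrightarrow> n x \<subseteq> F" using und_sub[OF F x] x by (simp add: n_def)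
          finally show ?thesis .
        qed
        moreover have "scott_closed t (n x)" using x und by (simp add: n_def)
        moreover have "scott_closed t (cl t (\<Union>(n ` D)))"
          by (rule gcl[OF q(5)[OF dir_und[OF D(1)]]])
        ultimately have "n x = cl t (\<Union>(n ` D))" by blast
        then show ?thesis using q(3)[OF dir_und[OF D(1)]] by simp
      qed
      then show ?thesis using nT by (auto simp: scott_maps_def q(1) n_def)
    qed
    have hat: "scott_closed q {X \<in> gen t T. X \<subseteq> F}" if F: "scott_closed t F" for F
    proof (rule scott_closedI)
      show "{X \<in> gen t T. X \<subseteq> F} \<subseteq> Field q" by (auto simp: q(1))
      show "Y \<in> {X \<in> gen t T. X \<subseteq> F}" if "X \<in> {X \<in> gen t T. X \<subseteq> F}" "(Y, X) \<in> q" for X Y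
        using that by (auto simp: q(2))
      show "X \<in> {X \<in> gen t T. X \<subseteq> F}"
        if "directed q \<D>" "\<D> \<subseteq> {X \<in> gen t T. X \<subseteq> F}" "is_sup q \<D> X" for \<D> X
      proof -
        have "X = cl t (\<Union>\<D>)" using q(3)[OF that(1)] that(3) by simp
        then show ?thesis using q(5)[OF that(1)] gsup[OF that(1) F] that(2) by auto
      qed
    qed
    have pre_hat: "pre t n {X \<in> gen t T. X \<subseteq> F} = F" if F: "scott_closed t F" for F
      using und_sub[OF F] nT scott_closed_Field[OF F] by (auto simp: pre_def n_def)
    have Kq: "directed q (K ` D)" "is_sup q (K ` D) (K x)"
      if D: "directed s D" "is_sup s D x" for D x
    proof -
      have DF: "D \<subseteq> Field s" using D(1) by (auto simp: directed_def)
      have x: "x \<in> Field s" by (rule is_sup_Field[OF D(2)])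
      show dir: "directed q (K ` D)"
        using D(1)
      proof (rule directed_image)
        show "K b \<in> Field q" if "b \<in> Field s" for b using that KT by (simp add: q(1))
        show "(K b, K c) \<in> q" if "(b, c) \<in> s" for b c
          using that KT FieldI1[OF that] FieldI2[OF that] Kmono by (simp add: q(2))
      qed
      have "cl t (\<Union>(K ` D)) \<subseteq> F \<longleftrightarrow> K x \<subseteq> F" if F: "scott_closed t F" for F
      proof -
        have "cl t (\<Union>(K ` D)) \<subseteq> F \<longleftrightarrow> (\<forall>d\<in>D. K d \<subseteq> F)" using gsup[OF dir F] by auto
        also have "\<dots> \<longleftrightarrow> D \<subseteq> E F" using DF KE[OF _ F] by auto
        also have "\<dots> \<longleftrightarrow> x \<in> E F"
          using scott_closed_sup[OF E(1)[OF F] D(1) _ D(2)] scott_closed_lower[OF E(1)[OF F]]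
            is_sup_upper[OF D(2)] by blast
        finally show ?thesis using KE[OF x F] by simp
      qed
      moreover have "scott_closed t (cl t (\<Union>(K ` D)))" by (rule gcl[OF q(5)[OF dir]])
      ultimately have "K x = cl t (\<Union>(K ` D))" using Kcl[OF x] by blast
      then show "is_sup q (K ` D) (K x)" using q(3)[OF dir] by simp
    qed
    have Kpre: "scott_closed s (pre s K \<F>)" if cF: "scott_closed q \<F>" for \<F>
    proof (rule scott_closedI)
      show "pre s K \<F> \<subseteq> Field s" by (auto simp: pre_def)
      show "y \<in> pre s K \<F>" if "x \<in> pre s K \<F>" "(y, x) \<in> s" for x y
        using that Kmono[OF that(2)] scott_closed_lower[OF cF, of "K x" "K y"] KT
        by (auto simp: pre_def q(2) intro: FieldI1)
      fix D x assume D: "directed s D" "D \<subseteq> pre s K \<F>" "is_sup s D x"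
      have "is_sup q (K ` D) (K x)" "directed q (K ` D)" using Kq[OF D(1,3)] by auto
      moreover have "K ` D \<subseteq> \<F>" using D(2) by (auto simp: pre_def)
      ultimately have "K x \<in> \<F>" using scott_closed_sup[OF cF] by blast
      then show "x \<in> pre s K \<F>" using is_sup_Field[OF D(3)] by (simp add: pre_def)
    qed
    have hat_pre: "\<F> = {X \<in> gen t T. X \<subseteq> pre t n \<F>}" if cF: "scott_closed q \<F>" for \<F>
    proof -
      let ?F = "pre t n \<F>"
      have F: "scott_closed t ?F" by (rule scott_closed_pre[OF t(2) n cF])
      have 1: "X \<subseteq> ?F" if "X \<in> \<F>" for X
      proof
        fix c assume c: "c \<in> X"
        have X: "X \<in> gen t T" using scott_closed_Field[OF cF that] by (simp add: q(1))
        have ct: "c \<in> Field t" using scott_closed_Field[OF gcl[OF X] c] .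
        have "under t c \<subseteq> X" using und_sub[OF gcl[OF X] ct] c by simp
        then have "n c \<in> \<F>"
          using scott_closed_lower[OF cF that] nT[OF ct] X ct by (simp add: q(2) n_def)
        then show "c \<in> ?F" using ct by (simp add: pre_def)
      qed
      have 2: "X \<in> \<F>" if "X \<in> gen t T" "X \<subseteq> ?F" for X
        using that
      proof induction
        case (base X)
        then consider c where "c \<in> Field t" "X = under t c" | b where "b \<in> Field s" "X = K b"
          by (auto simp: T_def)
        then show ?case
        proof cases
          case 1
          then show ?thesis using base.prems und_sub[OF F] by (auto simp: pre_def n_def)
        next
          case 2
          then have bE: "b \<in> E ?F" using base.prems KE[OF _ F] by auto
          have "pre r e (E ?F) \<subseteq> pre r e (pre s K \<F>)"
            unfolding E(2)[OF F]
            using Ke scott_maps_Field[OF e] by (auto simp: pre_def n_def split: if_splits)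
          then have "E ?F \<subseteq> pre s K \<F>"
            by (rule E2_reflect[OF assms(2) E(1)[OF F] Kpre[OF cF]])
          then show ?thesis using bE 2 by (auto simp: pre_def)
        qed
      next
        case (sup \<D>)
        have dir: "directed q \<D>"
          unfolding directed_def using sup.hyps by (auto simp: q(1,2))
        have "X \<subseteq> ?F" if "X \<in> \<D>" for X using gsup[OF dir F] sup.prems that by auto
        then have "\<D> \<subseteq> \<F>" using sup.IH by auto
        then show ?case using scott_closed_sup[OF cF dir] q(3)[OF dir] by auto
      qed
      show ?thesis using 1 2 scott_closed_Field[OF cF] by (auto simp: q(1))
    qed
    have nE2: "E2 t q n"
    proof (rule E2I[OF t(1) q(4) n])
      show "\<exists>G. scott_closed q G \<and> pre t n G = F" if "scott_closed t F" for F
        using hat[OF that] pre_hat[OF that] by blast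
      show "F \<subseteq> G" if "scott_closed q F" "scott_closed q G" "pre t n F \<subseteq> pre t n G" for F G
        using hat_pre[OF that(1)] hat_pre[OF that(2)] that(3) by blast
    qed
    have "map_orthogonal t q n t" using assms(1) nE2 by (auto simp: two_complete_def)
    then have img: "(\<lambda>g. compose (Field t) g n) ` scott_maps q t = scott_maps t t"
      by (simp add: map_orthogonal_def order_iso_def Field_fun_dcpo t(2) bij_betw_def)
    have "(\<lambda>c\<in>Field t. c) \<in> scott_maps t t"
    proof -
      have "(\<lambda>c\<in>Field t. c) ` D = D" if "directed t D" for D
        using that by (auto simp: directed_def subset_iff image_iff)
      then show ?thesis by (auto simp: scott_maps_def is_sup_Field)
    qed
    then obtain \<rho> where \<rho>: "\<rho> \<in> scott_maps q t" "compose (Field t) \<rho> n = (\<lambda>c\<in>Field t. c)"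
      unfolding img[symmetric] by (metis (no_types, lifting) imageE)
    have \<rho>n: "\<rho> (n c) = c" if "c \<in> Field t" for c
      using fun_cong[OF \<rho>(2), of c] that by (simp add: compose_def)
    have \<rho>F: "X \<subseteq> F \<longleftrightarrow> \<rho> X \<in> F" if X: "X \<in> gen t T" and F: "scott_closed t F" for X F
    proof -
      have q': "Partial_order q" using q(4) by (auto simp: dcpo_def)
      have cl': "scott_closed q (pre q \<rho> F)" by (rule scott_closed_pre[OF q' \<rho>(1) F])
      have "pre t n (pre q \<rho> F) = F"
        using \<rho>n nT scott_closed_Field[OF F] by (auto simp: pre_def q(1) n_def)
      then have "pre q \<rho> F = {X \<in> gen t T. X \<subseteq> F}" using hat_pre[OF cl'] by simp
      then have "X \<in> pre q \<rho> F \<longleftrightarrow> X \<subseteq> F" using X by simp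
      then show ?thesis using X by (simp add: pre_def q(1))
    qed
    have \<rho>t: "\<rho> X \<in> Field t" if "X \<in> gen t T" for X
      by (rule scott_maps_Field[OF \<rho>(1)]) (simp add: q(1) that)
    have \<rho>u: "under t (\<rho> X) = X" if X: "X \<in> gen t T" for X
      using \<rho>F[OF X und, of "\<rho> X"] \<rho>F[OF X gcl[OF X]] und_sub[OF gcl[OF X] \<rho>t[OF X]]
        und_sub[OF und \<rho>t[OF X], of "\<rho> X"] by auto
    define g where "g = (\<lambda>b\<in>Field s. \<rho> (K b))"
    have gt: "g b \<in> Field t" and gu: "under t (g b) = K b" if "b \<in> Field s" for b
      using that \<rho>t[OF KT] \<rho>u[OF KT] by (simp_all add: g_def)
    have gle: "(g b, z) \<in> t \<longleftrightarrow> b \<in> E (under t z)" if "b \<in> Field s" for b z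
      using KE[OF that und] und_sub[OF und gt[OF that], of z] gu[OF that]
      by (auto simp: under_def)
    have "g \<in> scott_maps s t"
    proof -
      have "is_sup t (g ` D) (g x)" if D: "directed s D" "is_sup s D x" for D x
      proof (rule is_supI)
        have DF: "D \<subseteq> Field s" using D(1) by (auto simp: directed_def)
        have x: "x \<in> Field s" by (rule is_sup_Field[OF D(2)])
        show "g x \<in> Field t" by (rule gt[OF x])
        show "(y, g x) \<in> t" if "y \<in> g ` D" for y
        proof -
          from that obtain d where d: "d \<in> D" "y = g d" by auto
          have "x \<in> E (under t (g x))" using gle[OF x] po_refl[OF t(2) gt[OF x]] by simp
          then have "d \<in> E (under t (g x))"
            using scott_closed_lower[OF E(1)[OF und]] is_sup_upper[OF D(2) d(1)] by blast
          then show ?thesis using gle d DF by auto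
        qed
        show "(g x, z) \<in> t" if z: "z \<in> Field t" "\<And>y. y \<in> g ` D \<Longrightarrow> (y, z) \<in> t" for z
        proof -
          have "D \<subseteq> E (under t z)" using z(2) gle DF by auto
          then show ?thesis using scott_closed_sup[OF E(1)[OF und] D(1) _ D(2)] gle[OF x] by simp
        qed
      qed
      then show ?thesis using gt by (auto simp: scott_maps_def g_def)
    qed
    moreover have "g (e a) = f a" if "a \<in> Field r" for a
      using und_inj[OF gt[OF scott_maps_Field[OF e that]] scott_maps_Field[OF f that]]
        gu[OF scott_maps_Field[OF e that]] Ke[OF that] by simp
    ultimately show "\<exists>g \<in> scott_maps s t. \<forall>x\<in>Field r. g (e x) = f x" by blast
  qed
qed

end

(* Inclusions.  Scott-closed families in Gamma(P) have their union as supremum, so a nonempty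
   C-compact set is irreducible, and the first inclusion follows.  Let e : A -> B be in E_2 and
   f : A -> P.  Extending f as a map into Gamma(P) sends b to K b, the closure of f(e^-1(down b)), and
   K b is C-compact.  The preimage under K of a Scott-closed family that contains down x for all
   x in K b contains b; applied to the family of all X with X <| K b this makes K b principal, so that
   K defines an extension B -> P of f.  The same argument works by induction when the relation <|
   is well-founded on the nonprincipal irreducible sets.

   Strictness.  In Johnstone's dcpo every non-maximal point lies below all but finitely many
   maximal points, which makes the whole dcpo C-compact.  Here the chain of levels omega + 1 is replaced
   by subsets of omega x omega, where a top only dominates what lies below a set with more
   incomplete blocks {j} x omega.  Over infinitely many blocks each closed set X_t of
   points bounded by t is a directed supremum of such sets X_s contained in a principal ideal, and
   so on without end; adding all X_t as new points does not change the lattice of closed sets, so this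
   dcpo is not 2-complete.  Over two blocks the process stops after two steps, which gives a
   2-complete dcpo that is not weakly dominated.

   For the remaining inequality one needs irreducible sets that are not C-compact.  In the fan space
   any two nonempty open sets meet, although a set whose finite subsets are bounded is bounded; hence
   the sets contained in a principal ideal form a Scott-closed family, and C-compact sets are
   principal.  A Johnstone-like tower over the fan space is then weakly dominated but not dominated. *)

theory Submission
  imports Defs "HOL-Library.Extended_Nat"
begin

text \<open>The fan space answers two opposing demands. In the tower, the points of height at most k
  lie below a single point, while their supremum over k is the whole tower, which is C-compact and
  unbounded. To refute domination these levels must be irreducible; to keep weak domination they
  must not be C-compact. Over an antichain of tops the levels split into separate chains and are
  reducible; the fan ties the chains together, but so loosely that no new C-compact set arises. In
  the column posets every jump from a top to a higher one must use up something, or directed sets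
  could climb through infinitely many columns. A column with bound a and top h has
  \<open>gap h\<close> properly inside \<open>gap a\<close>, so the finite number of incomplete
  blocks drops with each jump; the same count, read downwards, is the rank. A set t admits a column
  with top t only while some block of t indexed by I is still complete. The size of I thus decides
  how often a bounded closed set can be approximated anew by sets inside principal ideals.\<close>

lemma dcpo_po: "dcpo r \<Longrightarrow> Partial_order r"
  by (simp add: dcpo_def)

lemma directed_bound:
  "directed r D \<Longrightarrow> x \<in> D \<Longrightarrow> y \<in> D \<Longrightarrow> \<exists>z\<in>D. (x, z) \<in> r \<and> (y, z) \<in> r"
  by (simp add: directed_def)

subsection \<open>Families of sets ordered by inclusion\<close>

lemma incl_iff: "(X, Y) \<in> relation_of (\<subseteq>) \<T> \<longleftrightarrow> X \<in> \<T> \<and> Y \<in> \<T> \<and> X \<subseteq> Y"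
  by (auto simp: relation_of_def)

lemma Field_incl: "Field (relation_of (\<subseteq>) \<T>) = \<T>"
  by (rule Field_relation_of) simp

lemma po_incl: "Partial_order (relation_of (\<subseteq>) \<T>)"
  unfolding order_on_defs Field_incl
  by (auto simp: refl_on_def trans_def antisym_def incl_iff)

lemma directed_incl:
  "directed (relation_of (\<subseteq>) \<T>) \<D> \<longleftrightarrow>
     \<D> \<noteq> {} \<and> \<D> \<subseteq> \<T> \<and> (\<forall>X\<in>\<D>. \<forall>Y\<in>\<D>. \<exists>Z\<in>\<D>. X \<subseteq> Z \<and> Y \<subseteq> Z)"
  unfolding directed_def Field_incl incl_iff by blast

lemma is_sup_incl:
  assumes "\<D> \<subseteq> \<T>"
  shows "is_sup (relation_of (\<subseteq>) \<T>) \<D> X \<longleftrightarrow>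
     X \<in> \<T> \<and> (\<forall>Y\<in>\<D>. Y \<subseteq> X) \<and> (\<forall>Z\<in>\<T>. (\<forall>Y\<in>\<D>. Y \<subseteq> Z) \<longrightarrow> X \<subseteq> Z)"
proof -
  have "Z \<in> Above (relation_of (\<subseteq>) \<T>) \<D> \<longleftrightarrow> Z \<in> \<T> \<and> (\<forall>Y\<in>\<D>. Y \<subseteq> Z)" for Z
    using assms by (auto simp: Above_def Field_incl incl_iff)
  then show ?thesis unfolding is_sup_def by (simp add: incl_iff) blast
qed

text \<open>Serves \<open>Gamma\<close>, \<open>C_Gamma\<close> and \<open>Irr_Gamma\<close> at
  once: in a family of Scott-closed sets every upper bound of \<D> contains the closure of
  \<Union>\<D>, so this closure is the supremum as soon as the family contains it.\<close>

lemma is_sup_incl_cl: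
  assumes "\<D> \<subseteq> \<T>" "\<And>X. X \<in> \<T> \<Longrightarrow> scott_closed r X" "cl r (\<Union>\<D>) \<in> \<T>"
  shows "is_sup (relation_of (\<subseteq>) \<T>) \<D> X \<longleftrightarrow> X = cl r (\<Union>\<D>)"
proof -
  have "is_sup (relation_of (\<subseteq>) \<T>) \<D> (cl r (\<Union>\<D>))"
    unfolding is_sup_incl[OF assms(1)]
  proof (intro conjI ballI impI)
    show "cl r (\<Union>\<D>) \<subseteq> Z" if "Z \<in> \<T>" "\<forall>Y\<in>\<D>. Y \<subseteq> Z" for Z
      using assms(2)[OF that(1)] that(2) unfolding cl_def by blast
  qed (use assms(3) in \<open>auto simp: cl_def\<close>)
  then show ?thesis using is_sup_unique[OF po_incl] by metis
qed

lemma scott_closed_incl: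
  assumes \<T>: "\<And>X. X \<in> \<T> \<Longrightarrow> scott_closed r X"
    and cl: "\<And>\<D>. directed (relation_of (\<subseteq>) \<T>) \<D> \<Longrightarrow> cl r (\<Union>\<D>) \<in> \<T>"
  shows "scott_closed (relation_of (\<subseteq>) \<T>) \<A> \<longleftrightarrow> \<A> \<subseteq> \<T> \<and> (\<forall>X\<in>\<A>. \<forall>Y\<in>\<T>. Y \<subseteq> X \<longrightarrow> Y \<in> \<A>) \<and>
     (\<forall>\<D>. directed (relation_of (\<subseteq>) \<T>) \<D> \<longrightarrow> \<D> \<subseteq> \<A> \<longrightarrow> cl r (\<Union>\<D>) \<in> \<A>)"
proof -
  have "is_sup (relation_of (\<subseteq>) \<T>) \<D> X \<longleftrightarrow> X = cl r (\<Union>\<D>)"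
    if "directed (relation_of (\<subseteq>) \<T>) \<D>" for \<D> X
    using is_sup_incl_cl[OF _ \<T> cl[OF that], of X] that by (auto simp: directed_incl)
  then have "(\<forall>\<D> X. directed (relation_of (\<subseteq>) \<T>) \<D> \<longrightarrow> \<D> \<subseteq> \<A> \<longrightarrow>
      is_sup (relation_of (\<subseteq>) \<T>) \<D> X \<longrightarrow> X \<in> \<A>) \<longleftrightarrow>
    (\<forall>\<D>. directed (relation_of (\<subseteq>) \<T>) \<D> \<longrightarrow> \<D> \<subseteq> \<A> \<longrightarrow> cl r (\<Union>\<D>) \<in> \<A>)"
    by simp
  moreover have "(\<forall>X\<in>\<A>. under (relation_of (\<subseteq>) \<T>) X \<subseteq> \<A>) \<longleftrightarrow>
    (\<forall>X\<in>\<A>. \<forall>Y\<in>\<T>. Y \<subseteq> X \<longrightarrow> Y \<in> \<A>)" if "\<A> \<subseteq> \<T>"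
    using that by (auto simp: under_def incl_iff)
  ultimately show ?thesis
    unfolding scott_closed_def Field_incl by auto
qed

lemma is_sup_greatest:
  assumes "Partial_order r" "z \<in> D" "\<And>x. x \<in> D \<Longrightarrow> (x, z) \<in> r"
  shows "is_sup r D y \<longleftrightarrow> y = z"
proof -
  have "(z, z) \<in> r" using assms(2,3) by blast
  then have "is_sup r D z" using assms(2,3) by (intro is_supI) (auto intro: FieldI1)
  then show ?thesis using is_sup_unique[OF assms(1)] by metis
qed

lemma finite_subset_directed_Union:
  assumes "finite k" "k \<subseteq> \<Union>R" "R \<noteq> {}" "\<forall>r\<in>R. \<forall>r'\<in>R. \<exists>r''\<in>R. r \<subseteq> r'' \<and> r' \<subseteq> r''"
  shows "\<exists>r\<in>R. k \<subseteq> r"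
  using assms(1,2)
proof (induction k)
  case empty
  then show ?case using assms(3) by blast
next
  case (insert p k)
  then obtain r r' where "r \<in> R" "k \<subseteq> r" "r' \<in> R" "p \<in> r'" by auto
  moreover from this obtain r'' where "r'' \<in> R" "r \<subseteq> r''" "r' \<subseteq> r''" using assms(4) by blast
  ultimately show ?case by blast
qed

section \<open>Closures, unions and principal ideals among Scott-closed sets\<close>

lemma cl_upper: "X \<in> \<D> \<Longrightarrow> X \<subseteq> cl r (\<Union>\<D>)"
  by (auto simp: cl_def)

lemma cl_Union_least: "scott_closed r F \<Longrightarrow> (\<And>X. X \<in> \<D> \<Longrightarrow> X \<subseteq> F) \<Longrightarrow> cl r (\<Union>\<D>) \<subseteq> F"
  by (auto simp: cl_def)

lemma scott_closed_cl_Union: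
  "(\<And>X. X \<in> \<D> \<Longrightarrow> scott_closed r X) \<Longrightarrow> scott_closed r (cl r (\<Union>\<D>))"
  by (rule scott_closed_cl) (auto dest: scott_closed_Field)

text \<open>A directed set that leaves F at some d lies in G: each of its elements is below one that
  is also above d, which is outside F and hence in G, and G is a lower set.\<close>

lemma scott_closed_Un:
  assumes "scott_closed r F" "scott_closed r G"
  shows "scott_closed r (F \<union> G)"
proof (rule scott_closedI)
  show "F \<union> G \<subseteq> Field r" using assms by (auto dest: scott_closed_Field)
  show "y \<in> F \<union> G" if "x \<in> F \<union> G" "(y, x) \<in> r" for x y
    using that assms by (auto dest: scott_closed_lower)
  fix D x assume D: "directed r D" "D \<subseteq> F \<union> G" "is_sup r D x"
  show "x \<in> F \<union> G"
  proof (cases "D \<subseteq> F")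
    case True
    then show ?thesis using scott_closed_sup[OF assms(1) D(1) _ D(3)] by blast
  next
    case False
    then obtain d where d: "d \<in> D" "d \<notin> F" by blast
    have DG: "\<exists>z\<in>G. z \<in> D \<and> (y, z) \<in> r" if y: "y \<in> D" for y
    proof -
      obtain z where "z \<in> D" "(y, z) \<in> r" "(d, z) \<in> r"
        using directed_bound[OF D(1) y d(1)] by blast
      moreover from this have "z \<notin> F" using d(2) scott_closed_lower[OF assms(1)] by blast
      ultimately show ?thesis using D(2) by blast
    qed
    have "D \<subseteq> G" using DG scott_closed_lower[OF assms(2)] by blast
    then show ?thesis using scott_closed_sup[OF assms(2) D(1) _ D(3)] by blast
  qed
qed

lemma scott_closed_Int:
  "scott_closed r F \<Longrightarrow> scott_closed r G \<Longrightarrow> scott_closed r (F \<inter> G)"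
  using scott_closed_Inter[of "{F, G}" r] by auto

lemma under_subset_iff:
  "Partial_order r \<Longrightarrow> scott_closed r F \<Longrightarrow> x \<in> Field r \<Longrightarrow> under r x \<subseteq> F \<longleftrightarrow> x \<in> F"
  by (auto simp: under_def dest: po_refl scott_closed_lower)

lemma directed_under:
  assumes "Partial_order r" "directed r D"
  shows "directed (Gamma r) (under r ` D)"
  unfolding Gamma_def directed_incl
proof (intro conjI ballI)
  show "under r ` D \<noteq> {}" using assms(2) by (auto simp: directed_def)
  show "under r ` D \<subseteq> {A. scott_closed r A}" using scott_closed_under[OF assms(1)] by auto
  fix X Y assume "X \<in> under r ` D" "Y \<in> under r ` D"
  then obtain x y where "x \<in> D" "y \<in> D" "X = under r x" "Y = under r y" by blast
  moreover from this obtain z where "z \<in> D" "(x, z) \<in> r" "(y, z) \<in> r"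
    using directed_bound[OF assms(2)] by blast
  ultimately have "X \<subseteq> under r z" "Y \<subseteq> under r z"
    using po_trans[OF assms(1)] by (auto simp: under_def)
  then show "\<exists>Z\<in>under r ` D. X \<subseteq> Z \<and> Y \<subseteq> Z" using \<open>z \<in> D\<close> by blast
qed

text \<open>Continuity of the embedding of points as principal ideals: a closed set that contains D
  contains its supremum.\<close>

lemma cl_under_sup:
  assumes "Partial_order r" "directed r D" "is_sup r D x"
  shows "cl r (\<Union>(under r ` D)) = under r x"
proof
  show "cl r (\<Union>(under r ` D)) \<subseteq> under r x"
    using is_sup_upper[OF assms(3)] po_trans[OF assms(1)]
    by (intro cl_Union_least scott_closed_under assms(1)) (auto simp: under_def)
  have D: "D \<subseteq> Field r" using assms(2) by (auto simp: directed_def)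
  have c: "scott_closed r (cl r (\<Union>(under r ` D)))"
    by (rule scott_closed_cl_Union) (auto intro: scott_closed_under assms(1))
  have "D \<subseteq> cl r (\<Union>(under r ` D))"
    using D po_refl[OF assms(1)] cl_upper by (fastforce simp: under_def)
  then have "x \<in> cl r (\<Union>(under r ` D))" by (rule scott_closed_sup[OF c assms(2) _ assms(3)])
  then show "under r x \<subseteq> cl r (\<Union>(under r ` D))" using c by (auto simp: scott_closed_def)
qed

section \<open>Scott-closed families of closed sets and C-compactness\<close>

lemma scott_closed_Gamma_iff:
  "scott_closed (Gamma r) \<A> \<longleftrightarrow> \<A> \<subseteq> {A. scott_closed r A} \<and>
     (\<forall>X\<in>\<A>. \<forall>Y. scott_closed r Y \<longrightarrow> Y \<subseteq> X \<longrightarrow> Y \<in> \<A>) \<and>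
     (\<forall>\<D>. directed (Gamma r) \<D> \<longrightarrow> \<D> \<subseteq> \<A> \<longrightarrow> cl r (\<Union>\<D>) \<in> \<A>)"
proof -
  have "scott_closed (Gamma r) \<A> \<longleftrightarrow> \<A> \<subseteq> {A. scott_closed r A} \<and>
     (\<forall>X\<in>\<A>. \<forall>Y\<in>{A. scott_closed r A}. Y \<subseteq> X \<longrightarrow> Y \<in> \<A>) \<and>
     (\<forall>\<D>. directed (Gamma r) \<D> \<longrightarrow> \<D> \<subseteq> \<A> \<longrightarrow> cl r (\<Union>\<D>) \<in> \<A>)"
    unfolding Gamma_def
  proof (rule scott_closed_incl)
    fix \<D> assume "directed (relation_of (\<subseteq>) {A. scott_closed r A}) \<D>"
    then have "\<D> \<subseteq> {A. scott_closed r A}" by (simp add: directed_incl)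
    then show "cl r (\<Union>\<D>) \<in> {A. scott_closed r A}"
      using scott_closed_cl_Union[of \<D> r] by blast
  qed simp
  then show ?thesis by simp
qed

lemma scott_closed_Gamma_mem: "scott_closed (Gamma r) \<A> \<Longrightarrow> X \<in> \<A> \<Longrightarrow> scott_closed r X"
  by (auto simp: scott_closed_Gamma_iff)

lemma scott_closed_Gamma_lower:
  "scott_closed (Gamma r) \<A> \<Longrightarrow> X \<in> \<A> \<Longrightarrow> scott_closed r Y \<Longrightarrow> Y \<subseteq> X \<Longrightarrow> Y \<in> \<A>"
  by (simp add: scott_closed_Gamma_iff)

lemma scott_closed_Gamma_sup:
  "scott_closed (Gamma r) \<A> \<Longrightarrow> directed (Gamma r) \<D> \<Longrightarrow> \<D> \<subseteq> \<A> \<Longrightarrow> cl r (\<Union>\<D>) \<in> \<A>"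
  by (simp add: scott_closed_Gamma_iff)

text \<open>A directed D in the union yields the directed family of ideals \<open>under r d\<close>,
  all members of the lower family \<A>. Its supremum in \<open>Gamma r\<close> is the ideal of the
  supremum of D, so \<A> contains that ideal.\<close>

lemma scott_closed_Union_Gamma:
  assumes "dcpo r" "scott_closed (Gamma r) \<A>"
  shows "scott_closed r (\<Union>\<A>)"
proof (rule scott_closedI)
  have po: "Partial_order r" using assms(1) by (simp add: dcpo_def)
  note \<A> = assms(2)[unfolded scott_closed_Gamma_iff]
  show "\<Union>\<A> \<subseteq> Field r" using \<A> by (auto dest: scott_closed_Field)
  have cl: "scott_closed r F" if "F \<in> \<A>" for F using \<A> that by blast
  show "y \<in> \<Union>\<A>" if "x \<in> \<Union>\<A>" "(y, x) \<in> r" for x y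
    using that scott_closed_lower[OF cl] by blast
  fix D x assume D: "directed r D" "D \<subseteq> \<Union>\<A>" "is_sup r D x"
  have "under r d \<in> \<A>" if d: "d \<in> D" for d
  proof -
    obtain F where F: "d \<in> F" "F \<in> \<A>" using D(2) d by blast
    have "under r d \<subseteq> F" using cl[OF F(2)] F(1) by (simp add: scott_closed_def)
    moreover have "scott_closed r (under r d)" by (rule scott_closed_under[OF po])
    ultimately show ?thesis using F(2) \<A> by simp
  qed
  then have "cl r (\<Union>(under r ` D)) \<in> \<A>"
    using \<A> directed_under[OF po D(1)] by (simp add: image_subset_iff)
  then have "under r x \<in> \<A>" using cl_under_sup[OF po D(1,3)] by simp
  then show "x \<in> \<Union>\<A>" using po_refl[OF po is_sup_Field[OF D(3)]] by (auto simp: under_def)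
qed

lemma cl_closed: "scott_closed r F \<Longrightarrow> cl r F = F"
  by (auto simp: cl_def)

text \<open>Since suprema of Scott-closed families are unions, C-compactness becomes a covering
  property; all later arguments use this form.\<close>

lemma C_compact_Gamma_iff:
  assumes "dcpo r"
  shows "C_compact (Gamma r) A \<longleftrightarrow> scott_closed r A \<and>
     (\<forall>\<A>. \<A> \<noteq> {} \<longrightarrow> scott_closed (Gamma r) \<A> \<longrightarrow> A \<subseteq> \<Union>\<A> \<longrightarrow> A \<in> \<A>)"
proof -
  have sup: "is_sup (Gamma r) \<A> X \<longleftrightarrow> X = \<Union>\<A>" if "scott_closed (Gamma r) \<A>" for \<A> X
  proof -
    have c: "scott_closed r (\<Union>\<A>)" by (rule scott_closed_Union_Gamma[OF assms that])
    have sub: "\<A> \<subseteq> {A. scott_closed r A}" using that by (simp add: scott_closed_Gamma_iff)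
    have "is_sup (Gamma r) \<A> X \<longleftrightarrow> X = cl r (\<Union>\<A>)"
      unfolding Gamma_def by (rule is_sup_incl_cl[OF sub]) (use c in \<open>simp_all add: cl_closed\<close>)
    then show ?thesis by (simp only: cl_closed[OF c])
  qed
  have "prec_star (Gamma r) A A \<longleftrightarrow>
     (\<forall>\<A>. \<A> \<noteq> {} \<longrightarrow> scott_closed (Gamma r) \<A> \<longrightarrow> (A, \<Union>\<A>) \<in> Gamma r \<longrightarrow> A \<in> \<A>)"
    unfolding prec_star_def by (metis sup)
  also have "\<dots> \<longleftrightarrow> (\<forall>\<A>. \<A> \<noteq> {} \<longrightarrow> scott_closed (Gamma r) \<A> \<longrightarrow> A \<subseteq> \<Union>\<A> \<longrightarrow> A \<in> \<A>)"
    if "scott_closed r A"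
    using that scott_closed_Union_Gamma[OF assms] by (simp add: Gamma_def incl_iff)
  finally show ?thesis
    unfolding C_compact_def by (auto simp: Gamma_def Field_incl)
qed

lemma C_compactD:
  "dcpo r \<Longrightarrow> C_compact (Gamma r) A \<Longrightarrow> \<A> \<noteq> {} \<Longrightarrow> scott_closed (Gamma r) \<A> \<Longrightarrow> A \<subseteq> \<Union>\<A> \<Longrightarrow> A \<in> \<A>"
  by (simp add: C_compact_Gamma_iff)

lemma C_compact_closed: "C_compact (Gamma r) A \<Longrightarrow> scott_closed r A"
  by (simp add: C_compact_def Gamma_def Field_incl)

lemma scott_closed_Gamma_principal:
  assumes "scott_closed r F"
  shows "scott_closed (Gamma r) {X. scott_closed r X \<and> X \<subseteq> F}"
  unfolding scott_closed_Gamma_iff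
proof (intro conjI allI impI)
  fix \<D> assume "\<D> \<subseteq> {X. scott_closed r X \<and> X \<subseteq> F}"
  then show "cl r (\<Union>\<D>) \<in> {X. scott_closed r X \<and> X \<subseteq> F}"
    using cl_Union_least[OF assms] scott_closed_cl_Union[of \<D> r] by blast
qed auto

text \<open>The closed subsets of F together with those of G form a Scott-closed family that covers
  A. The empty set is C-compact too, being a member of every nonempty lower family, and has to be
  excluded.\<close>

lemma C_compact_irreducible:
  assumes "dcpo r" "C_compact (Gamma r) A" "A \<noteq> {}"
  shows "irreducible_closed r A"
  unfolding irreducible_closed_def
proof (intro conjI allI impI)
  show "scott_closed r A" by (rule C_compact_closed[OF assms(2)])
  fix F G assume FG: "scott_closed r F" "scott_closed r G" "A \<subseteq> F \<union> G"
  let ?\<A> = "{X. scott_closed r X \<and> X \<subseteq> F} \<union> {X. scott_closed r X \<and> X \<subseteq> G}"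
  have F: "F \<in> ?\<A>" and G: "G \<in> ?\<A>" using FG by auto
  have "A \<in> ?\<A>"
  proof (rule C_compactD[OF assms(1,2)])
    show "?\<A> \<noteq> {}" using F by (metis empty_iff)
    show "scott_closed (Gamma r) ?\<A>"
      by (intro scott_closed_Un scott_closed_Gamma_principal FG)
    show "A \<subseteq> \<Union>?\<A>" using FG(3) Union_upper[OF F] Union_upper[OF G] by (meson Un_least subset_trans)
  qed
  then show "A \<subseteq> F \<or> A \<subseteq> G" by blast
qed fact

text \<open>A Scott-closed family that covers the closure covers each member of \<D>, so it contains
  these members and then their supremum. Directed suprema in \<open>C_Gamma\<close> are therefore
  those of \<open>Gamma\<close>.\<close>

lemma directed_C_Gamma:
  assumes "dcpo r" "directed (C_Gamma r) \<D>"
  shows "C_compact (Gamma r) (cl r (\<Union>\<D>))"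
proof -
  have \<D>: "\<D> \<noteq> {}" "\<And>X. X \<in> \<D> \<Longrightarrow> C_compact (Gamma r) X"
    and dir: "\<forall>X\<in>\<D>. \<forall>Y\<in>\<D>. \<exists>Z\<in>\<D>. X \<subseteq> Z \<and> Y \<subseteq> Z"
    using assms(2) by (auto simp: C_Gamma_def directed_incl)
  have dG: "directed (Gamma r) \<D>"
    using \<D> dir by (auto simp: Gamma_def directed_incl intro: C_compact_closed)
  have "cl r (\<Union>\<D>) \<in> \<A>"
    if \<A>: "\<A> \<noteq> {}" "scott_closed (Gamma r) \<A>" "cl r (\<Union>\<D>) \<subseteq> \<Union>\<A>" for \<A>
  proof -
    have "\<D> \<subseteq> \<A>"
    proof
      fix X assume X: "X \<in> \<D>"
      then have "X \<subseteq> \<Union>\<A>" using cl_upper \<A>(3) by blast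
      then show "X \<in> \<A>" using C_compactD[OF assms(1) \<D>(2)[OF X] \<A>(1,2)] by blast
    qed
    then show ?thesis using scott_closed_Gamma_sup[OF \<A>(2) dG] by blast
  qed
  then show ?thesis
    unfolding C_compact_Gamma_iff[OF assms(1)]
    using scott_closed_cl_Union[OF C_compact_closed[OF \<D>(2)]] by blast
qed

section \<open>Irreducible sets, and dominated dcpos as weakly dominated ones\<close>

lemma irreducible_imp_closed: "irreducible_closed r A \<Longrightarrow> scott_closed r A"
  by (simp add: irreducible_closed_def)

lemma irreducible_cases:
  "irreducible_closed r A \<Longrightarrow> scott_closed r F \<Longrightarrow> scott_closed r G \<Longrightarrow> A \<subseteq> F \<union> G \<Longrightarrow> A \<subseteq> F \<or> A \<subseteq> G"
  by (simp add: irreducible_closed_def)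

lemma directed_Irr_Gamma:
  assumes "directed (Irr_Gamma r) \<D>"
  shows "irreducible_closed r (cl r (\<Union>\<D>))"
  unfolding irreducible_closed_def
proof (intro conjI allI impI)
  have \<D>: "\<D> \<noteq> {}" "\<And>X. X \<in> \<D> \<Longrightarrow> irreducible_closed r X"
    and dir: "\<forall>X\<in>\<D>. \<forall>Y\<in>\<D>. \<exists>Z\<in>\<D>. X \<subseteq> Z \<and> Y \<subseteq> Z"
    using assms by (auto simp: Irr_Gamma_def directed_incl)
  show "scott_closed r (cl r (\<Union>\<D>))"
    using \<D>(2) by (intro scott_closed_cl_Union) (auto simp: irreducible_closed_def)
  show "cl r (\<Union>\<D>) \<noteq> {}"
    using \<D> cl_upper[of _ \<D> r] by (fastforce simp: irreducible_closed_def)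
  fix F G assume FG: "scott_closed r F" "scott_closed r G" "cl r (\<Union>\<D>) \<subseteq> F \<union> G"
  have X: "X \<subseteq> F \<or> X \<subseteq> G" if "X \<in> \<D>" for X
    using \<D>(2)[OF that] FG cl_upper[OF that, of r] unfolding irreducible_closed_def by blast
  \<comment> \<open>A member outside F and a member outside G would have an upper bound in \<D>
    contained in neither.\<close>
  have "(\<forall>X\<in>\<D>. X \<subseteq> F) \<or> (\<forall>X\<in>\<D>. X \<subseteq> G)"
    using X dir by (meson subset_trans)
  then show "cl r (\<Union>\<D>) \<subseteq> F \<or> cl r (\<Union>\<D>) \<subseteq> G"
    using cl_Union_least FG(1,2) by metis
qed

lemma scott_closed_C_Gamma_iff:
  assumes "dcpo r"
  shows "scott_closed (C_Gamma r) \<A> \<longleftrightarrow> \<A> \<subseteq> {A. C_compact (Gamma r) A} \<and>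
     (\<forall>X\<in>\<A>. \<forall>Y. C_compact (Gamma r) Y \<longrightarrow> Y \<subseteq> X \<longrightarrow> Y \<in> \<A>) \<and>
     (\<forall>\<D>. directed (C_Gamma r) \<D> \<longrightarrow> \<D> \<subseteq> \<A> \<longrightarrow> cl r (\<Union>\<D>) \<in> \<A>)"
proof -
  have "scott_closed (C_Gamma r) \<A> \<longleftrightarrow> \<A> \<subseteq> {A. C_compact (Gamma r) A} \<and>
     (\<forall>X\<in>\<A>. \<forall>Y\<in>{A. C_compact (Gamma r) A}. Y \<subseteq> X \<longrightarrow> Y \<in> \<A>) \<and>
     (\<forall>\<D>. directed (C_Gamma r) \<D> \<longrightarrow> \<D> \<subseteq> \<A> \<longrightarrow> cl r (\<Union>\<D>) \<in> \<A>)"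
    unfolding C_Gamma_def
    by (rule scott_closed_incl)
      (simp_all add: C_compact_closed directed_C_Gamma[OF assms, unfolded C_Gamma_def])
  then show ?thesis by simp
qed

lemma scott_closed_Irr_Gamma_iff:
  "scott_closed (Irr_Gamma r) \<A> \<longleftrightarrow> \<A> \<subseteq> {A. irreducible_closed r A} \<and>
     (\<forall>X\<in>\<A>. \<forall>Y. irreducible_closed r Y \<longrightarrow> Y \<subseteq> X \<longrightarrow> Y \<in> \<A>) \<and>
     (\<forall>\<D>. directed (Irr_Gamma r) \<D> \<longrightarrow> \<D> \<subseteq> \<A> \<longrightarrow> cl r (\<Union>\<D>) \<in> \<A>)"
proof -
  have "scott_closed (Irr_Gamma r) \<A> \<longleftrightarrow> \<A> \<subseteq> {A. irreducible_closed r A} \<and>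
     (\<forall>X\<in>\<A>. \<forall>Y\<in>{A. irreducible_closed r A}. Y \<subseteq> X \<longrightarrow> Y \<in> \<A>) \<and>
     (\<forall>\<D>. directed (Irr_Gamma r) \<D> \<longrightarrow> \<D> \<subseteq> \<A> \<longrightarrow> cl r (\<Union>\<D>) \<in> \<A>)"
    unfolding Irr_Gamma_def
    by (rule scott_closed_incl)
      (simp_all add: irreducible_imp_closed directed_Irr_Gamma[unfolded Irr_Gamma_def])
  then show ?thesis by simp
qed

text \<open>A directed family of C-compact sets differs from a directed family of irreducible sets
  only by the empty set. Removing it affects neither directedness nor the union, unless nothing is
  left.\<close>

lemma dominated_imp_weakly_dominated:
  assumes "dominated r"
  shows "weakly_dominated r"
  unfolding weakly_dominated_def
proof (intro conjI allI impI)
  show dc: "dcpo r" using assms by (simp add: dominated_def)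
  fix B assume B: "C_compact (Gamma r) B"
  show "scott_closed (C_Gamma r) {A. C_compact (Gamma r) A \<and> lhd r A B}"
    unfolding scott_closed_C_Gamma_iff[OF dc]
  proof (intro conjI ballI allI impI)
    show "Y \<in> {A. C_compact (Gamma r) A \<and> lhd r A B}"
      if "X \<in> {A. C_compact (Gamma r) A \<and> lhd r A B}" "C_compact (Gamma r) Y" "Y \<subseteq> X" for X Y
      using that unfolding lhd_def by blast
    fix \<D> assume dir: "directed (C_Gamma r) \<D>" and sub: "\<D> \<subseteq> {A. C_compact (Gamma r) A \<and> lhd r A B}"
    have c: "C_compact (Gamma r) (cl r (\<Union>\<D>))" by (rule directed_C_Gamma[OF dc dir])
    from dir have "\<D> \<noteq> {}" by (simp add: directed_def)
    then have "B \<noteq> {}" using sub by (auto simp: lhd_def)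
    then have irrB: "irreducible_closed r B" by (rule C_compact_irreducible[OF dc B])
    then have cB: "scott_closed (Irr_Gamma r) {A. irreducible_closed r A \<and> lhd r A B}"
      using assms by (simp add: dominated_def)
    have "lhd r (cl r (\<Union>\<D>)) B"
    proof (cases "\<D> = {{}}")
      case True
      then have "cl r (\<Union>\<D>) \<subseteq> F" if "scott_closed r F" for F using that by (auto simp: cl_def)
      then have "cl r (\<Union>\<D>) \<subseteq> under r b" for b
        using scott_closed_under[OF dcpo_po[OF dc]] by blast
      then show ?thesis using \<open>B \<noteq> {}\<close> unfolding lhd_def by blast
    next
      case False
      have dir': "\<forall>X\<in>\<D>. \<forall>Y\<in>\<D>. \<exists>Z\<in>\<D>. X \<subseteq> Z \<and> Y \<subseteq> Z"
        using dir by (auto simp: C_Gamma_def directed_incl)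
      have "\<D> - {{}} \<noteq> {}" using False \<open>\<D> \<noteq> {}\<close> by blast
      moreover have irr: "irreducible_closed r X" if "X \<in> \<D> - {{}}" for X
        using that sub C_compact_irreducible[OF dc] by blast
      moreover have "\<forall>X\<in>\<D>-{{}}. \<forall>Y\<in>\<D>-{{}}. \<exists>Z\<in>\<D>-{{}}. X \<subseteq> Z \<and> Y \<subseteq> Z"
        using dir' by (metis DiffE DiffI empty_iff insert_iff subset_empty)
      ultimately have "directed (Irr_Gamma r) (\<D> - {{}})"
        unfolding Irr_Gamma_def directed_incl by blast
      moreover have "\<D> - {{}} \<subseteq> {A. irreducible_closed r A \<and> lhd r A B}"
        using irr sub by blast
      ultimately have "lhd r (cl r (\<Union>(\<D> - {{}}))) B"
        using cB by (auto simp: scott_closed_Irr_Gamma_iff)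
      moreover have "\<Union>(\<D> - {{}}) = \<Union>\<D>" by blast
      ultimately show ?thesis by simp
    qed
    then show "cl r (\<Union>\<D>) \<in> {A. C_compact (Gamma r) A \<and> lhd r A B}" using c by blast
  qed auto
qed


subsection \<open>Orthogonality to maps in \<open>E2\<close>\<close>

locale two_extension =
  fixes r :: "'a rel" and s :: "'b rel" and t :: "'c rel" and e f
  assumes t: "dcpo t" and E2: "E2 r s e" and f: "f \<in> scott_maps r t"
begin

lemma po: "Partial_order r" "Partial_order s" "Partial_order t" and e: "e \<in> scott_maps r s"
  using E2 t by (auto simp: E2_def dcpo_def)

text \<open>The closed set of \<open>s\<close> that the isomorphism of closed-set lattices assigns
  to the preimage of F under \<open>f\<close>. \<open>E2_lift\<close> gives existence and
  \<open>E2_reflect\<close> uniqueness, so the choice is harmless.\<close>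

definition lift :: "'c set \<Rightarrow> 'b set" where
  "lift F = (SOME G. scott_closed s G \<and> pre r e G = pre r f F)"

lemma lift: "scott_closed t F \<Longrightarrow> scott_closed s (lift F) \<and> pre r e (lift F) = pre r f F"
  unfolding lift_def by (rule someI_ex) (metis E2_lift[OF E2 scott_closed_pre[OF po(1) f]])

text \<open>The value at \<open>b\<close> of the extension of \<open>f\<close> to a map from \<open>s\<close> to \<open>Gamma t\<close>.\<close>

definition K :: "'b \<Rightarrow> 'c set" where
  "K b = cl t (f ` pre r e (under s b))"

lemma K_closed: "scott_closed t (K b)"
  unfolding K_def by (rule scott_closed_cl) (auto simp: pre_def intro: scott_maps_Field[OF f])

text \<open>Both sides say that the ideal of b and \<open>lift F\<close> are comparable after
  pulling back along \<open>e\<close>, and \<open>E2_reflect\<close> removes \<open>e\<close>. This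
  adjunction makes \<open>K b\<close> the least closed F with b in \<open>lift F\<close>, so facts
  about \<open>K\<close> can be tested on closed sets.\<close>

lemma K_iff:
  assumes "b \<in> Field s" "scott_closed t F"
  shows "K b \<subseteq> F \<longleftrightarrow> b \<in> lift F"
proof -
  have "K b \<subseteq> F \<longleftrightarrow> f ` pre r e (under s b) \<subseteq> F"
    unfolding K_def by (rule cl_least_iff[OF assms(2)]) (auto simp: pre_def intro: scott_maps_Field[OF f])
  also have "\<dots> \<longleftrightarrow> pre r e (under s b) \<subseteq> pre r e (lift F)"
    unfolding conjunct2[OF lift[OF assms(2)]] by (auto simp: pre_def)
  also have "\<dots> \<longleftrightarrow> under s b \<subseteq> lift F"
    using E2_reflect[OF E2 scott_closed_under[OF po(2)] conjunct1[OF lift[OF assms(2)]]]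
    by (auto simp: pre_def)
  finally show ?thesis
    using under_subset_iff[OF po(2) conjunct1[OF lift[OF assms(2)]] assms(1)] by simp
qed

lemma K_e:
  assumes "a \<in> Field r"
  shows "K (e a) = under t (f a)"
proof -
  have "K (e a) \<subseteq> F \<longleftrightarrow> under t (f a) \<subseteq> F" if F: "scott_closed t F" for F
  proof -
    have "K (e a) \<subseteq> F \<longleftrightarrow> a \<in> pre r e (lift F)"
      using K_iff[OF scott_maps_Field[OF e assms] F] assms by (simp add: pre_def)
    also have "\<dots> \<longleftrightarrow> f a \<in> F" using lift[OF F] assms by (simp add: pre_def)
    finally show ?thesis
      using under_subset_iff[OF po(3) F scott_maps_Field[OF f assms]] by simp
  qed
  from this[OF K_closed] this[OF scott_closed_under[OF po(3)]] show ?thesis by blast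
qed

lemma K_mono:
  assumes "(b, c) \<in> s"
  shows "K b \<subseteq> K c"
proof -
  have bc: "b \<in> Field s" "c \<in> Field s" using assms by (auto intro: FieldI1 FieldI2)
  have "c \<in> lift (K c)" using K_iff[OF bc(2) K_closed] by blast
  then show ?thesis
    using K_iff[OF bc(1) K_closed] scott_closed_lower assms lift[OF K_closed] by metis
qed

lemma K_sup:
  assumes "directed s D" "is_sup s D x"
  shows "cl t (\<Union>(K ` D)) = K x"
proof -
  have D: "D \<subseteq> Field s" and x: "x \<in> Field s"
    using assms by (auto simp: directed_def is_sup_Field)
  have "cl t (\<Union>(K ` D)) \<subseteq> F \<longleftrightarrow> K x \<subseteq> F" if F: "scott_closed t F" for F
  proof -
    have cF: "scott_closed s (lift F)" using lift[OF F] by simp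
    have "\<Union>(K ` D) \<subseteq> Field t" using K_closed by (auto dest: scott_closed_Field)
    then have "cl t (\<Union>(K ` D)) \<subseteq> F \<longleftrightarrow> (\<forall>d\<in>D. K d \<subseteq> F)"
      using cl_least_iff[OF F] by blast
    also have "\<dots> \<longleftrightarrow> D \<subseteq> lift F" using K_iff[OF _ F] D by blast
    also have "\<dots> \<longleftrightarrow> x \<in> lift F"
      using scott_closed_sup[OF cF assms(1) _ assms(2)] scott_closed_lower[OF cF]
        is_sup_upper[OF assms(2)] by blast
    finally show ?thesis using K_iff[OF x F] by simp
  qed
  moreover have "scott_closed t (cl t (\<Union>(K ` D)))"
    using K_closed by (intro scott_closed_cl_Union) auto
  ultimately show ?thesis using K_closed by blast
qed

text \<open>\<open>lift {}\<close> has empty preimage under \<open>e\<close>, so by reflection it is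
  empty and cannot contain b.\<close>

lemma K_nonempty:
  assumes "b \<in> Field s"
  shows "K b \<noteq> {}"
proof
  assume "K b = {}"
  have c: "scott_closed t {}" by (rule scott_closedI) (auto simp: directed_def)
  have "b \<in> lift {}" using K_iff[OF assms c] \<open>K b = {}\<close> by simp
  moreover have "lift {} \<subseteq> {}"
  proof (rule E2_reflect[OF E2])
    show "scott_closed s (lift {})" using lift[OF c] by simp
    show "scott_closed s {}" by (rule scott_closedI) (auto simp: directed_def)
    show "pre r e (lift {}) \<subseteq> pre r e {}" using lift[OF c] by (simp add: pre_def)
  qed
  ultimately show False by blast
qed

lemma directed_K:
  assumes "directed s D" "\<And>d. d \<in> D \<Longrightarrow> K d \<in> \<T>"
  shows "directed (relation_of (\<subseteq>) \<T>) (K ` D)"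
  unfolding directed_incl
proof (intro conjI ballI)
  show "K ` D \<noteq> {}" using assms(1) by (auto simp: directed_def)
  show "K ` D \<subseteq> \<T>" using assms(2) by auto
  fix X Y assume "X \<in> K ` D" "Y \<in> K ` D"
  then obtain x y where xy: "x \<in> D" "y \<in> D" "X = K x" "Y = K y" by blast
  then obtain z where "z \<in> D" "(x, z) \<in> s" "(y, z) \<in> s"
    using directed_bound[OF assms(1)] by metis
  then show "\<exists>Z\<in>K ` D. X \<subseteq> Z \<and> Y \<subseteq> Z" using xy K_mono by blast
qed

text \<open>On points \<open>e a\<close> the values of \<open>K\<close> are principal, so by
  reflection the preimage of \<A> under \<open>K\<close> contains \<open>lift F\<close>. Closedness
  is asked of that preimage instead of \<A>, because the families used later are closed only
  relative to values of \<open>K\<close>; F may exceed \<open>K b\<close>, which allows F =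
  \<Union>\<A>.\<close>

lemma K_mem:
  assumes b: "b \<in> Field s" and F: "scott_closed t F" "K b \<subseteq> F"
    and \<A>: "\<And>x. x \<in> F \<Longrightarrow> under t x \<in> \<A>" "scott_closed s {b' \<in> Field s. K b' \<in> \<A>}"
  shows "K b \<in> \<A>"
proof -
  have "lift F \<subseteq> {b' \<in> Field s. K b' \<in> \<A>}"
  proof (rule E2_reflect[OF E2 _ \<A>(2)])
    show "pre r e (lift F) \<subseteq> pre r e {b' \<in> Field s. K b' \<in> \<A>}"
      unfolding conjunct2[OF lift[OF F(1)]]
      using \<A>(1) K_e scott_maps_Field[OF e] by (auto simp: pre_def)
  qed (use lift[OF F(1)] in simp)
  then show ?thesis using K_iff[OF b F(1)] F(2) by blast
qed

lemma scott_closed_pre_K: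
  assumes "\<And>X Y. X \<in> \<A> \<Longrightarrow> Y \<subseteq> X \<Longrightarrow> scott_closed t Y \<Longrightarrow> Y \<in> range K \<Longrightarrow> Y \<in> \<A>"
    and "\<And>D. directed s D \<Longrightarrow> K ` D \<subseteq> \<A> \<Longrightarrow> cl t (\<Union>(K ` D)) \<in> \<A>"
  shows "scott_closed s {b' \<in> Field s. K b' \<in> \<A>}"
proof (rule scott_closedI)
  show "y \<in> {b' \<in> Field s. K b' \<in> \<A>}" if "x \<in> {b' \<in> Field s. K b' \<in> \<A>}" "(y, x) \<in> s" for x y
    using that assms(1) K_mono[OF that(2)] K_closed by (auto intro: FieldI1)
  show "x \<in> {b' \<in> Field s. K b' \<in> \<A>}"
    if "directed s D" "D \<subseteq> {b' \<in> Field s. K b' \<in> \<A>}" "is_sup s D x" for D x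
  proof -
    have "K ` D \<subseteq> \<A>" using that(2) by blast
    then have "K x \<in> \<A>" using assms(2)[OF that(1)] K_sup[OF that(1,3)] by simp
    then show ?thesis using is_sup_Field[OF that(3)] by simp
  qed
qed auto

text \<open>Every x in \<Union>\<A> has its principal ideal in the lower family \<A>, so
  \<open>K_mem\<close> applies with F = \<Union>\<A>.\<close>

lemma C_compact_K:
  assumes "b \<in> Field s"
  shows "C_compact (Gamma t) (K b)"
  unfolding C_compact_Gamma_iff[OF t]
proof (intro conjI allI impI)
  fix \<A> assume \<A>: "scott_closed (Gamma t) \<A>" "K b \<subseteq> \<Union>\<A>"
  have F: "scott_closed t (\<Union>\<A>)" by (rule scott_closed_Union_Gamma[OF t \<A>(1)])
  show "K b \<in> \<A>"
  proof (rule K_mem[OF assms F \<A>(2)])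
    fix x assume "x \<in> \<Union>\<A>"
    then obtain X where X: "X \<in> \<A>" "x \<in> X" by blast
    then have "under t x \<subseteq> X" using scott_closed_Gamma_mem[OF \<A>(1)] by (simp add: scott_closed_def)
    then show "under t x \<in> \<A>"
      by (rule scott_closed_Gamma_lower[OF \<A>(1) X(1) scott_closed_under[OF po(3)]])
  next
    show "scott_closed s {b' \<in> Field s. K b' \<in> \<A>}"
    proof (rule scott_closed_pre_K)
      show "Y \<in> \<A>" if "X \<in> \<A>" "Y \<subseteq> X" "scott_closed t Y" for X Y
        by (rule scott_closed_Gamma_lower[OF \<A>(1) that(1,3,2)])
      show "cl t (\<Union>(K ` D)) \<in> \<A>" if "directed s D" "K ` D \<subseteq> \<A>" for D
        using scott_closed_Gamma_sup[OF \<A>(1) _ that(2)] directed_K[OF that(1)] K_closed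
        by (simp add: Gamma_def)
    qed
  qed
qed (rule K_closed)

text \<open>The points \<open>x\<close> of \<open>K b\<close> satisfy \<open>lhd t (under t x) (K b)\<close>, so if this condition is
  Scott-closed it passes to \<open>K b\<close>.\<close>

lemma K_principal:
  assumes b: "b \<in> Field s" and c: "scott_closed s {b' \<in> Field s. lhd t (K b') (K b)}"
  shows "\<exists>x\<in>Field t. K b = under t x"
proof -
  have "K b \<in> {X. lhd t X (K b)}"
    by (rule K_mem[OF b K_closed subset_refl]) (use c in \<open>auto simp: lhd_def\<close>)
  then obtain x where x: "x \<in> K b" "K b \<subseteq> under t x" by (auto simp: lhd_def)
  moreover have "under t x \<subseteq> K b" using K_closed x(1) by (simp add: scott_closed_def)
  ultimately show ?thesis using scott_closed_Field[OF K_closed x(1)] by blast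
qed

lemma extends:
  assumes "\<And>b. b \<in> Field s \<Longrightarrow> \<exists>x\<in>Field t. K b = under t x"
  shows "\<exists>g\<in>scott_maps s t. \<forall>x\<in>Field r. g (e x) = f x"
proof -
  obtain h where h: "\<And>b. b \<in> Field s \<Longrightarrow> h b \<in> Field t \<and> K b = under t (h b)"
    using assms by metis
  have inj: "x = y" if "under t x = under t y" "x \<in> Field t" "y \<in> Field t" for x y
    using that po_refl[OF po(3)] po_antisym[OF po(3)] unfolding under_def by blast
  define g where "g = (\<lambda>b\<in>Field s. h b)"
  have "is_sup t (g ` D) (g x)" if D: "directed s D" "is_sup s D x" for D x
  proof (rule is_supI)
    have x: "x \<in> Field s" and DF: "D \<subseteq> Field s"
      using D by (auto simp: directed_def is_sup_Field)
    show "g x \<in> Field t" using x h by (simp add: g_def)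
    have sub: "(h d, z) \<in> t \<longleftrightarrow> K d \<subseteq> under t z" if "d \<in> Field s" for d z
      using h[OF that] under_subset_iff[OF po(3) scott_closed_under[OF po(3)], of "h d" z]
      by (simp add: under_def)
    show "(y, g x) \<in> t" if "y \<in> g ` D" for y
    proof -
      obtain d where d: "d \<in> D" "y = g d" using \<open>y \<in> g ` D\<close> by blast
      then have "K d \<subseteq> under t (h x)"
        using K_mono[OF is_sup_upper[OF D(2) d(1)]] h[OF x] by simp
      then show ?thesis using d DF x sub by (auto simp: g_def)
    qed
    show "(g x, z) \<in> t" if z: "z \<in> Field t" "\<And>y. y \<in> g ` D \<Longrightarrow> (y, z) \<in> t" for z
    proof -
      have "K d \<subseteq> under t z" if "d \<in> D" for d
      proof -
        have "d \<in> Field s" using that DF by blast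
        then show ?thesis using z(2)[of "g d"] that sub by (simp add: g_def)
      qed
      then have "K x \<subseteq> under t z"
        unfolding K_sup[OF D, symmetric]
        by (intro cl_Union_least scott_closed_under po(3)) auto
      then show ?thesis using sub[OF x] x by (simp add: g_def)
    qed
  qed
  then have "g \<in> scott_maps s t" using h by (auto simp: scott_maps_def g_def)
  moreover have "g (e a) = f a" if "a \<in> Field r" for a
    using inj[of "h (e a)" "f a"] h K_e[OF that] scott_maps_Field[OF e that] scott_maps_Field[OF f that]
    by (simp add: g_def)
  ultimately show ?thesis by blast
qed

end

text \<open>That g y is below h y means that y lies in the preimage of \<open>under t (h y)\<close>
  under g, so reflection of closed sets orders maps into any dcpo t. Only the existence of
  extensions depends on t.\<close>

lemma orthogonal_if_principal:
  assumes t: "dcpo t" and "E2 r s e"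
    and principal: "\<And>f b. f \<in> scott_maps r t \<Longrightarrow> b \<in> Field s \<Longrightarrow>
      \<exists>x\<in>Field t. two_extension.K r s t e f b = under t x"
  shows "map_orthogonal r s e t"
proof -
  have po: "Partial_order r" "Partial_order s" "Partial_order t" and e: "e \<in> scott_maps r s"
    using assms(1,2) by (auto simp: E2_def dcpo_def)
  show ?thesis
  proof (rule orthogonalI[OF po(1,3) e])
    fix g h y assume gh: "g \<in> scott_maps s t" "h \<in> scott_maps s t"
      and le: "\<And>x. x \<in> Field r \<Longrightarrow> (g (e x), h (e x)) \<in> t" and y: "y \<in> Field s"
    let ?F = "under t (h y)"
    have "pre r e (pre s h ?F) \<subseteq> pre r e (pre s g ?F)"
      using le scott_maps_Field[OF e] by (auto simp: pre_def under_def intro: po_trans[OF po(3)])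
    then have "pre s h ?F \<subseteq> pre s g ?F"
      by (rule E2_reflect[OF assms(2) scott_closed_pre[OF po(2) gh(2) scott_closed_under[OF po(3)]]
            scott_closed_pre[OF po(2) gh(1) scott_closed_under[OF po(3)]]])
    then show "(g y, h y) \<in> t"
      using y po_refl[OF po(3) scott_maps_Field[OF gh(2) y]] by (auto simp: pre_def under_def)
  next
    fix f assume f: "f \<in> scott_maps r t"
    interpret two_extension r s t e f by unfold_locales fact+
    show "\<exists>g \<in> scott_maps s t. \<forall>x\<in>Field r. g (e x) = f x"
      by (rule extends) (rule principal[OF f])
  qed
qed

text \<open>The sets X with \<open>lhd t X (K b)\<close> have to be closed only among C-compact
  sets, since all values of \<open>K\<close> are C-compact; weak domination says exactly
  this.\<close>

theorem weakly_dominated_orthogonal: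
  assumes "weakly_dominated t" "E2 r s e"
  shows "map_orthogonal r s e t"
proof (rule orthogonal_if_principal[OF _ assms(2)])
  show t: "dcpo t" using assms(1) by (simp add: weakly_dominated_def)
  fix f b assume f: "f \<in> scott_maps r t" and b: "b \<in> Field s"
  interpret two_extension r s t e f by unfold_locales fact+
  let ?\<A> = "{A. C_compact (Gamma t) A \<and> lhd t A (K b)}"
  have c: "scott_closed (C_Gamma t) ?\<A>"
    using assms(1) C_compact_K[OF b] by (simp add: weakly_dominated_def)
  note c' = c[unfolded scott_closed_C_Gamma_iff[OF t]]
  have "scott_closed s {b' \<in> Field s. K b' \<in> {X. lhd t X (K b)}}"
  proof (rule scott_closed_pre_K)
    show "Y \<in> {X. lhd t X (K b)}" if "X \<in> {X. lhd t X (K b)}" "Y \<subseteq> X" for X Y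
      using that unfolding lhd_def by blast
    show "cl t (\<Union>(K ` D)) \<in> {X. lhd t X (K b)}"
      if D: "directed s D" "K ` D \<subseteq> {X. lhd t X (K b)}" for D
    proof -
      have "C_compact (Gamma t) (K d)" if "d \<in> D" for d
        using C_compact_K that D(1) by (auto simp: directed_def)
      then have "directed (C_Gamma t) (K ` D)" "K ` D \<subseteq> ?\<A>"
        unfolding C_Gamma_def using directed_K[OF D(1)] D(2) by auto
      then show ?thesis using c' by simp
    qed
  qed
  then show "\<exists>x\<in>Field t. K b = under t x" by (intro K_principal[OF b]) simp
qed

text \<open>By induction on the rank, all values of \<open>K\<close> in the relation
  \<open>lhd\<close> to a nonprincipal \<open>K b\<close> are principal. Their tops lie in the
  closed set \<open>K b\<close>, and so does the supremum of directed many tops; hence the relation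
  passes to suprema and \<open>K_principal\<close> gives a contradiction.\<close>

theorem rank_orthogonal:
  fixes m :: "'c set \<Rightarrow> nat"
  assumes t: "dcpo t"
    and rank: "\<And>X Y. irreducible_closed t X \<Longrightarrow> irreducible_closed t Y \<Longrightarrow> lhd t X Y \<Longrightarrow>
      \<forall>x\<in>Field t. X \<noteq> under t x \<Longrightarrow> \<forall>x\<in>Field t. Y \<noteq> under t x \<Longrightarrow> m X < m Y"
    and "E2 r s e"
  shows "map_orthogonal r s e t"
proof (rule orthogonal_if_principal[OF t assms(3)])
  fix f b assume f: "f \<in> scott_maps r t" and b: "b \<in> Field s"
  interpret two_extension r s t e f by unfold_locales fact+
  have irr: "irreducible_closed t (K b)" if "b \<in> Field s" for b
    using C_compact_irreducible[OF t C_compact_K[OF that] K_nonempty[OF that]] .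
  show "\<exists>x\<in>Field t. K b = under t x"
    using b
  proof (induction "m (K b)" arbitrary: b rule: less_induct)
    case less
    show ?case
    proof (rule ccontr)
      assume np: "\<not> (\<exists>x\<in>Field t. K b = under t x)"
      have *: "\<exists>x\<in>K b. K b' = under t x" if b': "b' \<in> Field s" "lhd t (K b') (K b)" for b'
      proof -
        have "\<exists>x\<in>Field t. K b' = under t x"
        proof (rule ccontr)
          assume np': "\<not> ?thesis"
          then have "m (K b') < m (K b)" using rank[OF irr irr] np b' less.prems by blast
          then show False using less.hyps b'(1) np' by blast
        qed
        then obtain x where x: "x \<in> Field t" "K b' = under t x" by blast
        obtain y where "y \<in> K b" "K b' \<subseteq> under t y" using b'(2) by (auto simp: lhd_def)
        then have "x \<in> K b"
          using x po_refl[OF po(3)] scott_closed_lower[OF K_closed] unfolding under_def by blast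
        then show ?thesis using x(2) by blast
      qed
      have "scott_closed s {b' \<in> Field s. K b' \<in> {X. lhd t X (K b)}}"
      proof (rule scott_closed_pre_K)
        show "Y \<in> {X. lhd t X (K b)}" if "X \<in> {X. lhd t X (K b)}" "Y \<subseteq> X" for X Y
          using that unfolding lhd_def by blast
        show "cl t (\<Union>(K ` D)) \<in> {X. lhd t X (K b)}"
          if D: "directed s D" "K ` D \<subseteq> {X. lhd t X (K b)}" for D
        proof -
          have "\<forall>d\<in>D. \<exists>x\<in>K b. K d = under t x"
            using * D by (auto simp: directed_def)
          then obtain h where h: "\<And>d. d \<in> D \<Longrightarrow> h d \<in> K b \<and> K d = under t (h d)" by metis
          have hF: "h d \<in> Field t" if "d \<in> D" for d
            using h[OF that] scott_closed_Field[OF K_closed] by blast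
          have hd: "directed t (h ` D)"
            unfolding directed_def
          proof (intro conjI ballI)
            show "h ` D \<noteq> {}" "h ` D \<subseteq> Field t" using D(1) hF by (auto simp: directed_def)
            fix x y assume "x \<in> h ` D" "y \<in> h ` D"
            then obtain a c where ac: "a \<in> D" "c \<in> D" "x = h a" "y = h c" by blast
            then obtain d where d: "d \<in> D" "(a, d) \<in> s" "(c, d) \<in> s"
              using directed_bound[OF D(1)] by metis
            have "under t x \<subseteq> under t (h d)" "under t y \<subseteq> under t (h d)"
              using K_mono[OF d(2)] K_mono[OF d(3)] h ac d(1) by auto
            then show "\<exists>z\<in>h ` D. (x, z) \<in> t \<and> (y, z) \<in> t"
              using po_refl[OF po(3) hF] ac d(1) unfolding under_def by blast
          qed
          then obtain z where z: "is_sup t (h ` D) z" using t unfolding dcpo_def by blast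
          have "h ` D \<subseteq> K b" using h by blast
          then have "z \<in> K b" by (rule scott_closed_sup[OF K_closed hd _ z])
          have "K ` D = under t ` h ` D" using h by (auto simp: image_iff)
          then have "cl t (\<Union>(K ` D)) = under t z" using cl_under_sup[OF po(3) hd z] by simp
          then show ?thesis using \<open>z \<in> K b\<close> by (auto simp: lhd_def)
        qed
      qed
      then have "\<exists>x\<in>Field t. K b = under t x" by (intro K_principal[OF less.prems]) simp
      then show False using np by blast
    qed
  qed
qed

subsection \<open>Criteria for weak domination\<close>

text \<open>The closed sets with an upper bound in A form a Scott-closed family that covers A, so A
  is bounded by one of its own elements. Closure under directed suprema comes from
  \<open>bounded\<close>: a finite subset of a directed union lies in one member and so has a bound
  in A.\<close>

lemma C_compact_principal:
  assumes r: "dcpo r" and A: "C_compact (Gamma r) A" "A \<noteq> {}"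
    and bounded: "\<And>S. S \<subseteq> A \<Longrightarrow> (\<And>S0. finite S0 \<Longrightarrow> S0 \<subseteq> S \<Longrightarrow> \<exists>a\<in>A. \<forall>x\<in>S0. (x, a) \<in> r) \<Longrightarrow>
      \<exists>a\<in>A. \<forall>x\<in>S. (x, a) \<in> r"
  shows "\<exists>a\<in>A. A = under r a"
proof -
  note po = dcpo_po[OF r]
  have c: "scott_closed r A" by (rule C_compact_closed[OF A(1)])
  have AF: "A \<subseteq> Field r" using c by (simp add: scott_closed_def)
  have und: "under r a \<subseteq> A" if "a \<in> A" for a using c that by (simp add: scott_closed_def)
  let ?\<A> = "{F. scott_closed r F \<and> (\<exists>a\<in>A. F \<subseteq> under r a)}"
  have mem: "under r a \<in> ?\<A>" if "a \<in> A" for a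
    using that scott_closed_under[OF po] by blast
  have "A \<in> ?\<A>"
  proof (rule C_compactD[OF r A(1)])
    show "?\<A> \<noteq> {}" using A(2) mem by blast
    show "A \<subseteq> \<Union>?\<A>"
    proof
      fix a assume a: "a \<in> A"
      then have "a \<in> under r a" using po_refl[OF po] AF by (auto simp: under_def)
      then show "a \<in> \<Union>?\<A>" using mem[OF a] by (rule UnionI[rotated])
    qed
    show "scott_closed (Gamma r) ?\<A>"
      unfolding scott_closed_Gamma_iff
    proof (intro conjI ballI allI impI)
      fix X Y assume "X \<in> ?\<A>" "scott_closed r Y" "Y \<subseteq> X"
      then show "Y \<in> ?\<A>" using subset_trans[of Y X] by blast
    next
      fix \<D> assume \<D>: "directed (Gamma r) \<D>" "\<D> \<subseteq> ?\<A>"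
      have dir: "\<D> \<noteq> {}" "\<forall>X\<in>\<D>. \<forall>Y\<in>\<D>. \<exists>Z\<in>\<D>. X \<subseteq> Z \<and> Y \<subseteq> Z"
        using \<D>(1) by (simp_all add: Gamma_def directed_incl)
      have below: "\<exists>a\<in>A. X \<subseteq> under r a" if "X \<in> \<D>" for X using \<D>(2) that by blast
      have "\<exists>a\<in>A. \<forall>x\<in>\<Union>\<D>. (x, a) \<in> r"
      proof (rule bounded)
        show "\<Union>\<D> \<subseteq> A" using below und by blast
        fix S0 assume "finite S0" "S0 \<subseteq> \<Union>\<D>"
        then obtain X where X: "X \<in> \<D>" "S0 \<subseteq> X" using finite_subset_directed_Union[OF _ _ dir] by blast
        then show "\<exists>a\<in>A. \<forall>x\<in>S0. (x, a) \<in> r" using below[OF X(1)] by (auto simp: under_def)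
      qed
      then obtain a where a: "a \<in> A" "\<Union>\<D> \<subseteq> under r a" by (auto simp: under_def)
      have "cl r (\<Union>\<D>) \<subseteq> under r a"
        using a(2) by (intro cl_Union_least scott_closed_under[OF po]) blast
      moreover have "scott_closed r (cl r (\<Union>\<D>))" using \<D>(2) by (intro scott_closed_cl_Union) blast
      ultimately show "cl r (\<Union>\<D>) \<in> ?\<A>" using a(1) by blast
    qed blast
  qed
  then show ?thesis using und by blast
qed

text \<open>Sets in the relation \<open>lhd\<close> to B are bounded, so only bounded C-compact sets
  have to be principal. A directed family of principal ideals has the ideal of the supremum of its
  tops as supremum, and the closed set B contains that point.\<close>

lemma weakly_dominated_if_principal:
  assumes r: "dcpo r"
    and principal: "\<And>A b. C_compact (Gamma r) A \<Longrightarrow> A \<noteq> {} \<Longrightarrow> A \<subseteq> under r b \<Longrightarrow> \<exists>a\<in>A. A = under r a"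
  shows "weakly_dominated r"
  unfolding weakly_dominated_def
proof (intro conjI allI impI r)
  note po = dcpo_po[OF r]
  fix B assume "C_compact (Gamma r) B"
  then have B: "scott_closed r B" by (rule C_compact_closed)
  let ?\<A> = "{A. C_compact (Gamma r) A \<and> lhd r A B}"
  show "scott_closed (C_Gamma r) ?\<A>"
    unfolding scott_closed_C_Gamma_iff[OF r]
  proof (intro conjI ballI allI impI)
    fix X Y assume "X \<in> ?\<A>" "C_compact (Gamma r) Y" "Y \<subseteq> X"
    then show "Y \<in> ?\<A>" unfolding lhd_def using subset_trans[of Y X] by blast
  next
    fix \<D> assume \<D>: "directed (C_Gamma r) \<D>" "\<D> \<subseteq> ?\<A>"
    have dir: "\<D> \<noteq> {}" "\<forall>X\<in>\<D>. \<forall>Y\<in>\<D>. \<exists>Z\<in>\<D>. X \<subseteq> Z \<and> Y \<subseteq> Z"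
      using \<D>(1) by (simp_all add: C_Gamma_def directed_incl)
    have pr: "\<exists>a\<in>X. X = under r a" if "X \<in> \<D>" "X \<noteq> {}" for X
      using that \<D>(2) principal unfolding lhd_def by blast
    have below: "\<exists>b\<in>B. X \<subseteq> under r b" if "X \<in> \<D>" for X
      using that \<D>(2) unfolding lhd_def by blast
    define D where "D = {d \<in> Field r. under r d \<in> \<D>}"
    have XD: "\<exists>d\<in>D. X = under r d" if X: "X \<in> \<D>" "X \<noteq> {}" for X
    proof -
      obtain a where a: "a \<in> X" "X = under r a" using pr[OF X] by blast
      then have "a \<in> Field r" by (auto simp: under_def intro: FieldI1)
      then show ?thesis using a X(1) by (auto simp: D_def)
    qed
    have self: "d \<in> under r d" if "d \<in> D" for d
      using that po_refl[OF po] by (simp add: D_def under_def)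
    have DB: "D \<subseteq> B"
    proof
      fix d assume d: "d \<in> D"
      then obtain b where "b \<in> B" "under r d \<subseteq> under r b" using below D_def by blast
      then show "d \<in> B" using self[OF d] scott_closed_lower[OF B] by (auto simp: under_def)
    qed
    have "\<exists>b\<in>B. \<forall>X\<in>\<D>. X \<subseteq> under r b"
    proof (cases "D = {}")
      \<comment> \<open>The empty set is then the only member of \<D>, and any point of B bounds
        it.\<close>
      case True
      then have "X = {}" if "X \<in> \<D>" for X using XD[OF that] by blast
      moreover obtain b where "b \<in> B" using dir(1) below by blast
      ultimately show ?thesis by blast
    next
      case False
      have "directed r D"
        unfolding directed_def
      proof (intro conjI ballI False)
        show "D \<subseteq> Field r" by (auto simp: D_def)
        fix x y assume xy: "x \<in> D" "y \<in> D"
        then obtain Z where Z: "Z \<in> \<D>" "under r x \<subseteq> Z" "under r y \<subseteq> Z"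
          using dir(2) unfolding D_def by blast
        then obtain z where z: "z \<in> D" "Z = under r z" using XD self[OF xy(1)] by blast
        then show "\<exists>z\<in>D. (x, z) \<in> r \<and> (y, z) \<in> r"
          using Z(2,3) self[OF xy(1)] self[OF xy(2)] by (auto simp: under_def)
      qed
      then obtain x where x: "is_sup r D x" using r by (auto simp: dcpo_def)
      have "x \<in> B" by (rule scott_closed_sup[OF B \<open>directed r D\<close> DB x])
      moreover have "X \<subseteq> under r x" if X: "X \<in> \<D>" for X
      proof (cases "X = {}")
        case False
        then obtain d where "d \<in> D" "X = under r d" using XD[OF X] by blast
        then show ?thesis
          using is_sup_upper[OF x] po_trans[OF po] by (auto simp: under_def)
      qed simp
      ultimately show ?thesis by blast
    qed
    then obtain b where b: "b \<in> B" "\<And>X. X \<in> \<D> \<Longrightarrow> X \<subseteq> under r b" by blast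
    have "cl r (\<Union>\<D>) \<subseteq> under r b" by (intro cl_Union_least scott_closed_under[OF po] b(2))
    then show "cl r (\<Union>\<D>) \<in> ?\<A>" using directed_C_Gamma[OF r \<D>(1)] b(1) by (auto simp: lhd_def)
  qed blast
qed

subsection \<open>Relabelling along an injection\<close>

text \<open>Each counterexample lives on a type that fits its construction and is moved to
  \<open>nat set set\<close> at the end.\<close>

definition relabel :: "('a \<Rightarrow> 'b) \<Rightarrow> 'a rel \<Rightarrow> 'b rel" where
  "relabel h r = map_prod h h ` r"

lemma Field_relabel: "Field (relabel h r) = h ` Field r"
  unfolding relabel_def Field_def by force

context
  fixes h :: "'a \<Rightarrow> 'b"
  assumes h: "inj h"
begin

lemma relabel_iff: "(h x, h y) \<in> relabel h r \<longleftrightarrow> (x, y) \<in> r"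
  unfolding relabel_def using inj_eq[OF h] by force

lemma under_relabel: "under (relabel h r) (h x) = h ` under r x"
  unfolding under_def relabel_def using inj_eq[OF h] by force

lemma Above_relabel: "Above (relabel h r) (h ` S) = h ` Above r S"
  unfolding Above_def Field_relabel by (auto simp: relabel_iff)

lemma is_sup_relabel: "is_sup (relabel h r) (h ` S) (h x) \<longleftrightarrow> is_sup r S x"
  unfolding is_sup_def Above_relabel by (auto simp: relabel_iff inj_image_mem_iff[OF h])

lemma directed_relabel: "directed (relabel h r) (h ` D) \<longleftrightarrow> directed r D"
  unfolding directed_def Field_relabel by (simp add: relabel_iff inj_image_subset_iff[OF h])

lemma is_sup_relabel_ex: "is_sup (relabel h r) S y \<Longrightarrow> \<exists>x. y = h x"
  using is_sup_Field[of "relabel h r" S y] unfolding Field_relabel by blast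

lemma directed_relabel_ex: "directed (relabel h r) D \<Longrightarrow> \<exists>D'. D = h ` D'"
  unfolding directed_def Field_relabel subset_image_iff by blast

lemma partial_order_relabel:
  assumes "Partial_order r"
  shows "Partial_order (relabel h r)"
proof -
  have refl: "(z, z) \<in> relabel h r" if z: "z \<in> Field (relabel h r)" for z
  proof -
    obtain x where x: "x \<in> Field r" "z = h x" using z unfolding Field_relabel by blast
    then show ?thesis using po_refl[OF assms x(1)] by (simp add: relabel_iff)
  qed
  moreover have "trans (relabel h r)"
  proof (rule transI)
    fix x y z assume xyz: "(x, y) \<in> relabel h r" "(y, z) \<in> relabel h r"
    obtain a b where ab: "x = h a" "y = h b" using xyz(1) unfolding relabel_def by auto
    obtain c where c: "z = h c" using xyz(2) unfolding relabel_def by auto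
    show "(x, z) \<in> relabel h r"
      using xyz po_trans[OF assms, of a b c] unfolding ab c by (simp add: relabel_iff)
  qed
  moreover have "antisym (relabel h r)"
  proof (rule antisymI)
    fix x y assume xy: "(x, y) \<in> relabel h r" "(y, x) \<in> relabel h r"
    obtain a b where ab: "x = h a" "y = h b" using xy(1) unfolding relabel_def by auto
    show "x = y" using xy po_antisym[OF assms, of a b] unfolding ab by (simp add: relabel_iff)
  qed
  ultimately show ?thesis
    unfolding order_on_defs refl_on_def by (auto intro: FieldI1 FieldI2)
qed

lemma dcpo_relabel:
  assumes "dcpo r"
  shows "dcpo (relabel h r)"
  unfolding dcpo_def
proof (intro conjI allI impI)
  show "Partial_order (relabel h r)" by (rule partial_order_relabel[OF dcpo_po[OF assms]])
  fix D assume "directed (relabel h r) D"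
  then obtain D' where D': "D = h ` D'" "directed r D'"
    using directed_relabel_ex directed_relabel by metis
  then obtain x where "is_sup r D' x" using assms by (auto simp: dcpo_def)
  then show "\<exists>x. is_sup (relabel h r) D x" using D'(1) is_sup_relabel by metis
qed

lemma scott_closed_relabel: "scott_closed (relabel h r) (h ` F) \<longleftrightarrow> scott_closed r F"
proof -
  have "(\<forall>D x. directed (relabel h r) D \<longrightarrow> D \<subseteq> h ` F \<longrightarrow> is_sup (relabel h r) D x \<longrightarrow> x \<in> h ` F) \<longleftrightarrow>
    (\<forall>D x. directed r D \<longrightarrow> D \<subseteq> F \<longrightarrow> is_sup r D x \<longrightarrow> x \<in> F)" (is "?L \<longleftrightarrow> ?R")
  proof
    assume L: ?L
    show ?R
    proof (intro allI impI)
      fix D x assume "directed r D" "D \<subseteq> F" "is_sup r D x"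
      then have "h x \<in> h ` F"
        using L[rule_format, of "h ` D" "h x"] by (simp add: directed_relabel is_sup_relabel image_mono)
      then show "x \<in> F" by (simp add: inj_image_mem_iff[OF h])
    qed
  next
    assume R: ?R
    show ?L
    proof (intro allI impI)
      fix D x assume D: "directed (relabel h r) D" "D \<subseteq> h ` F" "is_sup (relabel h r) D x"
      obtain D' where D': "D = h ` D'" using directed_relabel_ex[OF D(1)] by blast
      obtain y where y: "x = h y" using is_sup_relabel_ex[OF D(3)] by blast
      show "x \<in> h ` F"
        using D R[rule_format, of D' y] unfolding D' y
        by (simp add: directed_relabel is_sup_relabel inj_image_subset_iff[OF h])
    qed
  qed
  then show ?thesis
    unfolding scott_closed_def Field_relabel
    by (simp add: under_relabel inj_image_subset_iff[OF h])
qed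

lemma scott_closed_relabel_ex:
  assumes "scott_closed (relabel h r) G"
  shows "\<exists>F. G = h ` F"
  using assms unfolding scott_closed_def Field_relabel subset_image_iff by blast

lemma scott_closed_relabel_Collect:
  "{A. scott_closed (relabel h r) A} = image h ` {A. scott_closed r A}"
  using scott_closed_relabel_ex scott_closed_relabel by fastforce

end

text \<open>Makes \<open>Gamma\<close>, \<open>Irr_Gamma\<close> and \<open>C_Gamma\<close> of a
  relabelled poset relabellings along \<open>image h\<close>, so the invariance lemmas above apply
  again one type level higher.\<close>

lemma incl_relabel: "relation_of (\<subseteq>) (image h ` \<T>) = relabel (image h) (relation_of (\<subseteq>) \<T>)"
  if "inj h" for h
  unfolding relabel_def relation_of_def
  by (force simp: inj_image_subset_iff[OF that])

lemma inj_image: "inj h \<Longrightarrow> inj (image h)"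
  by (simp add: inj_on_def inj_image_eq_iff)

context
  fixes h :: "'a \<Rightarrow> 'b"
  assumes h: "inj h"
begin

lemma Gamma_relabel: "Gamma (relabel h r) = relabel (image h) (Gamma r)"
  unfolding Gamma_def scott_closed_relabel_Collect[OF h] by (rule incl_relabel[OF h])

lemma prec_star_relabel: "prec_star (relabel h q) (h x) (h x) \<longleftrightarrow> prec_star q x x"
proof
  assume L: "prec_star (relabel h q) (h x) (h x)"
  show "prec_star q x x"
    unfolding prec_star_def
  proof (intro allI impI)
    fix S s assume "S \<noteq> {}" "scott_closed q S" "is_sup q S s" "(x, s) \<in> q"
    then have "h x \<in> h ` S"
      using L[unfolded prec_star_def, rule_format, of "h ` S" "h s"]
      by (simp add: scott_closed_relabel[OF h] is_sup_relabel[OF h] relabel_iff[OF h])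
    then show "x \<in> S" by (simp add: inj_image_mem_iff[OF h])
  qed
next
  assume R: "prec_star q x x"
  show "prec_star (relabel h q) (h x) (h x)"
    unfolding prec_star_def
  proof (intro allI impI)
    fix S s assume S: "S \<noteq> {}" "scott_closed (relabel h q) S" "is_sup (relabel h q) S s"
      "(h x, s) \<in> relabel h q"
    obtain S' where S': "S = h ` S'" using scott_closed_relabel_ex[OF h S(2)] by blast
    obtain s' where s': "s = h s'" using is_sup_relabel_ex[OF h S(3)] by blast
    have "x \<in> S'"
      using R[unfolded prec_star_def, rule_format, of S' s'] S unfolding S' s'
      by (simp add: scott_closed_relabel[OF h] is_sup_relabel[OF h] relabel_iff[OF h])
    then show "h x \<in> S" unfolding S' by simp
  qed
qed

lemma C_compact_relabel: "C_compact (relabel h q) (h x) \<longleftrightarrow> C_compact q x"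
  unfolding C_compact_def prec_star_relabel Field_relabel by (simp add: inj_image_mem_iff[OF h])

lemma irreducible_relabel: "irreducible_closed (relabel h r) (h ` A) \<longleftrightarrow> irreducible_closed r A"
proof -
  have "(\<forall>F G. scott_closed (relabel h r) F \<longrightarrow> scott_closed (relabel h r) G \<longrightarrow> h ` A \<subseteq> F \<union> G \<longrightarrow>
      h ` A \<subseteq> F \<or> h ` A \<subseteq> G) \<longleftrightarrow>
    (\<forall>F G. scott_closed r F \<longrightarrow> scott_closed r G \<longrightarrow> A \<subseteq> F \<union> G \<longrightarrow> A \<subseteq> F \<or> A \<subseteq> G)" (is "?L \<longleftrightarrow> ?R")
  proof
    assume L: ?L
    show ?R
    proof (intro allI impI)
      fix F G assume "scott_closed r F" "scott_closed r G" "A \<subseteq> F \<union> G"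
      then show "A \<subseteq> F \<or> A \<subseteq> G"
        using L[rule_format, of "h ` F" "h ` G"]
        by (simp only: scott_closed_relabel[OF h] inj_image_subset_iff[OF h] image_Un[symmetric])
    qed
  next
    assume R: ?R
    show ?L
    proof (intro allI impI)
      fix F G assume FG: "scott_closed (relabel h r) F" "scott_closed (relabel h r) G" "h ` A \<subseteq> F \<union> G"
      obtain F' G' where FG': "F = h ` F'" "G = h ` G'"
        using scott_closed_relabel_ex[OF h] FG(1,2) by metis
      show "h ` A \<subseteq> F \<or> h ` A \<subseteq> G"
        using FG R[rule_format, of F' G'] unfolding FG'
        by (simp only: scott_closed_relabel[OF h] inj_image_subset_iff[OF h] image_Un[symmetric])
    qed
  qed
  then show ?thesis
    unfolding irreducible_closed_def scott_closed_relabel[OF h] by simp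
qed

lemma lhd_relabel: "lhd (relabel h r) (h ` A) (h ` B) \<longleftrightarrow> lhd r A B"
  unfolding lhd_def by (simp add: under_relabel[OF h] inj_image_subset_iff[OF h])

lemma dcpo_relabel_iff: "dcpo (relabel h r) \<longleftrightarrow> dcpo r"
proof
  assume L: "dcpo (relabel h r)"
  have "r = relabel (inv h) (relabel h r)"
    by (force simp: relabel_def image_image map_prod_def split_beta inv_f_f[OF h])
  note po = dcpo_po[OF L]
  have refl: "(x, x) \<in> r" if "x \<in> Field r" for x
    using po_refl[OF po, of "h x"] that by (simp add: Field_relabel relabel_iff[OF h])
  have "trans r" using po_trans[OF po] relabel_iff[OF h] by (meson transI)
  moreover have "antisym r"
    using po_antisym[OF po] relabel_iff[OF h] inj_eq[OF h] by (metis antisymI)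
  ultimately have "Partial_order r"
    using refl by (auto simp: order_on_defs refl_on_def intro: FieldI1 FieldI2)
  moreover have "\<exists>x. is_sup r D x" if D: "directed r D" for D
  proof -
    have "directed (relabel h r) (h ` D)" using D by (simp add: directed_relabel[OF h])
    then obtain y where y: "is_sup (relabel h r) (h ` D) y" using L by (auto simp: dcpo_def)
    then show ?thesis using is_sup_relabel_ex[OF h y] is_sup_relabel[OF h] by metis
  qed
  ultimately show "dcpo r" by (simp add: dcpo_def)
qed (rule dcpo_relabel[OF h])

end

lemma all_relabel:
  assumes "\<And>A. P (h A) \<longleftrightarrow> Q A" "\<And>B. P B \<Longrightarrow> \<exists>A. B = h A" "\<And>A. S (h A) \<longleftrightarrow> R A"
  shows "(\<forall>B. P B \<longrightarrow> S B) \<longleftrightarrow> (\<forall>A. Q A \<longrightarrow> R A)"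
  using assms by metis

lemma Collect_relabel:
  assumes "\<And>A. P (h A) \<longleftrightarrow> Q A" "\<And>B. P B \<Longrightarrow> \<exists>A. B = h A"
  shows "{B. P B} = h ` {A. Q A}"
  using assms by fastforce

context
  fixes h :: "'a \<Rightarrow> 'b"
  assumes h: "inj h"
begin

lemma C_compact_Gamma_relabel:
  "C_compact (Gamma (relabel h r)) (h ` A) \<longleftrightarrow> C_compact (Gamma r) A"
  unfolding Gamma_relabel[OF h] by (rule C_compact_relabel[OF inj_image[OF h]])

lemma C_compact_Gamma_relabel_ex:
  "C_compact (Gamma (relabel h r)) B \<Longrightarrow> \<exists>A. B = h ` A"
  using scott_closed_relabel_ex[OF h C_compact_closed] .

lemma weakly_dominated_relabel: "weakly_dominated (relabel h r) \<longleftrightarrow> weakly_dominated r"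
proof -
  have C: "C_Gamma (relabel h r) = relabel (image h) (C_Gamma r)"
  proof -
    have "{B. C_compact (Gamma (relabel h r)) B} = image h ` {A. C_compact (Gamma r) A}"
      by (rule Collect_relabel) (rule C_compact_Gamma_relabel, erule C_compact_Gamma_relabel_ex)
    then show ?thesis unfolding C_Gamma_def by (simp only: incl_relabel[OF h])
  qed
  have sub: "{A. C_compact (Gamma (relabel h r)) A \<and> lhd (relabel h r) A (h ` B)} =
      image h ` {A. C_compact (Gamma r) A \<and> lhd r A B}" for B
    by (rule Collect_relabel)
      (simp only: C_compact_Gamma_relabel lhd_relabel[OF h], erule conjE, erule C_compact_Gamma_relabel_ex)
  have "scott_closed (C_Gamma (relabel h r))
      {A. C_compact (Gamma (relabel h r)) A \<and> lhd (relabel h r) A (h ` B)} \<longleftrightarrow>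
    scott_closed (C_Gamma r) {A. C_compact (Gamma r) A \<and> lhd r A B}" for B
    unfolding C sub by (rule scott_closed_relabel[OF inj_image[OF h]])
  then show ?thesis
    unfolding weakly_dominated_def dcpo_relabel_iff[OF h]
    by (intro conj_cong refl all_relabel[where h = "image h"])
      (rule C_compact_Gamma_relabel C_compact_Gamma_relabel_ex; assumption?)+
qed

lemma irreducible_relabel_ex: "irreducible_closed (relabel h r) B \<Longrightarrow> \<exists>A. B = h ` A"
  using scott_closed_relabel_ex[OF h irreducible_imp_closed] .

lemma dominated_relabel: "dominated (relabel h r) \<longleftrightarrow> dominated r"
proof -
  have C: "Irr_Gamma (relabel h r) = relabel (image h) (Irr_Gamma r)"
  proof -
    have "{B. irreducible_closed (relabel h r) B} = image h ` {A. irreducible_closed r A}"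
      by (rule Collect_relabel) (rule irreducible_relabel[OF h], erule irreducible_relabel_ex)
    then show ?thesis unfolding Irr_Gamma_def by (simp only: incl_relabel[OF h])
  qed
  have sub: "{A. irreducible_closed (relabel h r) A \<and> lhd (relabel h r) A (h ` B)} =
      image h ` {A. irreducible_closed r A \<and> lhd r A B}" for B
    by (rule Collect_relabel)
      (simp only: irreducible_relabel[OF h] lhd_relabel[OF h], erule conjE, erule irreducible_relabel_ex)
  have "scott_closed (Irr_Gamma (relabel h r))
      {A. irreducible_closed (relabel h r) A \<and> lhd (relabel h r) A (h ` B)} \<longleftrightarrow>
    scott_closed (Irr_Gamma r) {A. irreducible_closed r A \<and> lhd r A B}" for B
    unfolding C sub by (rule scott_closed_relabel[OF inj_image[OF h]])
  then show ?thesis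
    unfolding dominated_def dcpo_relabel_iff[OF h]
    by (intro conj_cong refl all_relabel[where h = "image h"])
      (rule irreducible_relabel[OF h] irreducible_relabel_ex; assumption?)+
qed

end

subsection \<open>Column posets\<close>

definition gap :: "(nat \<times> nat) set \<Rightarrow> nat set" where
  "gap A = {j. \<exists>n. (j, n) \<notin> A}"

text \<open>A filter of subsets: supersets and finite intersections stay in it. Finiteness turns the
  number of incomplete blocks into a measure with values in \<open>nat\<close>.\<close>

definition gapped :: "nat set \<Rightarrow> (nat \<times> nat) set set" where
  "gapped I = {A. finite (gap A) \<and> gap A \<subseteq> I}"

lemma gap_antimono: "A \<subseteq> B \<Longrightarrow> gap B \<subseteq> gap A"
  by (auto simp: gap_def)

lemma gap_Int: "gap (A \<inter> B) = gap A \<union> gap B"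
  by (auto simp: gap_def)

lemma gapped_up: "A \<in> gapped I \<Longrightarrow> A \<subseteq> B \<Longrightarrow> B \<in> gapped I"
  using gap_antimono[of A B] by (auto simp: gapped_def intro: finite_subset)

lemma gapped_Int: "A \<in> gapped I \<Longrightarrow> B \<in> gapped I \<Longrightarrow> A \<inter> B \<in> gapped I"
  by (auto simp: gapped_def gap_Int)

lemma gapped_UNIV: "UNIV \<in> gapped I"
  by (simp add: gapped_def gap_def)

text \<open>For growing n these sets exhaust A from below, while block j stays incomplete in all of
  them.\<close>

definition trunc :: "(nat \<times> nat) set \<Rightarrow> nat \<Rightarrow> nat \<Rightarrow> (nat \<times> nat) set" where
  "trunc A j n = A - {j} \<times> {n..}"

lemma gap_trunc: "gap (trunc A j n) = insert j (gap A)"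
  by (auto simp: gap_def trunc_def)

lemma trunc_gapped: "A \<in> gapped I \<Longrightarrow> j \<in> I \<Longrightarrow> trunc A j n \<in> gapped I"
  by (simp add: gapped_def gap_trunc)

lemma trunc_mono: "m \<le> n \<Longrightarrow> trunc A j m \<subseteq> trunc A j n"
  by (auto simp: trunc_def)

lemma trunc_subset: "trunc A j n \<subseteq> A"
  by (auto simp: trunc_def)

lemma Union_trunc: "(\<Union>n. trunc A j n) = A"
proof
  show "A \<subseteq> (\<Union>n. trunc A j n)"
  proof
    fix x assume "x \<in> A"
    then have "x \<in> trunc A j (Suc (snd x))" by (cases x) (simp add: trunc_def)
    then show "x \<in> (\<Union>n. trunc A j n)" by blast
  qed
qed (use trunc_subset in blast)

type_synonym triple = "(nat \<times> nat) set \<times> (nat \<times> nat) set \<times> (nat \<times> nat) set"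

text \<open>The triple \<open>(a, h, r)\<close> is the point \<open>r\<close> of a column with top \<open>h\<close>; the top of the column
  lies above everything that is bounded by \<open>a\<close>. A degenerate triple \<open>(t, t, t)\<close> is an ideal point
  that separates the points bounded by \<open>t\<close> from the tops whose first component contains \<open>t\<close>.\<close>

fun triple_le :: "triple \<Rightarrow> triple \<Rightarrow> bool" where
  "triple_le (a, h, r) (a', h', r') \<longleftrightarrow> a = a' \<and> h = h' \<and> r \<subseteq> r' \<or> r' = h' \<and> r \<subseteq> a'"

text \<open>Since a \<subseteq> h gives \<open>gap h\<close> \<subseteq> \<open>gap a\<close>, the
  condition \<open>gap a \<noteq> gap h\<close> makes this inclusion proper: a top is strictly more
  complete than the bound of what it dominates. Ideal points are the only exception and form
  one-point columns.\<close>

definition triples :: "nat set \<Rightarrow> bool \<Rightarrow> triple set" where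
  "triples I ideal = {(a, h, r). a \<in> gapped I \<and> h \<in> gapped I \<and> r \<in> gapped I \<and> a \<subseteq> h \<and> r \<subseteq> h \<and>
     (gap a \<noteq> gap h \<or> ideal \<and> a = h \<and> r = h)}"

definition column_order :: "nat set \<Rightarrow> bool \<Rightarrow> triple rel" where
  "column_order I ideal = relation_of triple_le (triples I ideal)"

lemma triples_iff: "(a, h, r) \<in> triples I b \<longleftrightarrow> a \<in> gapped I \<and> h \<in> gapped I \<and> r \<in> gapped I \<and>
   a \<subseteq> h \<and> r \<subseteq> h \<and> (gap a \<noteq> gap h \<or> b \<and> a = h \<and> r = h)"
  by (simp add: triples_def)

lemma column_order_iff:
  "(x, y) \<in> column_order I b \<longleftrightarrow> x \<in> triples I b \<and> y \<in> triples I b \<and> triple_le x y"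
  by (simp add: column_order_def relation_of_def)

lemma triple_le_refl: "triple_le x x"
  by (cases x) simp

lemma Field_column_order: "Field (column_order I b) = triples I b"
  unfolding column_order_def by (rule Field_relation_of) (rule triple_le_refl)

lemma triples_ideal: "x \<in> triples I False \<Longrightarrow> x \<in> triples I True"
  by (cases x) (auto simp: triples_iff)

lemma triple_le_subset:
  "triple_le (a, h, r) (a', h', r') \<Longrightarrow> a' \<subseteq> h' \<Longrightarrow> r \<subseteq> r'"
  by auto

lemma po_column_order: "Partial_order (column_order I b)"
proof -
  have "triple_le x z" if "triple_le x y" "triple_le y z" "y \<in> triples I b" "z \<in> triples I b" for x y z
    using that by (cases x; cases y; cases z) (auto simp: triples_iff)
  moreover have "x = y" if "triple_le x y" "triple_le y x" "x \<in> triples I b" "y \<in> triples I b" for x y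
    using that by (cases x; cases y) (auto simp: triples_iff)
  ultimately have "trans (column_order I b)" "antisym (column_order I b)"
    unfolding trans_def antisym_def column_order_iff by blast+
  then show ?thesis
    unfolding order_on_defs refl_on_def Field_column_order
    by (auto simp: column_order_iff triple_le_refl)
qed

lemma is_sup_column:
  assumes "R \<noteq> {}" "{a} \<times> {h} \<times> R \<subseteq> triples I b"
  shows "is_sup (column_order I b) ({a} \<times> {h} \<times> R) (a, h, \<Union>R)"
proof (rule is_supI)
  obtain r0 where r0: "r0 \<in> R" using assms(1) by blast
  have mem: "(a, h, r) \<in> triples I b" if "r \<in> R" for r using assms(2) that by blast
  have "\<Union>R \<in> gapped I"
    by (rule gapped_up[of r0]) (use mem[OF r0] r0 in \<open>auto simp: triples_iff\<close>)
  \<comment> \<open>Equal gaps occur only for an ideal point, whose column has no other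
    element.\<close>
  moreover have "\<Union>R = h" if "gap a = gap h"
    using mem assms(1) that by (fastforce simp: triples_iff)
  moreover have "\<Union>R \<subseteq> h" using mem by (auto simp: triples_iff)
  ultimately have sup: "(a, h, \<Union>R) \<in> triples I b"
    using mem[OF r0] by (auto simp: triples_iff)
  then show "(a, h, \<Union>R) \<in> Field (column_order I b)" by (simp add: Field_column_order)
  show "(y, (a, h, \<Union>R)) \<in> column_order I b" if "y \<in> {a} \<times> {h} \<times> R" for y
    using that mem sup by (auto simp: column_order_iff)
  fix z assume z: "z \<in> Field (column_order I b)"
    and ub: "\<And>y. y \<in> {a} \<times> {h} \<times> R \<Longrightarrow> (y, z) \<in> column_order I b"
  obtain a' h' r' where z': "z = (a', h', r')" by (cases z)
  have le: "a = a' \<and> h = h' \<and> r \<subseteq> r' \<or> r' = h' \<and> r \<subseteq> a'" if "r \<in> R" for r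
    using ub[of "(a, h, r)"] that z' by (simp add: column_order_iff)
  have "a' \<subseteq> h'" using z z' by (simp add: Field_column_order triples_iff)
  have "triple_le (a, h, \<Union>R) z"
  proof (cases "a = a' \<and> h = h'")
    case True
    then have "r \<subseteq> r'" if "r \<in> R" for r using le[OF that] \<open>a' \<subseteq> h'\<close> by blast
    then show ?thesis using True unfolding z' by (simp add: Sup_le_iff)
  next
    case False
    then have "r' = h' \<and> r \<subseteq> a'" if "r \<in> R" for r using le[OF that] by blast
    then show ?thesis using r0 unfolding z' triple_le.simps Sup_le_iff by blast
  qed
  then show "((a, h, \<Union>R), z) \<in> column_order I b"
    using sup z by (simp add: column_order_iff Field_column_order)
qed

lemma is_sup_ideal:
  assumes "D \<noteq> {}" "D \<subseteq> triples I b"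
    and cofinal: "\<And>x. x \<in> D \<Longrightarrow> \<exists>t. (t, t, t) \<in> D \<and> triple_le x (t, t, t)"
  defines "u \<equiv> \<Union>{t. (t, t, t) \<in> D}"
  shows "is_sup (column_order I b) D (u, u, u)"
proof (rule is_supI)
  obtain t0 where t0: "(t0, t0, t0) \<in> D" using assms(1) cofinal by blast
  then have t0m: "(t0, t0, t0) \<in> triples I b" using assms(2) by blast
  have "u \<in> gapped I"
    by (rule gapped_up[of t0]) (use t0m t0 in \<open>auto simp: triples_iff u_def\<close>)
  then have sup: "(u, u, u) \<in> triples I b"
    using t0m by (auto simp: triples_iff)
  then show "(u, u, u) \<in> Field (column_order I b)" by (simp add: Field_column_order)
  show "(x, (u, u, u)) \<in> column_order I b" if x: "x \<in> D" for x
  proof -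
    obtain a h r where x': "x = (a, h, r)" by (cases x)
    obtain t where t: "(t, t, t) \<in> D" "triple_le x (t, t, t)" using cofinal[OF x] by blast
    then have "r \<subseteq> t" "t \<subseteq> u" by (auto simp: x' u_def)
    then have "triple_le x (u, u, u)" by (auto simp: x')
    then show ?thesis using sup x assms(2) by (auto simp: column_order_iff)
  qed
  fix z assume z: "z \<in> Field (column_order I b)"
    and ub: "\<And>x. x \<in> D \<Longrightarrow> (x, z) \<in> column_order I b"
  obtain a' h' r' where z': "z = (a', h', r')" by (cases z)
  have "a' \<subseteq> h'" "r' \<subseteq> h'" using z z' by (simp_all add: Field_column_order triples_iff)
  \<comment> \<open>This covers an upper bound in the column of the ideal point too, where a', h'
    and r' all equal t.\<close>
  then have le: "r' = h' \<and> t \<subseteq> a'" if "(t, t, t) \<in> D" for t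
    using ub[OF that] z' by (auto simp: column_order_iff)
  then have "r' = h'" "u \<subseteq> a'" using t0 unfolding u_def by blast+
  then have "triple_le (u, u, u) z" by (simp add: z')
  then show "((u, u, u), z) \<in> column_order I b"
    using sup z by (simp add: column_order_iff Field_column_order)
qed

text \<open>A jump to a new column top strictly decreases the gap, unless it leads to an ideal point.\<close>

lemma directed_column_order_cases:
  assumes D: "directed (column_order I b) D"
  obtains (greatest) z where "z \<in> D" "\<And>x. x \<in> D \<Longrightarrow> (x, z) \<in> column_order I b"
  | (column) a h R where "D = {a} \<times> {h} \<times> R" "R \<noteq> {}" "\<forall>r\<in>R. \<forall>r'\<in>R. \<exists>r''\<in>R. r \<subseteq> r'' \<and> r' \<subseteq> r''"
  | (ideal) "b" "\<And>x. x \<in> D \<Longrightarrow> \<exists>t. (t, t, t) \<in> D \<and> triple_le x (t, t, t)"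
proof -
  have DF: "D \<subseteq> triples I b" and ne: "D \<noteq> {}"
    using D by (auto simp: directed_def Field_column_order)
  have bound: "\<exists>z\<in>D. triple_le x z \<and> triple_le y z" if "x \<in> D" "y \<in> D" for x y
    using directed_bound[OF D that] by (auto simp: column_order_iff)
  show thesis
  proof (cases "\<exists>a h. D \<subseteq> {a} \<times> {h} \<times> UNIV")
    case True
    then obtain a h where ah: "D \<subseteq> {a} \<times> {h} \<times> UNIV" by blast
    define R where "R = {r. (a, h, r) \<in> D}"
    have DR: "D = {a} \<times> {h} \<times> R" using ah by (auto simp: R_def)
    have sub: "a \<subseteq> h" if "r \<in> R" for r
    proof -
      have "(a, h, r) \<in> triples I b" using that DF R_def by blast
      then show ?thesis by (simp add: triples_iff)
    qed
    have "\<exists>r''\<in>R. r \<subseteq> r'' \<and> r' \<subseteq> r''" if rr: "r \<in> R" "r' \<in> R" for r r'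
    proof -
      have "(a, h, r) \<in> D" "(a, h, r') \<in> D" using rr DR by auto
      from bound[OF this] obtain z where z: "z \<in> D" "triple_le (a, h, r) z" "triple_le (a, h, r') z"
        by blast
      obtain s where s: "z = (a, h, s)" using z(1) ah by blast
      have "s \<in> R" using z(1) s R_def by blast
      moreover have "r \<subseteq> s" "r' \<subseteq> s" using z(2,3) sub[OF rr(1)] unfolding s triple_le.simps by blast+
      ultimately have "s \<in> R" "r \<subseteq> s" "r' \<subseteq> s" by auto
      then show ?thesis by blast
    qed
    then show thesis using column[OF DR] ne DR by blast
  next
    case False
    define tops where "tops = {h. \<exists>a. (a, h, h) \<in> D}"
    \<comment> \<open>An upper bound of elements of two different columns is reached from at least
      one of them by a jump, so it is a column top.\<close>
    have "\<exists>h. h \<in> tops"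
    proof -
      obtain a1 h1 r1 where x1: "(a1, h1, r1) \<in> D" using ne by (metis all_not_in_conv prod_cases3)
      have "\<not> D \<subseteq> {a1} \<times> {h1} \<times> UNIV" using False by blast
      then obtain y where y: "y \<in> D" "y \<notin> {a1} \<times> {h1} \<times> UNIV" by blast
      obtain a2 h2 r2 where y': "y = (a2, h2, r2)" by (cases y)
      have x2: "(a2, h2, r2) \<in> D" "(a2, h2) \<noteq> (a1, h1)" using y unfolding y' by auto
      obtain z where z': "z \<in> D" "triple_le (a1, h1, r1) z" "triple_le (a2, h2, r2) z"
        using bound[OF x1 x2(1)] by blast
      obtain a h r where "z = (a, h, r)" by (cases z)
      then have z: "(a, h, r) \<in> D" "triple_le (a1, h1, r1) (a, h, r)"
        "triple_le (a2, h2, r2) (a, h, r)" using z' by simp_all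
      have "r = h" using z(2,3) x2(2) unfolding triple_le.simps by blast
      then show ?thesis using z(1) by (auto simp: tops_def)
    qed
    \<comment> \<open>A top of D with the fewest incomplete blocks. An element of D strictly above
      it cannot have a smaller gap, so its own two gaps agree and it is an ideal point.\<close>
    then obtain h where h: "h \<in> tops" "\<And>h'. h' \<in> tops \<Longrightarrow> card (gap h) \<le> card (gap h')"
      using ex_has_least_nat[of "\<lambda>h. h \<in> tops" _ "\<lambda>h. card (gap h)"] by blast
    then obtain a where z: "(a, h, h) \<in> D" by (auto simp: tops_def)
    have above: "b \<and> w = (h', h', h')"
      if w: "w \<in> D" "triple_le (a, h, h) w" "w \<noteq> (a, h, h)" "h' = fst (snd w)" for w h'
    proof -
      obtain a' r' where w': "w = (a', h', r')" using w(4) by (cases w) auto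
      have wt: "(a', h', r') \<in> triples I b" using w(1) DF w' by blast
      have jump: "r' = h'" "h \<subseteq> a'"
        using w(2,3) wt unfolding w' by (auto simp: triples_iff)
      have fin: "finite (gap h)" using z DF by (auto simp: triples_iff gapped_def)
      have sub: "gap h' \<subseteq> gap a'" "gap a' \<subseteq> gap h"
        using wt jump(2) by (auto simp: triples_iff dest: gap_antimono)
      have "h' \<in> tops" using w(1) w' jump(1) by (auto simp: tops_def)
      then have "card (gap h) \<le> card (gap h')" by (rule h(2))
      then have "gap h' = gap h"
        using card_seteq[OF fin _] sub by blast
      then have "gap a' = gap h'" using sub by blast
      then show ?thesis using wt w' by (auto simp: triples_iff)
    qed
    show thesis
    proof (cases "\<forall>x\<in>D. triple_le x (a, h, h)")
      case True
      then show thesis using greatest[OF z] z DF by (auto simp: column_order_iff)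
    next
      case nonmax: False
      then obtain x0 where x0: "x0 \<in> D" "\<not> triple_le x0 (a, h, h)" by blast
      have tr: "triple_le x z" if "triple_le x y" "triple_le y z" "x \<in> D" "y \<in> D" "z \<in> D" for x y z
        using po_trans[OF po_column_order, of x y I b z] that DF by (auto simp: column_order_iff)
      \<comment> \<open>Directedness yields an element of D above x, x0 and the chosen top; as x0 is
        not below that top, this element is strictly above it.\<close>
      have *: "b \<and> (\<exists>t. (t, t, t) \<in> D \<and> triple_le x (t, t, t))" if x: "x \<in> D" for x
      proof -
        obtain w1 where w1: "w1 \<in> D" "triple_le (a, h, h) w1" "triple_le x0 w1"
          using bound[OF z x0(1)] by blast
        obtain w where w: "w \<in> D" "triple_le w1 w" "triple_le x w"
          using bound[OF w1(1) x] by blast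
        have le: "triple_le (a, h, h) w" by (rule tr[OF w1(2) w(2) z w1(1) w(1)])
        have "triple_le x0 w" by (rule tr[OF w1(3) w(2) x0(1) w1(1) w(1)])
        then have "w \<noteq> (a, h, h)" using x0(2) by blast
        from above[OF w(1) le this refl] show ?thesis using w(1,3) by metis
      qed
      then have b using ne by blast
      then show thesis using ideal * by blast
    qed
  qed
qed

lemma dcpo_column_order: "dcpo (column_order I b)"
  unfolding dcpo_def
proof (intro conjI allI impI)
  fix D assume D: "directed (column_order I b) D"
  then have DF: "D \<subseteq> triples I b" and ne: "D \<noteq> {}"
    by (auto simp: directed_def Field_column_order)
  from D show "\<exists>x. is_sup (column_order I b) D x"
  proof (cases rule: directed_column_order_cases)
    case (greatest z)
    have "is_sup (column_order I b) D z"
      using is_sup_greatest[OF po_column_order greatest] by simp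
    then show ?thesis ..
  next
    case (column a h R)
    have "is_sup (column_order I b) D (a, h, \<Union>R)"
      unfolding column(1) by (rule is_sup_column[OF column(2)]) (use DF column(1) in simp)
    then show ?thesis ..
  next
    case ideal
    show ?thesis using is_sup_ideal[OF ne DF ideal(2)] by (rule exI)
  qed
qed (rule po_column_order)

lemma directed_column:
  assumes "R \<noteq> {}" "\<forall>r\<in>R. \<forall>r'\<in>R. \<exists>r''\<in>R. r \<subseteq> r'' \<and> r' \<subseteq> r''" "{a} \<times> {h} \<times> R \<subseteq> triples I b"
  shows "directed (column_order I b) ({a} \<times> {h} \<times> R)"
  unfolding directed_def Field_column_order
proof (intro conjI ballI)
  fix x y assume "x \<in> {a} \<times> {h} \<times> R" "y \<in> {a} \<times> {h} \<times> R"
  then obtain r r' where rr: "x = (a, h, r)" "y = (a, h, r')" "r \<in> R" "r' \<in> R" by blast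
  then obtain r'' where "r'' \<in> R" "r \<subseteq> r''" "r' \<subseteq> r''" using assms(2) by blast
  then show "\<exists>z\<in>{a} \<times> {h} \<times> R. (x, z) \<in> column_order I b \<and> (y, z) \<in> column_order I b"
    using rr assms(3) by (intro bexI[of _ "(a, h, r'')"]) (auto simp: column_order_iff)
qed (use assms in auto)

lemma scott_closed_column:
  assumes "scott_closed (column_order I b) F" "{a} \<times> {h} \<times> R \<subseteq> F"
    and "R \<noteq> {}" "\<forall>r\<in>R. \<forall>r'\<in>R. \<exists>r''\<in>R. r \<subseteq> r'' \<and> r' \<subseteq> r''"
  shows "(a, h, \<Union>R) \<in> F"
proof -
  have "F \<subseteq> triples I b" using assms(1) by (simp add: scott_closed_def Field_column_order)
  then have sub: "{a} \<times> {h} \<times> R \<subseteq> triples I b" using assms(2) by (rule subset_trans[rotated])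
  show ?thesis
    by (rule scott_closed_sup[OF assms(1) directed_column[OF assms(3,4) sub] assms(2)
          is_sup_column[OF assms(3) sub]])
qed

text \<open>Without ideal points a directed set has a greatest element or stays in one column, so
  unions along a column are the only suprema to check.\<close>

lemma scott_closed_column_orderI:
  assumes "F \<subseteq> triples I False"
    and lower: "\<And>x y. x \<in> F \<Longrightarrow> y \<in> triples I False \<Longrightarrow> triple_le y x \<Longrightarrow> y \<in> F"
    and sup: "\<And>a h R. R \<noteq> {} \<Longrightarrow> \<forall>r\<in>R. \<forall>r'\<in>R. \<exists>r''\<in>R. r \<subseteq> r'' \<and> r' \<subseteq> r'' \<Longrightarrow>
      {a} \<times> {h} \<times> R \<subseteq> F \<Longrightarrow> (a, h, \<Union>R) \<in> triples I False \<Longrightarrow> (a, h, \<Union>R) \<in> F"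
  shows "scott_closed (column_order I False) F"
proof (rule scott_closedI)
  show "F \<subseteq> Field (column_order I False)" using assms(1) by (simp add: Field_column_order)
  show "y \<in> F" if "x \<in> F" "(y, x) \<in> column_order I False" for x y
    using that lower by (simp add: column_order_iff)
  fix D x assume D: "directed (column_order I False) D" "D \<subseteq> F" "is_sup (column_order I False) D x"
  from D(1) show "x \<in> F"
  proof (cases rule: directed_column_order_cases)
    case (greatest z)
    then have "x = z" using is_sup_greatest[OF po_column_order greatest] D(3) by simp
    then show ?thesis using greatest(1) D(2) by blast
  next
    case (column a h R)
    have DF: "{a} \<times> {h} \<times> R \<subseteq> F" using D(2) column(1) by simp
    have "is_sup (column_order I False) D (a, h, \<Union>R)"
      unfolding column(1) by (rule is_sup_column[OF column(2) subset_trans[OF DF assms(1)]])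
    then have x: "x = (a, h, \<Union>R)" by (rule is_sup_unique[OF po_column_order D(3)])
    have "x \<in> triples I False" using is_sup_Field[OF D(3)] by (simp add: Field_column_order)
    then show ?thesis using sup[OF column(2,3) DF] x by simp
  qed simp
qed

text \<open>The points that an ideal point \<open>(t, t, t)\<close> would dominate.\<close>

definition bounded_by :: "nat set \<Rightarrow> (nat \<times> nat) set \<Rightarrow> triple set" where
  "bounded_by I t = {(a, h, r). (a, h, r) \<in> triples I False \<and> r \<subseteq> t}"

lemma bounded_by_iff: "(a, h, r) \<in> bounded_by I t \<longleftrightarrow> (a, h, r) \<in> triples I False \<and> r \<subseteq> t"
  by (simp add: bounded_by_def)

lemma bounded_by_triples: "bounded_by I t \<subseteq> triples I False"
  by (auto simp: bounded_by_def)

lemma bounded_by_mono: "s \<subseteq> t \<Longrightarrow> bounded_by I s \<subseteq> bounded_by I t"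
  by (auto simp: bounded_by_def)

lemma scott_closed_bounded_by: "scott_closed (column_order I False) (bounded_by I t)"
proof (rule scott_closed_column_orderI[OF bounded_by_triples])
  show "y \<in> bounded_by I t" if "x \<in> bounded_by I t" "y \<in> triples I False" "triple_le y x" for x y
    using that by (cases x; cases y) (auto simp: bounded_by_iff triples_iff)
  show "(a, h, \<Union>R) \<in> bounded_by I t"
    if "{a} \<times> {h} \<times> R \<subseteq> bounded_by I t" "(a, h, \<Union>R) \<in> triples I False" for a h R
  proof -
    have "r \<subseteq> t" if "r \<in> R" for r
    proof -
      have "(a, h, r) \<in> bounded_by I t"
        using \<open>{a} \<times> {h} \<times> R \<subseteq> bounded_by I t\<close> that by blast
      then show ?thesis by (simp add: bounded_by_iff)
    qed
    then show ?thesis using that(2) by (simp add: bounded_by_iff Sup_le_iff)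
  qed
qed

text \<open>Meet-continuity: \<open>r\<close> is the directed union of the sets \<open>r \<inter> t\<close>.\<close>

lemma bounded_by_Union:
  assumes F: "scott_closed (column_order I False) F"
    and \<U>: "\<U> \<noteq> {}" "\<U> \<subseteq> gapped I" "\<forall>t\<in>\<U>. \<forall>t'\<in>\<U>. \<exists>t''\<in>\<U>. t \<subseteq> t'' \<and> t' \<subseteq> t''"
    and sub: "\<And>t. t \<in> \<U> \<Longrightarrow> bounded_by I t \<subseteq> F"
  shows "bounded_by I (\<Union>\<U>) \<subseteq> F"
proof
  fix x assume x: "x \<in> bounded_by I (\<Union>\<U>)"
  obtain a h r where x': "x = (a, h, r)" by (cases x)
  have mem: "(a, h, r) \<in> triples I False" "r \<subseteq> \<Union>\<U>" using x by (auto simp: x' bounded_by_iff)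
  have "(a, h, r \<inter> t) \<in> F" if "t \<in> \<U>" for t
  proof -
    have "(a, h, r \<inter> t) \<in> bounded_by I t"
      using mem(1) that \<U>(2) by (auto simp: bounded_by_iff triples_iff intro: gapped_Int)
    then show ?thesis using sub[OF that] by blast
  qed
  then have sub': "{a} \<times> {h} \<times> ((\<inter>) r ` \<U>) \<subseteq> F" by blast
  have dir:  "\<forall>s\<in>(\<inter>) r ` \<U>. \<forall>s'\<in>(\<inter>) r ` \<U>. \<exists>s''\<in>(\<inter>) r ` \<U>. s \<subseteq> s'' \<and> s' \<subseteq> s''"
  proof (intro ballI)
    fix s s' assume "s \<in> (\<inter>) r ` \<U>" "s' \<in> (\<inter>) r ` \<U>"
    then obtain t t' where t: "t \<in> \<U>" "t' \<in> \<U>" "s = r \<inter> t" "s' = r \<inter> t'" by blast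
    then obtain t'' where "t'' \<in> \<U>" "t \<subseteq> t''" "t' \<subseteq> t''" using \<U>(3) by blast
    then show "\<exists>s''\<in>(\<inter>) r ` \<U>. s \<subseteq> s'' \<and> s' \<subseteq> s''" using t(3,4) by blast
  qed
  have "(a, h, \<Union>((\<inter>) r ` \<U>)) \<in> F"
    by (rule scott_closed_column[OF F sub' _ dir]) (use \<U>(1) in simp)
  moreover have "\<Union>((\<inter>) r ` \<U>) = r" using mem(2) by blast
  ultimately show "x \<in> F" by (simp add: x')
qed

lemma truncs_directed:
  "\<forall>t\<in>range (trunc A j). \<forall>t'\<in>range (trunc A j). \<exists>t''\<in>range (trunc A j). t \<subseteq> t'' \<and> t' \<subseteq> t''"
proof (intro ballI)
  fix t t' assume "t \<in> range (trunc A j)" "t' \<in> range (trunc A j)"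
  then obtain m n where "t = trunc A j m" "t' = trunc A j n" by blast
  then show "\<exists>t''\<in>range (trunc A j). t \<subseteq> t'' \<and> t' \<subseteq> t''"
    using trunc_mono[of m "max m n" A j] trunc_mono[of n "max m n" A j] by auto
qed

text \<open>Cutting a complete block j of t enlarges the gap, as a column with top t requires. The
  resulting top is a point of \<open>bounded_by I t\<close> and lies above all of
  \<open>bounded_by I (trunc t j n)\<close>.\<close>

lemma trunc_top:
  assumes "t \<in> gapped I" "j \<in> I" "j \<notin> gap t"
  shows "(trunc t j n, t, t) \<in> triples I False"
  using assms trunc_gapped[OF assms(1,2)] trunc_subset by (auto simp: triples_iff gap_trunc)

lemma under_trunc_top:
  assumes "t \<in> gapped I" "j \<in> I" "j \<notin> gap t"
  shows "bounded_by I (trunc t j n) \<subseteq> under (column_order I False) (trunc t j n, t, t)"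
  using trunc_top[OF assms] by (auto simp: under_def column_order_iff bounded_by_iff)

lemma no_greatest:
  assumes "j \<in> I"
  shows "\<not> (\<exists>z\<in>triples I False. \<forall>x\<in>triples I False. triple_le x z)"
proof
  assume "\<exists>z\<in>triples I False. \<forall>x\<in>triples I False. triple_le x z"
  then obtain z where z: "z \<in> triples I False" "\<And>x. x \<in> triples I False \<Longrightarrow> triple_le x z" by blast
  obtain a h r where z': "z = (a, h, r)" by (cases z)
  have le: "triple_le (trunc UNIV j n, UNIV, UNIV) z" for n
    using z(2)[OF trunc_top[OF gapped_UNIV assms]] by (simp add: gap_def)
  have "a \<noteq> UNIV" using z(1) by (auto simp: z' triples_iff gap_def)
  \<comment> \<open>A jump from a top with h = \<open>UNIV\<close> would need a =
    \<open>UNIV\<close>, so z would have to share its column with each of these different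
    tops.\<close>
  then have "trunc UNIV j n = a" for n using le[of n] by (auto simp: z')
  then have "trunc UNIV j 0 = trunc UNIV j 1" by metis
  moreover have "(j, 0) \<notin> trunc UNIV j 0" "(j, 0) \<in> trunc UNIV j 1" by (auto simp: trunc_def)
  ultimately show False by metis
qed

subsection \<open>A dcpo that is not \<open>2\<close>-complete\<close>

lemma triples_ideal_cases:
  "x \<in> triples I True \<Longrightarrow> x \<in> triples I False \<or> (\<exists>t\<in>gapped I. x = (t, t, t))"
  by (cases x) (auto simp: triples_iff)

lemma ideal_triple: "(t, t, t) \<in> triples I True \<longleftrightarrow> t \<in> gapped I" "(t, t, t) \<notin> triples I False"
  by (simp_all add: triples_iff)

lemma triple_le_ideal:
  "x \<in> triples I False \<Longrightarrow> triple_le x (t, t, t) \<longleftrightarrow> x \<in> bounded_by I t"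
  by (cases x) (auto simp: bounded_by_iff triples_iff)

lemma column_order_ideal:
  "x \<in> triples I False \<Longrightarrow> y \<in> triples I False \<Longrightarrow> (x, y) \<in> column_order I True \<longleftrightarrow> (x, y) \<in> column_order I False"
  by (simp add: column_order_iff triples_ideal)

text \<open>Directed sets without ideal points fall under the first two cases, whose suprema are
  given by the same formulas in both posets.\<close>

lemma inclusion_scott_maps:
  "(\<lambda>x\<in>triples I False. x) \<in> scott_maps (column_order I False) (column_order I True)"
proof -
  have "is_sup (column_order I True) D x"
    if D: "directed (column_order I False) D" "is_sup (column_order I False) D x" for D x
  proof -
    have DF: "D \<subseteq> triples I False" using D(1) by (simp add: directed_def Field_column_order)
    then have DT: "D \<subseteq> triples I True" using triples_ideal by blast
    from D(1) show ?thesis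
    proof (cases rule: directed_column_order_cases)
      case (greatest z)
      have "x = z" using is_sup_greatest[OF po_column_order greatest] D(2) by simp
      moreover have "(y, z) \<in> column_order I True" if "y \<in> D" for y
        using greatest(2)[OF that] by (simp add: column_order_iff triples_ideal)
      ultimately show ?thesis using is_sup_greatest[OF po_column_order greatest(1)] by simp
    next
      case (column a h R)
      have "is_sup (column_order I False) D (a, h, \<Union>R)"
        unfolding column(1) by (rule is_sup_column[OF column(2)]) (use DF column(1) in simp)
      then have x: "x = (a, h, \<Union>R)" by (rule is_sup_unique[OF po_column_order D(2)])
      show ?thesis
        unfolding column(1) x by (rule is_sup_column[OF column(2)]) (use DT column(1) in simp)
    qed simp
  qed
  moreover have "(\<lambda>x\<in>triples I False. x) ` D = D" if "directed (column_order I False) D" for D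
    using that by (auto simp: directed_def Field_column_order subset_iff image_iff)
  ultimately show ?thesis
    using triples_ideal
    by (auto simp: scott_maps_def Field_column_order dest: is_sup_Field)
qed

text \<open>An ideal point is added to F when everything it dominates is already in F. Suprema of
  ideal points are then handled by \<open>bounded_by_Union\<close>, and suprema in a column by F
  itself unless the column is a single ideal point.\<close>

lemma scott_closed_ideal_extension:
  assumes F: "scott_closed (column_order I False) F"
  defines "G \<equiv> F \<union> {x. \<exists>t\<in>gapped I. x = (t, t, t) \<and> bounded_by I t \<subseteq> F}"
  shows "scott_closed (column_order I True) G" "G \<inter> triples I False = F"
proof -
  have FF: "F \<subseteq> triples I False" using F by (simp add: scott_closed_def Field_column_order)
  then show GF: "G \<inter> triples I False = F" using ideal_triple(2) by (auto simp: G_def)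
  have G: "(t, t, t) \<in> G \<longleftrightarrow> t \<in> gapped I \<and> bounded_by I t \<subseteq> F" for t
    using FF ideal_triple(2) by (auto simp: G_def)
  show "scott_closed (column_order I True) G"
  proof (rule scott_closedI)
    show "G \<subseteq> Field (column_order I True)"
      using FF triples_ideal by (auto simp: G_def Field_column_order ideal_triple)
  next
    fix x y assume x: "x \<in> G" and yx: "(y, x) \<in> column_order I True"
    have mem: "y \<in> triples I True" "x \<in> triples I True" and le: "triple_le y x"
      using yx by (simp_all add: column_order_iff)
    have P: "z \<in> F" if z: "z \<in> triples I False" "(z, x) \<in> column_order I True" for z
    proof (cases "x \<in> triples I False")
      case True
      then have "(z, x) \<in> column_order I False" using z column_order_ideal by blast
      moreover have "x \<in> F" using True x GF by blast
      ultimately show ?thesis using scott_closed_lower[OF F] by blast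
    next
      case False
      then obtain t where t: "x = (t, t, t)" using triples_ideal_cases[OF mem(2)] by blast
      then have "z \<in> bounded_by I t"
        using z triple_le_ideal[OF z(1)] by (simp add: column_order_iff)
      then show ?thesis using x G t by blast
    qed
    show "y \<in> G"
    proof (cases "y \<in> triples I False")
      case True
      then show ?thesis using P yx G_def by blast
    next
      case False
      then obtain s where s: "y = (s, s, s)" "s \<in> gapped I" using triples_ideal_cases[OF mem(1)] by blast
      have "z \<in> F" if z: "z \<in> bounded_by I s" for z
      proof -
        have zF: "z \<in> triples I False" using z bounded_by_triples by blast
        then have "(z, y) \<in> column_order I True"
          using triple_le_ideal[OF zF] z s(1) mem(1) triples_ideal[OF zF] by (simp add: column_order_iff)
        then have "(z, x) \<in> column_order I True" by (rule po_trans[OF po_column_order _ yx])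
        then show ?thesis by (rule P[OF zF])
      qed
      then show ?thesis using G s by blast
    qed
  next
    fix D x assume D: "directed (column_order I True) D" "D \<subseteq> G" "is_sup (column_order I True) D x"
    have DT: "D \<subseteq> triples I True" and ne: "D \<noteq> {}"
      using D(1) by (auto simp: directed_def Field_column_order)
    from D(1) show "x \<in> G"
    proof (cases rule: directed_column_order_cases)
      case (greatest z)
      have "x = z" using is_sup_greatest[OF po_column_order greatest] D(3) by simp
      then show ?thesis using greatest(1) D(2) by blast
    next
      case (column a h R)
      have sub: "{a} \<times> {h} \<times> R \<subseteq> triples I True" using DT column(1) by simp
      have x: "x = (a, h, \<Union>R)"
        using is_sup_unique[OF po_column_order D(3)] is_sup_column[OF column(2) sub] column(1) by simp
      have mem: "(a, h, r) \<in> triples I True" if "r \<in> R" for r using sub that by blast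
      show ?thesis
      proof (cases "gap a = gap h")
        case True
        then have "r = h" if "r \<in> R" for r using mem[OF that] by (simp add: triples_iff)
        then have "R = {h}" using column(2) by blast
        then show ?thesis using x column(1) D(2) by simp
      next
        case False
        then have "(a, h, r) \<in> triples I False" if "r \<in> R" for r
          using mem[OF that] by (simp add: triples_iff)
        then have "{a} \<times> {h} \<times> R \<subseteq> G \<inter> triples I False" using D(2) column(1) by auto
        then have "{a} \<times> {h} \<times> R \<subseteq> F" using GF by simp
        then have "x \<in> F" unfolding x by (rule scott_closed_column[OF F _ column(2,3)])
        then show ?thesis by (simp add: G_def)
      qed
    next
      case ideal
      define \<U> where "\<U> = {t. (t, t, t) \<in> D}"
      have x: "x = (\<Union>\<U>, \<Union>\<U>, \<Union>\<U>)"
        unfolding \<U>_def by (rule is_sup_unique[OF po_column_order D(3) is_sup_ideal[OF ne DT ideal(2)]])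
      have "\<Union>\<U> \<in> gapped I"
        using is_sup_Field[OF D(3)] by (simp add: Field_column_order x ideal_triple)
      moreover have "bounded_by I (\<Union>\<U>) \<subseteq> F"
      proof (rule bounded_by_Union[OF F])
        show "\<U> \<noteq> {}" using ne ideal(2) \<U>_def by blast
        show "\<U> \<subseteq> gapped I" using DT ideal_triple(1) \<U>_def by blast
        show "bounded_by I t \<subseteq> F" if "t \<in> \<U>" for t using that D(2) G \<U>_def by blast
        show "\<forall>t\<in>\<U>. \<forall>t'\<in>\<U>. \<exists>t''\<in>\<U>. t \<subseteq> t'' \<and> t' \<subseteq> t''"
        proof (intro ballI)
          fix t t' assume "t \<in> \<U>" "t' \<in> \<U>"
          then have tt: "(t, t, t) \<in> D" "(t', t', t') \<in> D" by (simp_all add: \<U>_def)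
          from directed_bound[OF D(1) tt] obtain z where
            z: "z \<in> D" "triple_le (t, t, t) z" "triple_le (t', t', t') z"
            by (auto simp: column_order_iff)
          obtain s where s: "(s, s, s) \<in> D" "triple_le z (s, s, s)" using ideal(2)[OF z(1)] by blast
          obtain a h r where z': "z = (a, h, r)" by (cases z)
          have "(a, h, r) \<in> triples I True" using z(1) z' DT by blast
          then have "a \<subseteq> h" by (simp add: triples_iff)
          then have "t \<subseteq> r" "t' \<subseteq> r" using z(2,3) triple_le_subset unfolding z' by blast+
          moreover have "r \<subseteq> s" using s(2) unfolding z' triple_le.simps by blast
          ultimately show "\<exists>t''\<in>\<U>. t \<subseteq> t'' \<and> t' \<subseteq> t''" using s(1) \<U>_def by blast
        qed
      qed
      ultimately show ?thesis using G x by simp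
    qed
  qed
qed

text \<open>The point (t, t, t) is the supremum of the ideal points of the truncations
  \<open>trunc t j n\<close>, and each of those lies below the ordinary point
  \<open>(trunc t j n, t, t)\<close> of \<open>bounded_by I t\<close>.\<close>

lemma ideal_in_closed:
  assumes F: "scott_closed (column_order I True) F" and j: "j \<in> I" "j \<notin> gap t" and t: "t \<in> gapped I"
    and sub: "bounded_by I t \<subseteq> F"
  shows "(t, t, t) \<in> F"
proof -
  define D where "D = (\<lambda>n. (trunc t j n, trunc t j n, trunc t j n)) ` UNIV"
  have mem: "(trunc t j n, trunc t j n, trunc t j n) \<in> triples I True" for n
    using trunc_gapped[OF t j(1)] by (simp add: ideal_triple)
  have in_D: "(s, s, s) \<in> D \<longleftrightarrow> s \<in> range (trunc t j)" for s by (auto simp: D_def)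
  have "D \<subseteq> F"
  proof -
    have "(trunc t j n, trunc t j n, trunc t j n) \<in> F" for n
    proof (rule scott_closed_lower[OF F])
      show top: "(trunc t j n, t, t) \<in> F"
        using sub trunc_top[OF t j, of n] by (auto simp: bounded_by_iff)
      show "((trunc t j n, trunc t j n, trunc t j n), trunc t j n, t, t) \<in> column_order I True"
        using mem trunc_top[OF t j, of n] triples_ideal by (auto simp: column_order_iff)
    qed
    then show ?thesis by (auto simp: D_def)
  qed
  moreover have dir: "directed (column_order I True) D"
    unfolding directed_def Field_column_order
  proof (intro conjI ballI)
    show "D \<subseteq> triples I True" using mem by (auto simp: D_def)
    fix x y assume "x \<in> D" "y \<in> D"
    then obtain m n where xy: "x = (trunc t j m, trunc t j m, trunc t j m)"
      "y = (trunc t j n, trunc t j n, trunc t j n)" by (auto simp: D_def)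
    show "\<exists>z\<in>D. (x, z) \<in> column_order I True \<and> (y, z) \<in> column_order I True"
    proof
      let ?k = "max m n"
      show "(trunc t j ?k, trunc t j ?k, trunc t j ?k) \<in> D" by (simp add: D_def)
      show "(x, trunc t j ?k, trunc t j ?k, trunc t j ?k) \<in> column_order I True \<and>
        (y, trunc t j ?k, trunc t j ?k, trunc t j ?k) \<in> column_order I True"
        using mem trunc_mono[of m ?k t j] trunc_mono[of n ?k t j] unfolding xy
        by (simp add: column_order_iff)
    qed
  qed (simp add: D_def)
  moreover have "is_sup (column_order I True) D (t, t, t)"
  proof -
    have "is_sup (column_order I True) D
      (\<Union>{s. (s, s, s) \<in> D}, \<Union>{s. (s, s, s) \<in> D}, \<Union>{s. (s, s, s) \<in> D})"
    proof (rule is_sup_ideal)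
      show "D \<noteq> {}" by (simp add: D_def)
      show "D \<subseteq> triples I True" using mem by (auto simp: D_def)
      show "\<exists>s. (s, s, s) \<in> D \<and> triple_le x (s, s, s)" if "x \<in> D" for x
        using that triple_le_refl by (auto simp: D_def)
    qed
    moreover have "\<Union>{s. (s, s, s) \<in> D} = t"
      unfolding in_D using Union_trunc[of t j] by simp
    ultimately show ?thesis by simp
  qed
  ultimately show ?thesis using scott_closed_sup[OF F] by blast
qed

lemma E2_inclusion:
  assumes "infinite I"
  shows "E2 (column_order I False) (column_order I True) (\<lambda>x\<in>triples I False. x)"
proof (rule E2I[OF dcpo_column_order dcpo_column_order inclusion_scott_maps])
  have pre: "pre (column_order I False) (\<lambda>x\<in>triples I False. x) G = G \<inter> triples I False" for G
    by (auto simp: pre_def Field_column_order)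
  show "\<exists>G. scott_closed (column_order I True) G \<and>
      pre (column_order I False) (\<lambda>x\<in>triples I False. x) G = F"
    if "scott_closed (column_order I False) F" for F
    using scott_closed_ideal_extension[OF that] unfolding pre by blast
  fix F G assume FG: "scott_closed (column_order I True) F" "scott_closed (column_order I True) G"
    and sub: "pre (column_order I False) (\<lambda>x\<in>triples I False. x) F \<subseteq>
      pre (column_order I False) (\<lambda>x\<in>triples I False. x) G"
  show "F \<subseteq> G"
  proof
    fix x assume x: "x \<in> F"
    then have "x \<in> triples I True" using scott_closed_Field[OF FG(1)] by (simp add: Field_column_order)
    then consider "x \<in> triples I False" | t where "t \<in> gapped I" "x = (t, t, t)"
      using triples_ideal_cases by blast
    then show "x \<in> G"
    proof cases
      case 1
      then show ?thesis using x sub unfolding pre by blast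
    next
      case 2
      then have "finite (gap t)" by (simp add: gapped_def)
      \<comment> \<open>Finitely many incomplete blocks in an infinite I leave one to cut.\<close>
      then obtain j where j: "j \<in> I" "j \<notin> gap t"
        using assms by (meson finite_subset subsetI)
      have "bounded_by I t \<subseteq> F"
      proof
        fix z assume z: "z \<in> bounded_by I t"
        then have zF: "z \<in> triples I False" using bounded_by_triples by blast
        then have "(z, x) \<in> column_order I True"
          using z triple_le_ideal[OF zF] 2 triples_ideal[OF zF]
          by (simp add: column_order_iff ideal_triple)
        then show "z \<in> F" by (rule scott_closed_lower[OF FG(1) x])
      qed
      then have "bounded_by I t \<subseteq> G" using sub bounded_by_triples[of I t] unfolding pre by blast
      then show ?thesis using ideal_in_closed[OF FG(2) j 2(1)] 2(2) by simp
    qed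
  qed
qed

text \<open>The inclusion, relabelled in its target only, has no extension: the image of the ideal
  point over \<open>UNIV\<close> would be a greatest element.\<close>

theorem not_two_complete_column_order:
  assumes "infinite I" "inj h"
  shows "\<not> two_complete (relabel h (column_order I False))"
proof
  let ?P = "column_order I False" and ?Q = "column_order I True"
  let ?e = "\<lambda>x\<in>triples I False. x"
  assume "two_complete (relabel h ?P)"
  then have "map_orthogonal ?P ?Q ?e (relabel h ?P)"
    by (rule two_complete_orthogonal[OF _ E2_inclusion[OF assms(1)]])
  then have img: "(\<lambda>g. compose (triples I False) g ?e) ` scott_maps ?Q (relabel h ?P) =
      scott_maps ?P (relabel h ?P)"
    by (simp add: map_orthogonal_def order_iso_def bij_betw_def Field_column_order
        Field_fun_dcpo partial_order_relabel[OF assms(2) po_column_order])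
  have "(\<lambda>x\<in>triples I False. h x) \<in> scott_maps ?P (relabel h ?P)"
  proof -
    have "(\<lambda>x\<in>triples I False. h x) ` D = h ` D" if "directed ?P D" for D
      using that by (auto simp: directed_def Field_column_order subset_iff image_iff)
    then show ?thesis
      by (auto simp: scott_maps_def Field_column_order Field_relabel is_sup_relabel[OF assms(2)]
          dest!: is_sup_Field)
  qed
  then obtain g where g: "g \<in> scott_maps ?Q (relabel h ?P)"
    "compose (triples I False) g ?e = (\<lambda>x\<in>triples I False. h x)"
    unfolding img[symmetric] by (metis (no_types, lifting) imageE)
  let ?top = "(UNIV, UNIV, UNIV)"
  have top: "?top \<in> triples I True" by (simp add: ideal_triple gapped_UNIV)
  then have "g ?top \<in> h ` triples I False"
    using scott_maps_Field[OF g(1)] by (simp add: Field_column_order Field_relabel)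
  then obtain z where z: "z \<in> triples I False" "g ?top = h z" by blast
  have "triple_le x z" if x: "x \<in> triples I False" for x
  proof -
    have "(x, ?top) \<in> ?Q"
      using triple_le_ideal[OF x] x triples_ideal[OF x] top
      by (cases x) (simp add: column_order_iff bounded_by_iff)
    then have "(g x, g ?top) \<in> relabel h ?P" by (rule scott_maps_mono[OF po_column_order g(1)])
    moreover have "g x = h x" using fun_cong[OF g(2), of x] x by (simp add: compose_def)
    ultimately show ?thesis using z(2) by (simp add: relabel_iff[OF assms(2)] column_order_iff)
  qed
  moreover obtain j where "j \<in> I" using assms(1) by (metis ex_in_conv finite.emptyI)
  ultimately show False using no_greatest z(1) by blast
qed

subsection \<open>A \<open>2\<close>-complete dcpo that is not weakly dominated\<close>

lemma bounded_by_truncs_directed: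
  "\<forall>X\<in>range (\<lambda>n. bounded_by I (trunc t j n)). \<forall>Y\<in>range (\<lambda>n. bounded_by I (trunc t j n)).
     \<exists>Z\<in>range (\<lambda>n. bounded_by I (trunc t j n)). X \<subseteq> Z \<and> Y \<subseteq> Z"
proof (intro ballI)
  fix X Y assume "X \<in> range (\<lambda>n. bounded_by I (trunc t j n))" "Y \<in> range (\<lambda>n. bounded_by I (trunc t j n))"
  then obtain m n where "X = bounded_by I (trunc t j m)" "Y = bounded_by I (trunc t j n)" by blast
  then have "X \<subseteq> bounded_by I (trunc t j (max m n))" "Y \<subseteq> bounded_by I (trunc t j (max m n))"
    by (simp_all add: bounded_by_mono trunc_mono)
  then show "\<exists>Z\<in>range (\<lambda>n. bounded_by I (trunc t j n)). X \<subseteq> Z \<and> Y \<subseteq> Z" by blast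
qed

lemma bounded_by_subset_cl_truncs:
  assumes "t \<in> gapped I" "j \<in> I"
  shows "bounded_by I t \<subseteq> cl (column_order I False) (\<Union>(range (\<lambda>n. bounded_by I (trunc t j n))))"
    (is "_ \<subseteq> ?C")
proof -
  have "bounded_by I (\<Union>(range (trunc t j))) \<subseteq> ?C"
  proof (rule bounded_by_Union[OF scott_closed_cl_Union])
    show "range (trunc t j) \<subseteq> gapped I" using trunc_gapped[OF assms] by blast
    show "bounded_by I s \<subseteq> ?C" if "s \<in> range (trunc t j)" for s
      using that by (intro cl_upper) blast
  qed (use scott_closed_bounded_by truncs_directed in auto)
  then show ?thesis by (simp only: Union_trunc)
qed

text \<open>A member of \<A> that contains the top \<open>(trunc t j n, t, t)\<close> includes
  \<open>bounded_by I (trunc t j n)\<close>, so \<A> contains this closed set for every n, and then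
  the supremum of the chain.\<close>

lemma C_compact_bounded_by:
  assumes t: "t \<in> gapped I" and j: "j \<in> I" "j \<notin> gap t"
  shows "C_compact (Gamma (column_order I False)) (bounded_by I t)"
  unfolding C_compact_Gamma_iff[OF dcpo_column_order]
proof (intro conjI allI impI)
  let ?P = "column_order I False"
  fix \<A> assume \<A>: "scott_closed (Gamma ?P) \<A>" "bounded_by I t \<subseteq> \<Union>\<A>"
  let ?\<D> = "range (\<lambda>n. bounded_by I (trunc t j n))"
  have "bounded_by I (trunc t j n) \<in> \<A>" for n
  proof -
    have top: "(trunc t j n, t, t) \<in> bounded_by I t"
      using trunc_top[OF t j] by (simp add: bounded_by_iff)
    then obtain X where X: "X \<in> \<A>" "(trunc t j n, t, t) \<in> X" using \<A>(2) by blast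
    then have "under ?P (trunc t j n, t, t) \<subseteq> X"
      using scott_closed_Gamma_mem[OF \<A>(1)] by (simp add: scott_closed_def)
    then have "bounded_by I (trunc t j n) \<subseteq> X"
      using under_trunc_top[OF t j, of n] by (rule subset_trans[rotated])
    then show ?thesis
      by (rule scott_closed_Gamma_lower[OF \<A>(1) X(1) scott_closed_bounded_by])
  qed
  then have sub: "?\<D> \<subseteq> \<A>" by blast
  have "directed (Gamma ?P) ?\<D>"
    unfolding Gamma_def directed_incl
  proof (intro conjI)
    show "?\<D> \<subseteq> {A. scott_closed ?P A}" using scott_closed_bounded_by by blast
  next
    show "\<forall>X\<in>?\<D>. \<forall>Y\<in>?\<D>. \<exists>Z\<in>?\<D>. X \<subseteq> Z \<and> Y \<subseteq> Z" by (rule bounded_by_truncs_directed)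
  qed simp
  then have "cl ?P (\<Union>?\<D>) \<in> \<A>" by (rule scott_closed_Gamma_sup[OF \<A>(1) _ sub])
  moreover have "bounded_by I t \<subseteq> cl ?P (\<Union>?\<D>)"
    by (rule bounded_by_subset_cl_truncs[OF t j(1)])
  ultimately show "bounded_by I t \<in> \<A>"
    by (rule scott_closed_Gamma_lower[OF \<A>(1) _ scott_closed_bounded_by])
qed (rule scott_closed_bounded_by)

text \<open>Block j is cut to approximate the C-compact, unbounded whole by sets below tops. Block
  j' remains complete in these sets, which makes them C-compact as well.\<close>

theorem not_weakly_dominated_column_order:
  assumes j: "j \<in> I" "j' \<in> I" "j \<noteq> j'"
  shows "\<not> weakly_dominated (column_order I False)"
proof
  let ?P = "column_order I False"
  assume wd: "weakly_dominated ?P"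
  have all: "bounded_by I UNIV = triples I False" by (auto simp: bounded_by_def)
  have gapU: "gap UNIV = {}" by (simp add: gap_def)
  let ?\<A> = "{A. C_compact (Gamma ?P) A \<and> lhd ?P A (triples I False)}"
  let ?\<D> = "range (\<lambda>n. bounded_by I (trunc UNIV j n))"
  have "C_compact (Gamma ?P) (triples I False)"
    unfolding all[symmetric] by (rule C_compact_bounded_by[OF gapped_UNIV j(1)]) (simp add: gapU)
  then have "scott_closed (C_Gamma ?P) ?\<A>" using wd by (simp add: weakly_dominated_def)
  then have sup: "directed (C_Gamma ?P) \<D> \<Longrightarrow> \<D> \<subseteq> ?\<A> \<Longrightarrow> cl ?P (\<Union>\<D>) \<in> ?\<A>" for \<D>
    unfolding scott_closed_C_Gamma_iff[OF dcpo_column_order] by blast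
  have C: "C_compact (Gamma ?P) (bounded_by I (trunc UNIV j n))" for n
    by (rule C_compact_bounded_by[OF trunc_gapped[OF gapped_UNIV j(1)] j(2)])
      (use j(3) in \<open>simp add: gap_trunc gapU\<close>)
  have "lhd ?P (bounded_by I (trunc UNIV j n)) (triples I False)" for n
    unfolding lhd_def
    using under_trunc_top[OF gapped_UNIV j(1), of n] trunc_top[OF gapped_UNIV j(1), of n] gapU by blast
  then have sub: "?\<D> \<subseteq> ?\<A>" using C by blast
  have "directed (C_Gamma ?P) ?\<D>"
    unfolding C_Gamma_def directed_incl
  proof (intro conjI)
    show "?\<D> \<subseteq> {A. C_compact (Gamma ?P) A}" using C by blast
  next
    show "\<forall>X\<in>?\<D>. \<forall>Y\<in>?\<D>. \<exists>Z\<in>?\<D>. X \<subseteq> Z \<and> Y \<subseteq> Z" by (rule bounded_by_truncs_directed)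
  qed simp
  then have "cl ?P (\<Union>?\<D>) \<in> ?\<A>" by (rule sup[OF _ sub])
  moreover have "triples I False \<subseteq> cl ?P (\<Union>?\<D>)"
    using bounded_by_subset_cl_truncs[OF gapped_UNIV j(1)] by (simp only: all)
  ultimately obtain z where "z \<in> triples I False" "triples I False \<subseteq> under ?P z"
    unfolding lhd_def by blast
  then have "\<forall>x\<in>triples I False. triple_le x z" by (auto simp: under_def column_order_iff)
  then show False using no_greatest[OF j(1)] \<open>z \<in> triples I False\<close> by blast
qed

section \<open>Irreducible sets and their rank over finitely many blocks\<close>

lemma scott_closed_not_finite_subset:
  assumes X: "scott_closed (column_order I False) X" "X \<subseteq> {a} \<times> {h} \<times> UNIV" and "finite k"
  shows "scott_closed (column_order I False) {x \<in> X. \<not> k \<subseteq> snd (snd x)}"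
proof (rule scott_closed_column_orderI)
  have XT: "X \<subseteq> triples I False" using X(1) by (simp add: scott_closed_def Field_column_order)
  then show "{x \<in> X. \<not> k \<subseteq> snd (snd x)} \<subseteq> triples I False" by blast
  show "y \<in> {x \<in> X. \<not> k \<subseteq> snd (snd x)}"
    if x: "x \<in> {x \<in> X. \<not> k \<subseteq> snd (snd x)}" and y: "y \<in> triples I False" and le: "triple_le y x" for x y
  proof -
    have "x \<in> X" using x by blast
    moreover from this have "(y, x) \<in> column_order I False"
      using y le XT[THEN subsetD] by (simp add: column_order_iff)
    ultimately have "y \<in> X" by (rule scott_closed_lower[OF X(1)])
    moreover have "snd (snd y) \<subseteq> snd (snd x)"
    proof -
      obtain a' h' r' where x': "x = (a', h', r')" by (cases x)
      obtain a'' h'' r'' where y': "y = (a'', h'', r'')" by (cases y)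
      have "(a', h', r') \<in> triples I False" using \<open>x \<in> X\<close> XT x' by blast
      then have "a' \<subseteq> h'" by (simp add: triples_iff)
      then show ?thesis using triple_le_subset[OF le[unfolded x' y']] by (simp add: x' y')
    qed
    ultimately show ?thesis using x by blast
  qed
  fix a' h' R assume R: "R \<noteq> {}" "\<forall>r\<in>R. \<forall>r'\<in>R. \<exists>r''\<in>R. r \<subseteq> r'' \<and> r' \<subseteq> r''"
    "{a'} \<times> {h'} \<times> R \<subseteq> {x \<in> X. \<not> k \<subseteq> snd (snd x)}"
  have "(a', h', \<Union>R) \<in> X" by (rule scott_closed_column[OF X(1) _ R(1,2)]) (use R(3) in blast)
  moreover have "\<not> k \<subseteq> r" if "r \<in> R" for r
  proof -
    have "(a', h', r) \<in> {x \<in> X. \<not> k \<subseteq> snd (snd x)}" using R(3) that by blast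
    then show ?thesis by simp
  qed
  \<comment> \<open>A finite k inside a directed union already lies in one member, so containing k
    is a Scott-open condition along a column.\<close>
  then have "\<not> k \<subseteq> \<Union>R" using finite_subset_directed_Union[OF assms(3) _ R(1,2)] by blast
  ultimately show "(a', h', \<Union>R) \<in> {x \<in> X. \<not> k \<subseteq> snd (snd x)}" by simp
qed

text \<open>For finite \<open>I\<close> every column is an algebraic domain, hence sober.\<close>

lemma irreducible_column:
  assumes I: "finite I" and X: "irreducible_closed (column_order I False) X" "X \<subseteq> {a} \<times> {h} \<times> UNIV"
  shows "\<exists>x\<in>Field (column_order I False). X = under (column_order I False) x"
proof -
  let ?P = "column_order I False"
  have c: "scott_closed ?P X" and ne: "X \<noteq> {}"
    using X(1) by (auto simp: irreducible_closed_def)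
  have XT: "X \<subseteq> triples I False" using c by (simp add: scott_closed_def Field_column_order)
  define R where "R = {r. (a, h, r) \<in> X}"
  have in_R: "r \<in> R \<longleftrightarrow> (a, h, r) \<in> X" for r by (simp add: R_def)
  have XR: "x \<in> X \<Longrightarrow> \<exists>r\<in>R. x = (a, h, r)" for x using X(2) in_R by blast
  have RT: "(a, h, r) \<in> triples I False" if "r \<in> R" for r using that XT in_R by blast
  \<comment> \<open>Otherwise the points missing k and the points missing p would be two closed sets
    that cover X while neither contains it.\<close>
  have fin: "\<exists>r\<in>R. k \<subseteq> r" if "finite k" "k \<subseteq> \<Union>R" for k
    using that
  proof (induction k)
    case empty
    then show ?case using ne XR by blast
  next
    case (insert p k)
    then obtain r r' where r: "r \<in> R" "k \<subseteq> r" "r' \<in> R" "p \<in> r'" by auto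
    show ?case
    proof (rule ccontr)
      assume no: "\<not> ?case"
      have "X \<subseteq> {x \<in> X. \<not> k \<subseteq> snd (snd x)} \<union> {x \<in> X. \<not> {p} \<subseteq> snd (snd x)}"
      proof
        fix x assume x: "x \<in> X"
        then obtain s where "s \<in> R" "x = (a, h, s)" using XR by blast
        then show "x \<in> {x \<in> X. \<not> k \<subseteq> snd (snd x)} \<union> {x \<in> X. \<not> {p} \<subseteq> snd (snd x)}"
          using x no by auto
      qed
      then have "X \<subseteq> {x \<in> X. \<not> k \<subseteq> snd (snd x)} \<or> X \<subseteq> {x \<in> X. \<not> {p} \<subseteq> snd (snd x)}"
        by (rule irreducible_cases[OF X(1) scott_closed_not_finite_subset[OF c X(2) insert.hyps(1)]
              scott_closed_not_finite_subset[OF c X(2)], rotated]) simp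
      moreover have "(a, h, r) \<in> X" "(a, h, r') \<in> X" using r(1,3) in_R by auto
      ultimately have "\<not> k \<subseteq> r \<or> p \<notin> r'" by fastforce
      then show False using r by blast
    qed
  qed
  \<comment> \<open>The blocks outside I lie in every member of \<open>gapped I\<close>. As I is
    finite, adding a finite set to N gives members again; these are the compact elements of the
    column.\<close>
  define N where "N = (- I) \<times> (UNIV :: nat set)"
  have N: "N \<subseteq> r" if "r \<in> R" for r
    using RT[OF that] by (force simp: N_def triples_iff gapped_def gap_def)
  obtain r0 where r0: "r0 \<in> R" using ne XR by blast
  define K where "K = {k \<union> N | k. finite k \<and> k \<subseteq> \<Union>R}"
  have "(a, h, \<Union>K) \<in> X"
  proof (rule scott_closed_column[OF c])
    show "K \<noteq> {}" by (auto simp: K_def intro!: exI[of _ "{}"])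
    show "\<forall>s\<in>K. \<forall>s'\<in>K. \<exists>s''\<in>K. s \<subseteq> s'' \<and> s' \<subseteq> s''"
    proof (intro ballI)
      fix s s' assume "s \<in> K" "s' \<in> K"
      then obtain k k' where k: "s = k \<union> N" "s' = k' \<union> N" "finite k" "finite k'" "k \<subseteq> \<Union>R" "k' \<subseteq> \<Union>R"
        unfolding K_def by blast
      then have "(k \<union> k') \<union> N \<in> K" unfolding K_def by blast
      then show "\<exists>s''\<in>K. s \<subseteq> s'' \<and> s' \<subseteq> s''" unfolding k by (rule bexI[rotated]) blast
    qed
    show "{a} \<times> {h} \<times> K \<subseteq> X"
    proof -
      have "(a, h, k \<union> N) \<in> X" if k: "finite k" "k \<subseteq> \<Union>R" for k
      proof -
        obtain r where r: "r \<in> R" "k \<subseteq> r" using fin[OF k] by blast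
        have sub: "k \<union> N \<subseteq> r" using r N by blast
        have "gap (k \<union> N) \<subseteq> I" by (auto simp: gap_def N_def)
        then have "k \<union> N \<in> gapped I" using I by (simp add: gapped_def finite_subset)
        then have "(a, h, k \<union> N) \<in> triples I False"
          using RT[OF r(1)] sub by (auto simp: triples_iff)
        then have "((a, h, k \<union> N), (a, h, r)) \<in> ?P"
          using RT[OF r(1)] sub by (simp add: column_order_iff)
        then show ?thesis using scott_closed_lower[OF c] r(1) in_R by blast
      qed
      then show ?thesis unfolding K_def by blast
    qed
  qed
  moreover have "\<Union>K = \<Union>R"
  proof
    show "\<Union>K \<subseteq> \<Union>R" using N[OF r0] r0 unfolding K_def by blast
    show "\<Union>R \<subseteq> \<Union>K"
    proof
      fix p assume "p \<in> \<Union>R"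
      then have "{p} \<union> N \<in> K" unfolding K_def by blast
      then show "p \<in> \<Union>K" by blast
    qed
  qed
  ultimately have top: "(a, h, \<Union>R) \<in> X" by simp
  have "X = under ?P (a, h, \<Union>R)"
  proof
    show "under ?P (a, h, \<Union>R) \<subseteq> X" using c top by (simp add: scott_closed_def)
    show "X \<subseteq> under ?P (a, h, \<Union>R)"
    proof
      fix x assume x: "x \<in> X"
      then obtain r where "r \<in> R" "x = (a, h, r)" using XR by blast
      then show "x \<in> under ?P (a, h, \<Union>R)"
        using x top XT by (auto simp: under_def column_order_iff)
    qed
  qed
  moreover have "(a, h, \<Union>R) \<in> Field ?P" using top XT by (auto simp: Field_column_order)
  ultimately show ?thesis by blast
qed

text \<open>X splits into its part in the column and its part bounded by a. Both are closed, and an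
  irreducible set within one column would be principal.\<close>

lemma irreducible_below:
  assumes I: "finite I" and X: "irreducible_closed (column_order I False) X"
    and below: "X \<subseteq> under (column_order I False) (a, h, r)"
    and np: "\<forall>x\<in>Field (column_order I False). X \<noteq> under (column_order I False) x"
  shows "r = h" "X \<subseteq> bounded_by I a"
proof -
  let ?P = "column_order I False"
  have c: "scott_closed ?P X" and ne: "X \<noteq> {}"
    using X(1) by (auto simp: irreducible_closed_def)
  have XT: "X \<subseteq> triples I False" using c by (simp add: scott_closed_def Field_column_order)
  have xle: "triple_le x (a, h, r)" "(a, h, r) \<in> triples I False" if "x \<in> X" for x
    using below that by (auto simp: under_def column_order_iff)
  have arT: "(a, h, r) \<in> triples I False" using xle(2) ne by blast
  have notin: "(a, h, r) \<notin> X"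
  proof
    assume "(a, h, r) \<in> X"
    then have "under ?P (a, h, r) \<subseteq> X" using c by (simp add: scott_closed_def)
    then show False using below np arT by (auto simp: Field_column_order)
  qed
  show rh: "r = h"
  proof (rule ccontr)
    assume "r \<noteq> h"
    then have "x \<in> {a} \<times> {h} \<times> UNIV" if "x \<in> X" for x using xle(1)[OF that] by (cases x) auto
    then show False using irreducible_column[OF I X] np by blast
  qed
  let ?A = "X \<inter> {a} \<times> {h} \<times> UNIV" and ?B = "X \<inter> bounded_by I a"
  have "X \<subseteq> ?A \<union> ?B"
  proof
    fix x assume x: "x \<in> X"
    obtain a' h' r' where x': "x = (a', h', r')" by (cases x)
    have "a' = a \<and> h' = h \<or> r' \<subseteq> a" using xle(1)[OF x] unfolding x' by auto
    then show "x \<in> ?A \<union> ?B" using x XT unfolding x' by (auto simp: bounded_by_iff)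
  qed
  moreover have "scott_closed ?P ?B" by (intro scott_closed_Int c scott_closed_bounded_by)
  moreover have "scott_closed ?P ?A"
  proof (rule scott_closed_column_orderI)
    show "?A \<subseteq> triples I False" using XT by blast
    \<comment> \<open>Only the top of a column has points of other columns below it, and X avoids
      the top of this one.\<close>
    show "y \<in> ?A" if x: "x \<in> ?A" and y: "y \<in> triples I False" "triple_le y x" for x y
    proof -
      have "(y, x) \<in> ?P" using x y XT by (auto simp: column_order_iff)
      then have "y \<in> X" using scott_closed_lower[OF c] x by blast
      moreover obtain s where s: "x = (a, h, s)" using x by blast
      have "s \<noteq> h" using s x notin rh by blast
      then have "y \<in> {a} \<times> {h} \<times> UNIV" using y(2) unfolding s by (cases y) auto
      ultimately show ?thesis by blast
    qed
    fix a' h' R assume R: "R \<noteq> {}" "\<forall>r\<in>R. \<forall>r'\<in>R. \<exists>r''\<in>R. r \<subseteq> r'' \<and> r' \<subseteq> r''" "{a'} \<times> {h'} \<times> R \<subseteq> ?A"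
    have "(a', h', \<Union>R) \<in> X" by (rule scott_closed_column[OF c _ R(1,2)]) (use R(3) in blast)
    moreover have "a' = a" "h' = h" using R(1,3) by auto
    ultimately show "(a', h', \<Union>R) \<in> ?A" by simp
  qed
  ultimately have "X \<subseteq> ?A \<or> X \<subseteq> ?B" by (intro irreducible_cases[OF X])
  moreover have "\<not> X \<subseteq> ?A" using irreducible_column[OF I X, of a h] np by blast
  ultimately show "X \<subseteq> bounded_by I a" by blast
qed

text \<open>As \<open>gap a\<close> \<subseteq> I, the \<open>Suc\<close> keeps every value
  positive; a top whose bound a has full gap thus still counts more than the default 0 of a set
  without tops.\<close>

definition rank :: "nat set \<Rightarrow> triple set \<Rightarrow> nat" where
  "rank I X = Max (insert 0 {Suc (card I) - card (gap a) | a h. (a, h, h) \<in> X})"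

text \<open>X is bounded by the a of some top (a, h, h) in Y. A top (a', h', h') in X has h'
  \<subseteq> a, so \<open>gap a\<close> \<subseteq> \<open>gap h'\<close>, which is properly inside
  \<open>gap a'\<close>; it therefore has a smaller value.\<close>

lemma rank_less:
  assumes I: "finite I"
    and X: "irreducible_closed (column_order I False) X"
    and Y: "irreducible_closed (column_order I False) Y"
    and XY: "lhd (column_order I False) X Y"
    and np: "\<forall>x\<in>Field (column_order I False). X \<noteq> under (column_order I False) x"
  shows "rank I X < rank I Y"
proof -
  have fin: "finite (insert 0 {Suc (card I) - card (gap a) | a h. (a, h, h) \<in> Z})" for Z
    by (rule finite_subset[of _ "{..Suc (card I)}"]) auto
  have XT: "X \<subseteq> triples I False" and YT: "Y \<subseteq> triples I False"
    using X Y by (simp_all add: irreducible_closed_def scott_closed_def Field_column_order)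
  obtain y where y: "y \<in> Y" "X \<subseteq> under (column_order I False) y" using XY by (auto simp: lhd_def)
  obtain a h r where y': "y = (a, h, r)" by (cases y)
  note below = irreducible_below[OF I X y(2)[unfolded y'] np]
  have ahh: "(a, h, h) \<in> Y" using y(1) y' below(1) by simp
  then have "(a, h, h) \<in> triples I False" using YT by blast
  then have ag: "gap a \<subseteq> I" by (simp add: triples_iff gapped_def)
  let ?v = "Suc (card I) - card (gap a)"
  have "?v \<in> insert 0 {Suc (card I) - card (gap a) | a h. (a, h, h) \<in> Y}" using ahh by blast
  then have "?v \<le> rank I Y" unfolding rank_def by (rule Max_ge[OF fin])
  moreover have "rank I X < ?v"
    unfolding rank_def
  proof (subst Max_less_iff[OF fin])
    show "insert 0 {Suc (card I) - card (gap a) | a h. (a, h, h) \<in> X} \<noteq> {}" by simp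
    have "card (gap a) \<le> card I" by (rule card_mono[OF I ag])
    moreover have "Suc (card I) - card (gap a') < ?v" if "(a', h', h') \<in> X" for a' h'
    proof -
      have mem: "(a', h', h') \<in> triples I False" "h' \<subseteq> a"
        using subsetD[OF below(2) that] by (simp_all add: bounded_by_iff)
      have a'I: "gap a' \<subseteq> I" "gap h' \<subseteq> gap a'" "gap a' \<noteq> gap h'"
        using mem(1) gap_antimono by (auto simp: triples_iff gapped_def)
      have "gap a \<subset> gap a'" using gap_antimono[OF mem(2)] a'I by blast
      then have "card (gap a) < card (gap a')"
        using psubset_card_mono finite_subset[OF a'I(1) I] by blast
      moreover have "card (gap a') \<le> card I" by (rule card_mono[OF I a'I(1)])
      ultimately show ?thesis by linarith
    qed
    ultimately show "\<forall>v\<in>insert 0 {Suc (card I) - card (gap a) | a h. (a, h, h) \<in> X}. v < ?v"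
      by auto
  qed
  ultimately show ?thesis by linarith
qed

text \<open>\<open>two_complete\<close> refers to maps between dcpos on types derived from its own
  carrier, so the rank rather than the property is transported along \<open>h\<close>.\<close>

theorem two_complete_column_order:
  assumes "finite I" "inj h"
  shows "two_complete (relabel h (column_order I False))"
proof -
  let ?P = "column_order I False"
  let ?t = "relabel h ?P"
  have dc: "dcpo ?t" by (rule dcpo_relabel[OF assms(2) dcpo_column_order])
  have "rank I (h -` X) < rank I (h -` Y)"
    if XY: "irreducible_closed ?t X" "irreducible_closed ?t Y" "lhd ?t X Y"
      "\<forall>x\<in>Field ?t. X \<noteq> under ?t x" for X Y
  proof -
    obtain X' where X': "X = h ` X'" using irreducible_relabel_ex[OF assms(2) XY(1)] by blast
    obtain Y' where Y': "Y = h ` Y'" using irreducible_relabel_ex[OF assms(2) XY(2)] by blast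
    have "irreducible_closed ?P X'" "irreducible_closed ?P Y'" "lhd ?P X' Y'"
      using XY(1-3) unfolding X' Y' by (simp_all only: irreducible_relabel[OF assms(2)] lhd_relabel[OF assms(2)])
    moreover have "\<forall>x\<in>Field ?P. X' \<noteq> under ?P x"
      using XY(4) unfolding X' by (auto simp: Field_relabel under_relabel[OF assms(2)])
    ultimately have "rank I X' < rank I Y'" by (rule rank_less[OF assms(1)])
    then show ?thesis unfolding X' Y' by (simp only: inj_vimage_image_eq[OF assms(2)])
  qed
  then have "map_orthogonal r s e ?t" if "E2 r s e" for r :: "'a rel" and s :: "'a set rel" and e
    using rank_orthogonal[OF dc _ that, of "\<lambda>X. rank I (h -` X)"] by blast
  then show ?thesis using dc by (simp add: two_complete_def)
qed

subsection \<open>The fan space\<close>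

text \<open>A top \<open>c\<close> is the supremum of many chains \<open>Spine c i\<close>, and lies above initial segments of one
  spine \<open>Inl n\<close> and one spine \<open>Inr f\<close> of two further tops. Every neighbourhood of a top contains
  \<open>Spine c (Inl n) (g n)\<close> for some \<open>g\<close> and all \<open>n\<close>, and the spine \<open>Inr g\<close> of any other top meets every
  neighbourhood of that top, so any two neighbourhoods intersect in a top with data \<open>n\<close> and \<open>g\<close>.\<close>

datatype fan = Top "nat \<Rightarrow> nat" | Spine "nat \<Rightarrow> nat" "nat + (nat \<Rightarrow> nat)" nat

text \<open>A top is its own code for the two tops, the function and the number that it serves, read
  off at the residues mod 4. Only joint surjectivity of the four components is used.\<close>

definition left_top :: "(nat \<Rightarrow> nat) \<Rightarrow> nat \<Rightarrow> nat" where "left_top z = (\<lambda>i. z (4 * i))"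
definition right_top :: "(nat \<Rightarrow> nat) \<Rightarrow> nat \<Rightarrow> nat" where "right_top z = (\<lambda>i. z (4 * i + 1))"
definition fun_part :: "(nat \<Rightarrow> nat) \<Rightarrow> nat \<Rightarrow> nat" where "fun_part z = (\<lambda>i. z (4 * i + 2))"
definition nat_part :: "(nat \<Rightarrow> nat) \<Rightarrow> nat" where "nat_part z = z 3"

lemma node_exists: "\<exists>z. left_top z = a \<and> right_top z = b \<and> fun_part z = f \<and> nat_part z = n"
proof -
  let ?z = "\<lambda>i. if i mod 4 = 0 then a (i div 4) else if i mod 4 = 1 then b (i div 4)
    else if i mod 4 = 2 then f (i div 4) else n"
  have m: "(4 * i + k) mod 4 = k" "(4 * i + k) div 4 = i" if "k < 4" for i k :: nat
    using that by simp_all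
  have "left_top ?z = a" "right_top ?z = b" "fun_part ?z = f" "nat_part ?z = n"
    unfolding left_top_def right_top_def fun_part_def nat_part_def
    using m[of 0] m[of 1] m[of 2] by (simp_all add: fun_eq_iff)
  then show ?thesis by blast
qed

text \<open>Each of the two segments is limited by the index of the other spine: the left one, on
  \<open>Inl n\<close>, ends at the value at n of the function indexing the right one, and the right
  one ends at n.\<close>

fun serves :: "(nat \<Rightarrow> nat) \<Rightarrow> (nat \<Rightarrow> nat) \<Rightarrow> nat + (nat \<Rightarrow> nat) \<Rightarrow> nat \<Rightarrow> bool" where
  "serves z c (Inl n) m \<longleftrightarrow> left_top z = c \<and> nat_part z = n \<and> m \<le> fun_part z n"
| "serves z c (Inr f) m \<longleftrightarrow> right_top z = c \<and> fun_part z = f \<and> m \<le> nat_part z"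

fun fan_le :: "fan \<Rightarrow> fan \<Rightarrow> bool" where
  "fan_le (Top c) y \<longleftrightarrow> y = Top c"
| "fan_le (Spine c i m) (Top z) \<longleftrightarrow> z = c \<or> serves z c i m"
| "fan_le (Spine c i m) (Spine d j l) \<longleftrightarrow> c = d \<and> i = j \<and> m \<le> l"

definition fan_order :: "fan rel" where
  "fan_order = {(x, y). fan_le x y}"

lemma fan_order_iff: "(x, y) \<in> fan_order \<longleftrightarrow> fan_le x y"
  by (simp add: fan_order_def)

lemma serves_le: "serves z c i m \<Longrightarrow> l \<le> m \<Longrightarrow> serves z c i l"
  by (cases i) auto

lemma serves_unbounded: "\<exists>m. \<not> serves z c i m"
proof (cases i)
  case (Inl n)
  then show ?thesis by (auto intro!: exI[of _ "Suc (fun_part z n)"])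
next
  case (Inr f)
  then show ?thesis by (auto intro!: exI[of _ "Suc (nat_part z)"])
qed

lemma fan_le_refl: "fan_le x x"
  by (cases x) auto

lemma fan_le_trans: "fan_le x y \<Longrightarrow> fan_le y z \<Longrightarrow> fan_le x z"
  by (cases x; cases y; cases z) (auto intro: serves_le)

lemma fan_le_antisym: "fan_le x y \<Longrightarrow> fan_le y x \<Longrightarrow> x = y"
  by (cases x; cases y) auto

lemma Field_fan_order: "Field fan_order = UNIV"
  using fan_le_refl by (auto simp: Field_def fan_order_def)

lemma po_fan_order: "Partial_order fan_order"
proof -
  have "trans fan_order"
    by (rule transI) (unfold fan_order_iff, rule fan_le_trans)
  moreover have "antisym fan_order"
    by (rule antisymI) (unfold fan_order_iff, rule fan_le_antisym)
  ultimately show ?thesis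
    by (simp add: order_on_defs refl_on_def Field_fan_order fan_order_iff fan_le_refl)
qed

lemma fan_le_Spine: "fan_le x (Spine c i m) \<longleftrightarrow> (\<exists>l\<le>m. x = Spine c i l)"
  by (cases x) auto

lemma is_sup_spine:
  assumes "infinite M"
  shows "is_sup fan_order (Spine c i ` M) (Top c)"
proof (rule is_supI)
  fix z assume ub: "\<And>y. y \<in> Spine c i ` M \<Longrightarrow> (y, z) \<in> fan_order"
  have le: "fan_le (Spine c i m) z" if "m \<in> M" for m using ub that by (simp add: fan_order_iff)
  have unb: "\<exists>m\<in>M. k < m" for k using assms by (meson infinite_nat_iff_unbounded)
  show "(Top c, z) \<in> fan_order"
  proof (cases z)
    case (Top d)
    obtain k where k: "\<not> serves d c i k" using serves_unbounded by blast
    obtain m where m: "m \<in> M" "k < m" using unb by blast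
    have "\<not> serves d c i m" using k serves_le m(2) less_imp_le by blast
    then show ?thesis using le[OF m(1)] Top by (simp add: fan_order_iff)
  next
    case (Spine d j k)
    obtain m where "m \<in> M" "k < m" using unb by blast
    then show ?thesis using le Spine by fastforce
  qed
qed (auto simp: Field_fan_order fan_order_iff)

lemma directed_fan_order_cases:
  assumes "directed fan_order D"
  obtains (greatest) z where "z \<in> D" "\<And>x. x \<in> D \<Longrightarrow> (x, z) \<in> fan_order"
  | (spine) c i M where "D = Spine c i ` M" "infinite M"
proof -
  have bound: "\<exists>z\<in>D. fan_le x z \<and> fan_le y z" if "x \<in> D" "y \<in> D" for x y
    using directed_bound[OF assms that] by (simp add: fan_order_iff)
  obtain x0 where x0: "x0 \<in> D" using assms by (auto simp: directed_def)
  show thesis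
  proof (cases "\<exists>c. Top c \<in> D")
    case True
    then obtain c where c: "Top c \<in> D" by blast
    have "fan_le x (Top c)" if "x \<in> D" for x using bound[OF that c] by auto
    then show thesis using greatest[OF c] by (simp add: fan_order_iff)
  next
    case False
    then obtain c i m0 where x0': "x0 = Spine c i m0" using x0 by (cases x0) auto
    define M where "M = {m. Spine c i m \<in> D}"
    have "x \<in> Spine c i ` M" if x: "x \<in> D" for x
    proof -
      obtain z where z: "z \<in> D" "fan_le x0 z" "fan_le x z" using bound[OF x0 x] by blast
      then obtain m where "z = Spine c i m" using False x0' by (cases z) auto
      then show ?thesis using z(3) x by (auto simp: fan_le_Spine M_def)
    qed
    then have DM: "D = Spine c i ` M" by (auto simp: M_def)
    show thesis
    proof (cases "finite M")
      case True
      have "M \<noteq> {}" using x0 DM by blast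
      then have "Spine c i (Max M) \<in> D" using Max_in[OF True] DM by blast
      moreover have "(x, Spine c i (Max M)) \<in> fan_order" if "x \<in> D" for x
        using that DM True by (auto simp: fan_order_iff)
      ultimately show thesis by (rule greatest)
    next
      case False
      then show thesis by (rule spine[OF DM])
    qed
  qed
qed

lemma dcpo_fan_order: "dcpo fan_order"
  unfolding dcpo_def
proof (intro conjI allI impI)
  fix D assume "directed fan_order D"
  then show "\<exists>x. is_sup fan_order D x"
  proof (cases rule: directed_fan_order_cases)
    case (greatest z)
    then have "is_sup fan_order D z" using is_sup_greatest[OF po_fan_order greatest] by simp
    then show ?thesis ..
  next
    case (spine c i M)
    then show ?thesis using is_sup_spine by blast
  qed
qed (rule po_fan_order)

lemma directed_spine:
  assumes "M \<noteq> {}"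
  shows "directed fan_order (Spine c i ` M)"
  unfolding directed_def
proof (intro conjI ballI)
  fix x y assume "x \<in> Spine c i ` M" "y \<in> Spine c i ` M"
  then obtain m n where mn: "x = Spine c i m" "y = Spine c i n" "m \<in> M" "n \<in> M" by blast
  then have "max m n \<in> M" by (simp add: max_def)
  then show "\<exists>z\<in>Spine c i ` M. (x, z) \<in> fan_order \<and> (y, z) \<in> fan_order"
    using mn by (intro bexI[of _ "Spine c i (max m n)"]) (auto simp: fan_order_iff)
qed (use assms in \<open>auto simp: Field_fan_order\<close>)

lemma top_in_closed:
  assumes "scott_closed fan_order A" "infinite M" "Spine c i ` M \<subseteq> A"
  shows "Top c \<in> A"
  using scott_closed_sup[OF assms(1) directed_spine assms(3) is_sup_spine[OF assms(2)]] assms(2) by auto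

lemma fan_le_own_top: "\<exists>c. fan_le x (Top c)"
  by (cases x) auto

lemma irreducible_fan: "irreducible_closed fan_order UNIV"
  unfolding irreducible_closed_def
proof (intro conjI allI impI)
  show "scott_closed fan_order UNIV" using scott_closed_all[of fan_order] by (simp add: Field_fan_order)
  fix F G assume F: "scott_closed fan_order F" and G: "scott_closed fan_order G" and FG: "UNIV \<subseteq> F \<union> G"
  show "UNIV \<subseteq> F \<or> UNIV \<subseteq> G"
  proof (rule ccontr)
    assume "\<not> (UNIV \<subseteq> F \<or> UNIV \<subseteq> G)"
    then obtain x y where xy: "x \<notin> F" "y \<notin> G" by blast
    obtain a where a: "fan_le x (Top a)" using fan_le_own_top by blast
    obtain b where b: "fan_le y (Top b)" using fan_le_own_top by blast
    have aF: "Top a \<notin> F" using scott_closed_lower[OF F, of "Top a" x] a xy(1) by (auto simp: fan_order_iff)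
    have bG: "Top b \<notin> G" using scott_closed_lower[OF G, of "Top b" y] b xy(2) by (auto simp: fan_order_iff)
    \<comment> \<open>Every spine of a leaves F, and g records where. The spine of b indexed by this
      g leaves G at some k, and the top z built from a, b, g, k is above a point outside F and a
      point outside G.\<close>
    have "\<exists>m. Spine a (Inl n) m \<notin> F" for n
      using top_in_closed[OF F, of UNIV a "Inl n"] aF by auto
    then obtain g where g: "\<And>n. Spine a (Inl n) (g n) \<notin> F" by metis
    obtain k where k: "Spine b (Inr g) k \<notin> G"
      using top_in_closed[OF G, of UNIV b "Inr g"] bG by auto
    obtain z where z: "left_top z = a" "right_top z = b" "fun_part z = g" "nat_part z = k"
      using node_exists by blast
    have "(Spine a (Inl k) (g k), Top z) \<in> fan_order" "(Spine b (Inr g) k, Top z) \<in> fan_order"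
      using z by (simp_all add: fan_order_iff)
    then have "Top z \<notin> F" "Top z \<notin> G"
      using scott_closed_lower[OF F] scott_closed_lower[OF G] g k by blast+
    then show False using FG by blast
  qed
qed simp

text \<open>A pair of elements on different spines has finitely many upper bounds, except for a pair that
  is served by a common top; but then the upper bounds fix the length of the segments.\<close>

lemma fan_bounded:
  assumes A: "scott_closed fan_order A"
    and fin: "\<And>S0. finite S0 \<Longrightarrow> S0 \<subseteq> S \<Longrightarrow> \<exists>a\<in>A. \<forall>x\<in>S0. fan_le x a"
  shows "\<exists>a\<in>A. \<forall>x\<in>S. fan_le x a"
proof (rule ccontr)
  assume no: "\<not> ?thesis"
  \<comment> \<open>With finitely many upper bounds, S0 could be enlarged by one element of S for
    each of them that it fails to dominate; this finite set would have no bound in A.\<close>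
  have inf: "infinite {z. \<forall>x\<in>S0. fan_le x z}" if S0: "finite S0" "S0 \<subseteq> S" for S0
  proof
    let ?U = "{z. \<forall>x\<in>S0. fan_le x z}"
    assume U: "finite ?U"
    have "\<forall>z. \<exists>s. z \<in> A \<longrightarrow> s \<in> S \<and> \<not> fan_le s z" using no by blast
    then obtain s where s: "\<And>z. z \<in> A \<Longrightarrow> s z \<in> S \<and> \<not> fan_le (s z) z" by metis
    have "finite (S0 \<union> s ` (?U \<inter> A))" using S0(1) U by simp
    moreover have "S0 \<union> s ` (?U \<inter> A) \<subseteq> S" using S0(2) s by blast
    ultimately obtain a where a: "a \<in> A" "\<forall>x\<in>S0 \<union> s ` (?U \<inter> A). fan_le x a" using fin by blast
    then have "a \<in> ?U \<inter> A" by blast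
    then have "fan_le (s a) a" using a(2) by blast
    then show False using s[OF a(1)] by blast
  qed
  have infS: "infinite S" using fin[OF _ subset_refl] no by blast
  have SA: "S \<subseteq> A"
  proof
    fix x assume "x \<in> S"
    then obtain a where "a \<in> A" "fan_le x a" using fin[of "{x}"] by auto
    then show "x \<in> A" using scott_closed_lower[OF A] by (simp add: fan_order_iff)
  qed
  have noTop: "Top c \<notin> S" for c
  proof
    assume "Top c \<in> S"
    then have "infinite {z. \<forall>x\<in>{Top c}. fan_le x z}" by (intro inf) auto
    then show False by simp
  qed
  have common: "\<exists>z. serves z c i m \<and> serves z d j l"
    if "Spine c i m \<in> S" "Spine d j l \<in> S" "(c, i) \<noteq> (d, j)" for c i m d j l
  proof (rule ccontr)
    assume ns: "\<not> ?thesis"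
    have "{z. \<forall>x\<in>{Spine c i m, Spine d j l}. fan_le x z} \<subseteq> {Top c, Top d}"
    proof
      fix z assume "z \<in> {z. \<forall>x\<in>{Spine c i m, Spine d j l}. fan_le x z}"
      then have z: "fan_le (Spine c i m) z" "fan_le (Spine d j l) z" by auto
      show "z \<in> {Top c, Top d}" using z ns that(3) by (cases z) auto
    qed
    then have "finite {z. \<forall>x\<in>{Spine c i m, Spine d j l}. fan_le x z}" by (rule finite_subset) simp
    then show False using inf[of "{Spine c i m, Spine d j l}"] that(1,2) by blast
  qed
  obtain x0 where "x0 \<in> S" using infS by (metis ex_in_conv finite.emptyI)
  then obtain c i m0 where x0: "Spine c i m0 \<in> S" using noTop by (cases x0) auto
  show False
  proof (cases "S \<subseteq> range (Spine c i)")
    case True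
    then obtain M where M: "S = Spine c i ` M" by (meson subset_imageE)
    then have "infinite M" using infS by blast
    then have "Top c \<in> A" by (rule top_in_closed[OF A]) (use M SA in blast)
    moreover have "\<forall>x\<in>S. fan_le x (Top c)" using M by auto
    ultimately show False using no by blast
  next
    case False
    then obtain y0 where "y0 \<in> S" "y0 \<notin> range (Spine c i)" by blast
    moreover obtain d j l0 where "y0 = Spine d j l0" using noTop \<open>y0 \<in> S\<close> by (cases y0) auto
    ultimately have y0: "Spine d j l0 \<in> S" "(c, i) \<noteq> (d, j)" by auto
    \<comment> \<open>A top serves one spine of each kind, so different spines in S are of opposite
      kinds and a third one cannot occur.\<close>
    have type: "isl i \<noteq> isl j" if "Spine c i m \<in> S" "Spine d j l \<in> S" "(c, i) \<noteq> (d, j)" for c i m d j l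
      using common[OF that] that(3) by (cases i; cases j) auto
    have ij: "isl i \<noteq> isl j" by (rule type[OF x0 y0])
    have two: "(e, k) = (c, i) \<or> (e, k) = (d, j)" if e: "Spine e k m \<in> S" for e k m
    proof (rule ccontr)
      assume ne: "\<not> ?thesis"
      then have "isl i \<noteq> isl k" "isl j \<noteq> isl k" using type[OF x0 e] type[OF y0(1) e] by auto
      then show False using ij by blast
    qed
    \<comment> \<open>The index of the other spine limits m, which makes S finite. The value 0
      stands for two right spines, a case excluded by \<open>common\<close>.\<close>
    have bd: "\<exists>N. \<forall>m. Spine c i m \<in> S \<longrightarrow> m \<le> N"
      if y: "Spine d j l \<in> S" "(c, i) \<noteq> (d, j)" for c i d j l
    proof -
      have "m \<le> (case j of Inl k \<Rightarrow> k | Inr f \<Rightarrow> case i of Inl n \<Rightarrow> f n | Inr _ \<Rightarrow> 0)"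
        if "Spine c i m \<in> S" for m
        using common[OF that y] y(2) by (cases i; cases j) auto
      then show ?thesis by blast
    qed
    obtain N where N: "\<And>m. Spine c i m \<in> S \<Longrightarrow> m \<le> N" using bd[OF y0] by blast
    obtain N' where N': "\<And>m. Spine d j m \<in> S \<Longrightarrow> m \<le> N'" using bd[OF x0] y0(2) by metis
    have "S \<subseteq> Spine c i ` {..N} \<union> Spine d j ` {..N'}"
    proof
      fix x assume x: "x \<in> S"
      then obtain e k m where "x = Spine e k m" using noTop by (cases x) auto
      then show "x \<in> Spine c i ` {..N} \<union> Spine d j ` {..N'}" using two x N N' by blast
    qed
    then show False using infS finite_subset by blast
  qed
qed

lemma greatest_below_spine:
  assumes "S \<noteq> {}" "\<forall>x\<in>S. fan_le x (Spine c i m)"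
  shows "\<exists>u\<in>S. \<forall>x\<in>S. fan_le x u"
proof -
  have S: "S \<subseteq> Spine c i ` {..m}" using assms(2) by (auto simp: fan_le_Spine)
  then obtain M where M: "M \<subseteq> {..m}" "S = Spine c i ` M" by (meson subset_imageE)
  then have "finite M" "M \<noteq> {}" using assms(1) finite_subset by auto
  then show ?thesis using M(2) by (intro bexI[of _ "Spine c i (Max M)"]) auto
qed

subsection \<open>A weakly dominated dcpo that is not dominated\<close>

text \<open>With an antichain of tops in place of the fan space this would be Johnstone's dcpo.\<close>

fun tower_le :: "fan \<times> enat \<Rightarrow> fan \<times> enat \<Rightarrow> bool" where
  "tower_le (x, r) (y, s) \<longleftrightarrow> fan_le x y \<and> r \<le> s \<or> s = \<infinity> \<and> (\<exists>c. y = Top c \<and> r \<le> enat (nat_part c))"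

definition tower_order :: "(fan \<times> enat) rel" where
  "tower_order = {(p, q). tower_le p q}"

lemma tower_order_iff: "(p, q) \<in> tower_order \<longleftrightarrow> tower_le p q"
  by (simp add: tower_order_def)

lemma tower_le_prod: "fan_le (fst p) (fst q) \<Longrightarrow> snd p \<le> snd q \<Longrightarrow> tower_le p q"
  by (cases p; cases q) simp

text \<open>The points (Top c, \<infinity>) are the only ones with relations beyond the product
  order. They are maximal, so most arguments start by excluding them.\<close>

lemma tower_le_prodD:
  "tower_le p q \<Longrightarrow> (\<And>c. q \<noteq> (Top c, \<infinity>)) \<Longrightarrow> fan_le (fst p) (fst q) \<and> snd p \<le> snd q"
  by (cases p; cases q) auto

lemma tower_le_top: "tower_le p (Top c, \<infinity>) \<longleftrightarrow> fan_le (fst p) (Top c) \<or> snd p \<le> enat (nat_part c)"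
  by (cases p) auto

lemma tower_top_le: "tower_le (Top c, \<infinity>) q \<Longrightarrow> q = (Top c, \<infinity>)"
  by (cases q) auto

lemma tower_le_refl: "tower_le p p"
  by (cases p) (simp add: fan_le_refl)

lemma tower_le_trans:
  assumes "tower_le p q" "tower_le q w"
  shows "tower_le p w"
proof (cases "\<exists>c. q = (Top c, \<infinity>)")
  case True
  then show ?thesis using assms tower_top_le by blast
next
  case False
  then have pq: "fan_le (fst p) (fst q)" "snd p \<le> snd q" using tower_le_prodD[OF assms(1)] by auto
  show ?thesis
  proof (cases "\<exists>c. w = (Top c, \<infinity>)")
    case True
    then obtain c where c: "w = (Top c, \<infinity>)" by blast
    then show ?thesis
      using assms(2) pq fan_le_trans[of "fst p" "fst q"] order_trans[OF pq(2)]
      unfolding c tower_le_top by blast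
  next
    case False
    then have "fan_le (fst q) (fst w)" "snd q \<le> snd w" using tower_le_prodD[OF assms(2)] by auto
    then show ?thesis using pq by (intro tower_le_prod) (auto intro: fan_le_trans)
  qed
qed

lemma tower_le_antisym:
  assumes "tower_le p q" "tower_le q p"
  shows "p = q"
proof (cases "\<exists>c. p = (Top c, \<infinity>) \<or> q = (Top c, \<infinity>)")
  case True
  then show ?thesis using assms tower_top_le by blast
next
  case False
  then have "fan_le (fst p) (fst q) \<and> snd p \<le> snd q" "fan_le (fst q) (fst p) \<and> snd q \<le> snd p"
    using assms tower_le_prodD by blast+
  then show ?thesis by (intro prod_eqI) (auto intro: fan_le_antisym)
qed

lemma Field_tower_order: "Field tower_order = UNIV"
  using tower_le_refl by (auto simp: Field_def tower_order_def)

lemma po_tower_order: "Partial_order tower_order"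
proof -
  have "trans tower_order"
    by (rule transI) (unfold tower_order_iff, rule tower_le_trans)
  moreover have "antisym tower_order"
    by (rule antisymI) (unfold tower_order_iff, rule tower_le_antisym)
  ultimately show ?thesis
    by (simp add: order_on_defs refl_on_def Field_tower_order tower_order_iff tower_le_refl)
qed

lemma tower_sup_product:
  assumes dir: "\<And>p q. p \<in> D \<Longrightarrow> q \<in> D \<Longrightarrow> \<exists>w\<in>D. fan_le (fst p) (fst w) \<and> snd p \<le> snd w \<and>
      fan_le (fst q) (fst w) \<and> snd q \<le> snd w"
    and x: "is_sup fan_order (fst ` D) x"
  shows "is_sup tower_order D (x, Sup (snd ` D))"
proof (rule is_supI)
  show "(p, (x, Sup (snd ` D))) \<in> tower_order" if "p \<in> D" for p
    using is_sup_upper[OF x, of "fst p"] that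
    by (auto simp: fan_order_iff tower_order_iff intro!: tower_le_prod Sup_upper)
  fix q assume ub: "\<And>p. p \<in> D \<Longrightarrow> (p, q) \<in> tower_order"
  have least: "fan_le x y" if "\<And>p. p \<in> D \<Longrightarrow> fan_le (fst p) y" for y
  proof -
    have "(x, y) \<in> fan_order"
    proof (rule is_sup_least[OF x])
      show "(z, y) \<in> fan_order" if "z \<in> fst ` D" for z
        using that \<open>\<And>p. p \<in> D \<Longrightarrow> fan_le (fst p) y\<close> unfolding fan_order_iff by blast
    qed (simp add: Field_fan_order)
    then show ?thesis by (simp add: fan_order_iff)
  qed
  show "((x, Sup (snd ` D)), q) \<in> tower_order"
  proof (cases "\<exists>c. q = (Top c, \<infinity>)")
    case True
    then obtain c where c: "q = (Top c, \<infinity>)" by blast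
    have le: "fan_le (fst p) (Top c) \<or> snd p \<le> enat (nat_part c)" if "p \<in> D" for p
      using ub[OF that] by (simp add: c tower_order_iff tower_le_top)
    \<comment> \<open>Both conditions are inherited downwards in the product order, so a directed
      set cannot satisfy them in mixed fashion.\<close>
    have "(\<forall>p\<in>D. fan_le (fst p) (Top c)) \<or> (\<forall>p\<in>D. snd p \<le> enat (nat_part c))"
    proof (rule ccontr)
      assume "\<not> ?thesis"
      then obtain p q where pq: "p \<in> D" "q \<in> D" "\<not> fan_le (fst p) (Top c)"
        "\<not> snd q \<le> enat (nat_part c)" by blast
      then obtain w where w: "w \<in> D" "fan_le (fst p) (fst w)" "snd q \<le> snd w" using dir by blast
      have "\<not> fan_le (fst w) (Top c)" using fan_le_trans[OF w(2)] pq(3) by blast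
      moreover have "\<not> snd w \<le> enat (nat_part c)" using order_trans[OF w(3)] pq(4) by blast
      ultimately show False using le[OF w(1)] by blast
    qed
    then have "fan_le x (Top c) \<or> Sup (snd ` D) \<le> enat (nat_part c)"
      using least by (auto intro!: Sup_least)
    then show ?thesis by (simp add: c tower_order_iff tower_le_top)
  next
    case False
    then have "fan_le (fst p) (fst q) \<and> snd p \<le> snd q" if "p \<in> D" for p
      using tower_le_prodD[of p q] ub[OF that] by (simp add: tower_order_iff)
    then show ?thesis
      unfolding tower_order_iff using least by (intro tower_le_prod) (auto intro!: Sup_least)
  qed
qed (simp add: Field_tower_order)

lemma directed_tower_product:
  assumes D: "directed tower_order D" and no: "\<And>c. (Top c, \<infinity>) \<notin> D"
  obtains x where "is_sup fan_order (fst ` D) x" "is_sup tower_order D (x, Sup (snd ` D))"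
proof -
  have dir: "\<exists>w\<in>D. fan_le (fst p) (fst w) \<and> snd p \<le> snd w \<and> fan_le (fst q) (fst w) \<and> snd q \<le> snd w"
    if pq: "p \<in> D" "q \<in> D" for p q
  proof -
    obtain w where w: "w \<in> D" "tower_le p w" "tower_le q w"
      using directed_bound[OF D pq] by (auto simp: tower_order_iff)
    then have "w \<noteq> (Top c, \<infinity>)" for c using no by blast
    then show ?thesis using tower_le_prodD w by blast
  qed
  have "directed fan_order (fst ` D)"
    unfolding directed_def
  proof (intro conjI ballI)
    show "fst ` D \<noteq> {}" using D by (simp add: directed_def)
    fix x y assume "x \<in> fst ` D" "y \<in> fst ` D"
    then obtain p q where pq: "p \<in> D" "q \<in> D" "x = fst p" "y = fst q" by blast
    then obtain w where "w \<in> D" "fan_le x (fst w)" "fan_le y (fst w)" using dir by blast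
    then show "\<exists>z\<in>fst ` D. (x, z) \<in> fan_order \<and> (y, z) \<in> fan_order" by (auto simp: fan_order_iff)
  qed (simp add: Field_fan_order)
  then obtain x where x: "is_sup fan_order (fst ` D) x" using dcpo_fan_order by (auto simp: dcpo_def)
  show thesis by (rule that[OF x tower_sup_product[OF dir x]])
qed

lemma dcpo_tower_order: "dcpo tower_order"
  unfolding dcpo_def
proof (intro conjI allI impI)
  fix D assume D: "directed tower_order D"
  show "\<exists>x. is_sup tower_order D x"
  proof (cases "\<exists>c. (Top c, \<infinity>) \<in> D")
    case True
    then obtain c where c: "(Top c, \<infinity>) \<in> D" by blast
    have "(p, (Top c, \<infinity>)) \<in> tower_order" if "p \<in> D" for p
      using directed_bound[OF D that c] tower_top_le by (auto simp: tower_order_iff)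
    then have "is_sup tower_order D (Top c, \<infinity>)" using is_sup_greatest[OF po_tower_order c] by simp
    then show ?thesis ..
  next
    case False
    then show ?thesis using directed_tower_product[OF D] by metis
  qed
qed (rule po_tower_order)

lemma tower_closed_le:
  assumes "scott_closed tower_order A" "q \<in> A" "tower_le p q"
  shows "p \<in> A"
  using scott_closed_lower[OF assms(1,2)] assms(3) by (simp add: tower_order_iff)

lemma tower_closed_product:
  assumes A: "scott_closed tower_order A" and D: "D \<noteq> {}" "D \<subseteq> A"
    and dir: "\<And>p q. p \<in> D \<Longrightarrow> q \<in> D \<Longrightarrow> \<exists>w\<in>D. fan_le (fst p) (fst w) \<and> snd p \<le> snd w \<and>
      fan_le (fst q) (fst w) \<and> snd q \<le> snd w"
    and x: "is_sup fan_order (fst ` D) x"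
  shows "(x, Sup (snd ` D)) \<in> A"
proof (rule scott_closed_sup[OF A _ D(2) tower_sup_product[OF dir x]])
  show "directed tower_order D"
    unfolding directed_def
  proof (intro conjI ballI D(1))
    fix p q assume "p \<in> D" "q \<in> D"
    then show "\<exists>z\<in>D. (p, z) \<in> tower_order \<and> (q, z) \<in> tower_order"
      using dir tower_le_prod unfolding tower_order_iff by meson
  qed (simp add: Field_tower_order)
qed

lemma scott_closed_slice:
  assumes A: "scott_closed tower_order A"
  shows "scott_closed fan_order {x. (x, r) \<in> A}"
proof (rule scott_closedI)
  show "y \<in> {x. (x, r) \<in> A}" if "x \<in> {x. (x, r) \<in> A}" "(y, x) \<in> fan_order" for x y
    using that tower_closed_le[OF A, of "(x, r)" "(y, r)"] by (simp add: fan_order_iff)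
  fix D x assume D: "directed fan_order D" "D \<subseteq> {x. (x, r) \<in> A}" "is_sup fan_order D x"
  have ne: "D \<noteq> {}" using D(1) by (simp add: directed_def)
  have "(x, Sup (snd ` (D \<times> {r}))) \<in> A"
  proof (rule tower_closed_product[OF A])
    show "D \<times> {r} \<subseteq> A" using D(2) by blast
    show "is_sup fan_order (fst ` (D \<times> {r})) x" using D(3) by simp
    fix p q assume "p \<in> D \<times> {r}" "q \<in> D \<times> {r}"
    then show "\<exists>w\<in>D \<times> {r}. fan_le (fst p) (fst w) \<and> snd p \<le> snd w \<and> fan_le (fst q) (fst w) \<and> snd q \<le> snd w"
      using directed_bound[OF D(1), of "fst p" "fst q"] by (auto simp: fan_order_iff)
  qed (use ne in simp)
  then show "x \<in> {x. (x, r) \<in> A}" using ne by simp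
qed (simp add: Field_fan_order)

lemma Sup_range_enat: "Sup (range enat) = \<infinity>"
proof (rule ccontr)
  assume "Sup (range enat) \<noteq> \<infinity>"
  then obtain k where k: "Sup (range enat) = enat k" by auto
  have "enat (Suc k) \<le> Sup (range enat)" by (rule Sup_upper) simp
  then show False using k by simp
qed

lemma tower_closed_limit:
  assumes A: "scott_closed tower_order A" and x: "\<And>i. (x, enat i) \<in> A"
  shows "(x, \<infinity>) \<in> A"
proof -
  have "(x, Sup (snd ` ({x} \<times> range enat))) \<in> A"
  proof (rule tower_closed_product[OF A])
    show "{x} \<times> range enat \<subseteq> A" using x by auto
    show "is_sup fan_order (fst ` ({x} \<times> range enat)) x"
      by (rule is_supI) (auto simp: Field_fan_order fan_order_iff fan_le_refl)
    fix p q assume "p \<in> {x} \<times> range enat" "q \<in> {x} \<times> range enat"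
    then obtain i j where "p = (x, enat i)" "q = (x, enat j)" by auto
    then show "\<exists>w\<in>{x} \<times> range enat. fan_le (fst p) (fst w) \<and> snd p \<le> snd w \<and>
        fan_le (fst q) (fst w) \<and> snd q \<le> snd w"
      by (intro bexI[of _ "(x, enat (max i j))"]) (auto simp: fan_le_refl)
  qed simp
  then show ?thesis by (simp add: Sup_range_enat)
qed

lemma tower_closed_mono: "scott_closed tower_order A \<Longrightarrow> (x, s) \<in> A \<Longrightarrow> r \<le> s \<Longrightarrow> (x, r) \<in> A"
  by (erule tower_closed_le) (auto simp: fan_le_refl)

section \<open>Irreducible levels and the failure of domination\<close>

definition level :: "nat \<Rightarrow> (fan \<times> enat) set" where
  "level k = {p. snd p \<le> enat k}"

lemma scott_closed_level: "scott_closed tower_order (level k)"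
proof (rule scott_closedI)
  show "q \<in> level k" if "p \<in> level k" "(q, p) \<in> tower_order" for p q
  proof -
    have "p \<noteq> (Top c, \<infinity>)" for c using that(1) by (auto simp: level_def)
    then have "snd q \<le> snd p" using tower_le_prodD that(2) by (simp add: tower_order_iff)
    then show ?thesis using that(1) by (auto simp: level_def)
  qed
  fix D p assume D: "directed tower_order D" "D \<subseteq> level k" "is_sup tower_order D p"
  have "(Top c, \<infinity>) \<notin> D" for c using D(2) by (auto simp: level_def)
  then obtain x where "is_sup tower_order D (x, Sup (snd ` D))" using directed_tower_product[OF D(1)] by metis
  then have "p = (x, Sup (snd ` D))" by (rule is_sup_unique[OF po_tower_order D(3)])
  moreover have "Sup (snd ` D) \<le> enat k" using D(2) by (auto simp: level_def intro!: Sup_least)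
  ultimately show "p \<in> level k" by (simp add: level_def)
qed (simp add: Field_tower_order)

text \<open>A closed set that contains all points of height k contains the level, so a closed cover
  of the level is decided on the slice at height k, a copy of the fan.\<close>

lemma irreducible_level: "irreducible_closed tower_order (level k)"
  unfolding irreducible_closed_def
proof (intro conjI allI impI scott_closed_level)
  show "level k \<noteq> {}" by (auto simp: level_def intro!: exI[of _ "0 :: enat"])
  fix F G assume F: "scott_closed tower_order F" and G: "scott_closed tower_order G"
    and FG: "level k \<subseteq> F \<union> G"
  have all: "level k \<subseteq> H" if "scott_closed tower_order H" "UNIV \<subseteq> {x. (x, enat k) \<in> H}" for H
  proof
    fix p assume p: "p \<in> level k"
    have "(fst p, enat k) \<in> H" using that(2) by blast
    then have "(fst p, snd p) \<in> H" by (rule tower_closed_mono[OF that(1)]) (use p in \<open>simp add: level_def\<close>)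
    then show "p \<in> H" by simp
  qed
  have "UNIV \<subseteq> {x. (x, enat k) \<in> F} \<union> {x. (x, enat k) \<in> G}"
  proof
    fix x
    have "(x, enat k) \<in> level k" by (simp add: level_def)
    then show "x \<in> {x. (x, enat k) \<in> F} \<union> {x. (x, enat k) \<in> G}" using FG by blast
  qed
  then have "UNIV \<subseteq> {x. (x, enat k) \<in> F} \<or> UNIV \<subseteq> {x. (x, enat k) \<in> G}"
    by (rule irreducible_cases[OF irreducible_fan scott_closed_slice[OF F] scott_closed_slice[OF G]])
  then show "level k \<subseteq> F \<or> level k \<subseteq> G" using all F G by blast
qed

lemma tower_closed_proper:
  assumes "scott_closed tower_order A" "A \<noteq> UNIV"
  shows "\<exists>x i. (x, enat i) \<notin> A"
proof (rule ccontr)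
  assume no: "\<not> ?thesis"
  then have "(x, r) \<in> A" for x r
    using tower_closed_limit[OF assms(1)] by (cases r) auto
  then show False using assms(2) by auto
qed

lemma nat_part_surj: "\<exists>c. nat_part c = n"
  using node_exists by blast

text \<open>Proper closed sets miss points at finite heights i and j, and any point (Top c,
  \<infinity>) with \<open>nat_part c\<close> = max i j lies above both.\<close>

lemma irreducible_tower: "irreducible_closed tower_order UNIV"
  unfolding irreducible_closed_def
proof (intro conjI allI impI)
  show "scott_closed tower_order UNIV"
    using scott_closed_all[of tower_order] by (simp add: Field_tower_order)
  fix F G assume F: "scott_closed tower_order F" and G: "scott_closed tower_order G"
    and FG: "UNIV \<subseteq> F \<union> G"
  show "UNIV \<subseteq> F \<or> UNIV \<subseteq> G"
  proof (rule ccontr)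
    assume "\<not> ?thesis"
    then have ne: "F \<noteq> UNIV" "G \<noteq> UNIV" by blast+
    obtain x i where xi: "(x, enat i) \<notin> F" using tower_closed_proper[OF F ne(1)] by blast
    obtain y j where yj: "(y, enat j) \<notin> G" using tower_closed_proper[OF G ne(2)] by blast
    obtain c where c: "nat_part c = max i j" using nat_part_surj by blast
    have "(Top c, \<infinity>) \<notin> F" using tower_closed_le[OF F, of "(Top c, \<infinity>)" "(x, enat i)"] xi c by auto
    moreover have "(Top c, \<infinity>) \<notin> G" using tower_closed_le[OF G, of "(Top c, \<infinity>)" "(y, enat j)"] yj c by auto
    ultimately show False using FG by blast
  qed
qed simp

text \<open>The levels are irreducible, and each lies below some (Top c, \<infinity>). Their
  supremum is the whole tower, which has several maximal points and hence no upper bound.\<close>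

theorem not_dominated_tower: "\<not> dominated tower_order"
proof
  assume dom: "dominated tower_order"
  let ?\<A> = "{A. irreducible_closed tower_order A \<and> lhd tower_order A UNIV}"
  have c: "scott_closed (Irr_Gamma tower_order) ?\<A>"
    using dom irreducible_tower by (simp add: dominated_def)
  have sup: "directed (Irr_Gamma tower_order) \<D> \<Longrightarrow> \<D> \<subseteq> ?\<A> \<Longrightarrow> cl tower_order (\<Union>\<D>) \<in> ?\<A>" for \<D>
    using c unfolding scott_closed_Irr_Gamma_iff by blast
  have below: "lhd tower_order (level k) UNIV" for k
  proof -
    obtain c where "nat_part c = k" using nat_part_surj by blast
    then have "level k \<subseteq> under tower_order (Top c, \<infinity>)"
      by (auto simp: level_def under_def tower_order_iff)
    then show ?thesis unfolding lhd_def by blast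
  qed
  have mono: "level i \<subseteq> level j" if "i \<le> j" for i j
  proof
    fix p assume "p \<in> level i"
    then show "p \<in> level j" using that order_trans[of "snd p" "enat i" "enat j"] by (simp add: level_def)
  qed
  have "directed (Irr_Gamma tower_order) (range level)"
    unfolding Irr_Gamma_def directed_incl
  proof (intro conjI ballI)
    show "range level \<subseteq> {A. irreducible_closed tower_order A}" using irreducible_level by blast
    fix X Y assume "X \<in> range level" "Y \<in> range level"
    then obtain i j where "X = level i" "Y = level j" by blast
    then have "X \<subseteq> level (max i j)" "Y \<subseteq> level (max i j)" using mono by simp_all
    then show "\<exists>Z\<in>range level. X \<subseteq> Z \<and> Y \<subseteq> Z" by blast
  qed simp
  moreover have "range level \<subseteq> ?\<A>" using irreducible_level below by blast
  ultimately have C: "cl tower_order (\<Union>(range level)) \<in> ?\<A>" (is "?C \<in> _") by (rule sup)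
  have closed: "scott_closed tower_order ?C" by (rule scott_closed_cl_Union) (use scott_closed_level in blast)
  have "(x, enat i) \<in> ?C" for x i
    using cl_upper[of "level i" "range level" tower_order] by (auto simp: level_def)
  then have "?C = UNIV" using tower_closed_proper[OF closed] by blast
  then obtain b where b: "UNIV \<subseteq> under tower_order b" using C by (auto simp: lhd_def)
  then have le: "tower_le p b" for p by (auto simp: under_def tower_order_iff)
  obtain c where "b = (Top c, \<infinity>)" using tower_top_le[OF le[of "(Top undefined, \<infinity>)"]] by blast
  then have "c = d" for d using tower_top_le[OF le[of "(Top d, \<infinity>)"]] by simp
  from this[of "\<lambda>_. 0"] this[of "\<lambda>_. Suc 0"] have "(\<lambda>_ :: nat. 0) = (\<lambda>_. Suc 0)" by simp
  then show False by (simp add: fun_eq_iff)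
qed

text \<open>A carries the product order, and \<open>fan_bounded\<close> bounds S within the slice of
  A at any height attained in S. If the heights of S are unbounded, these bounds must be replaced by
  one that works at all heights; \<open>slim\<close> makes this possible.\<close>

lemma tower_bounded:
  assumes A: "scott_closed tower_order A" "A \<noteq> {}" and no: "\<And>c. (Top c, \<infinity>) \<notin> A"
    and slim: "(\<exists>k. A \<subseteq> level k) \<or> (\<exists>y. \<forall>p\<in>A. fan_le (fst p) y)"
    and S: "S \<subseteq> A"
    and fin: "\<And>S0. finite S0 \<Longrightarrow> S0 \<subseteq> S \<Longrightarrow> \<exists>a\<in>A. \<forall>p\<in>S0. tower_le p a"
  shows "\<exists>a\<in>A. \<forall>p\<in>S. tower_le p a"
proof -
  have fin': "\<exists>z\<in>{x. (x, r) \<in> A}. \<forall>x\<in>S0. fan_le x z"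
    if p0: "p0 \<in> S" "r \<le> snd p0" and S0: "finite S0" "S0 \<subseteq> fst ` S" for r p0 S0
  proof -
    obtain S1 where S1: "finite S1" "S1 \<subseteq> S" "S0 = fst ` S1"
      using finite_subset_image[OF S0] by blast
    then obtain a where a: "a \<in> A" "\<forall>p\<in>insert p0 S1. tower_le p a"
      using fin[of "insert p0 S1"] p0(1) by auto
    have "a \<noteq> (Top c, \<infinity>)" for c using a(1) no by blast
    then have pr: "fan_le (fst p) (fst a) \<and> snd p \<le> snd a" if "p \<in> insert p0 S1" for p
      using tower_le_prodD a(2) that by blast
    then have "r \<le> snd a" using p0(2) by (meson insertI1 order_trans)
    then have "(fst a, r) \<in> A" using tower_closed_mono[OF A(1), of "fst a" "snd a" r] a(1) by simp
    moreover have "\<forall>x\<in>S0. fan_le x (fst a)" using pr S1(3) by blast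
    ultimately show ?thesis by blast
  qed
  have slice: "\<exists>z. (z, r) \<in> A \<and> (\<forall>p\<in>S. fan_le (fst p) z)" if "p0 \<in> S" "r \<le> snd p0" for r p0
  proof -
    have "\<exists>z\<in>{x. (x, r) \<in> A}. \<forall>x\<in>fst ` S. fan_le x z"
      by (rule fan_bounded[OF scott_closed_slice[OF A(1)]]) (rule fin'[OF that])
    then show ?thesis by simp
  qed
  show ?thesis
  proof (cases "S = {}")
    case True
    then show ?thesis using A(2) by blast
  next
    case ne: False
    show ?thesis
    proof (cases "\<exists>p0\<in>S. \<forall>p\<in>S. snd p \<le> snd p0")
      case True
      then obtain p0 where p0: "p0 \<in> S" "\<forall>p\<in>S. snd p \<le> snd p0" by blast
      obtain z where z: "(z, snd p0) \<in> A" "\<forall>p\<in>S. fan_le (fst p) z" using slice[OF p0(1) order_refl] by blast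
      have "tower_le p (z, snd p0)" if "p \<in> S" for p
        by (rule tower_le_prod) (use that z(2) p0(2) in simp_all)
      then show ?thesis using z(1) by blast
    next
      case nomax: False
      have unb: "\<exists>p\<in>S. enat i \<le> snd p" for i
      proof (rule ccontr)
        assume "\<not> ?thesis"
        then have le: "\<forall>p\<in>S. snd p \<le> enat i" by (meson le_cases)
        then have "finite (snd ` S)" by (intro finite_enat_bounded[of _ i]) blast
        then have "Max (snd ` S) \<in> snd ` S" "\<forall>p\<in>S. snd p \<le> Max (snd ` S)" using ne by simp_all
        then show False using nomax by (metis imageE)
      qed
      then have "\<exists>z. (z, enat i) \<in> A \<and> (\<forall>p\<in>S. fan_le (fst p) z)" for i using slice by blast
      then obtain z where z: "\<And>i. (z i, enat i) \<in> A" "\<And>i. \<forall>p\<in>S. fan_le (fst p) (z i)" by metis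
      have "\<not> A \<subseteq> level k" for k using z(1)[of "Suc k"] by (auto simp: level_def)
      then obtain y where y: "\<And>p. p \<in> A \<Longrightarrow> fan_le (fst p) y" using slim by blast
      have "\<exists>u. (\<forall>i. (u, enat i) \<in> A) \<and> (\<forall>p\<in>S. fan_le (fst p) u)"
      proof (cases "\<forall>i. z i = y")
        case True
        then show ?thesis using z by metis
      next
        case False
        \<comment> \<open>A bound strictly below y is on a spine, so the first components of S have
          a greatest element u. This u is below every \<open>z k\<close> and does not depend on the
          height.\<close>
        then obtain i where i: "z i \<noteq> y" by blast
        have "fan_le (z i) y" using y[OF z(1)[of i]] by simp
        then obtain c l m where "z i = Spine c l m" using i by (cases "z i") auto
        then obtain u where u: "u \<in> fst ` S" "\<forall>x\<in>fst ` S. fan_le x u"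
          using greatest_below_spine[of "fst ` S" c l m] z(2)[of i] ne by auto
        have "(u, enat k) \<in> A" for k
          using tower_closed_le[OF A(1) z(1)[of k], of "(u, enat k)"] u(1) z(2)[of k] by auto
        then show ?thesis using u(2) by blast
      qed
      then obtain u where u: "\<And>i. (u, enat i) \<in> A" "\<forall>p\<in>S. fan_le (fst p) u" by blast
      have "(u, \<infinity>) \<in> A" by (rule tower_closed_limit[OF A(1) u(1)])
      moreover have "tower_le p (u, \<infinity>)" if "p \<in> S" for p
        by (rule tower_le_prod) (use that u(2) in simp_all)
      ultimately show ?thesis by blast
    qed
  qed
qed

text \<open>Boundedness of A matters, since the whole tower is C-compact. If A contains a point (Top
  c, \<infinity>), its bound b is that point; otherwise \<open>tower_bounded\<close> supplies what
  \<open>C_compact_principal\<close> requires.\<close>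

theorem weakly_dominated_tower: "weakly_dominated tower_order"
proof (rule weakly_dominated_if_principal[OF dcpo_tower_order])
  fix A b assume C: "C_compact (Gamma tower_order) A" and ne: "A \<noteq> {}"
    and below: "A \<subseteq> under tower_order b"
  have A: "scott_closed tower_order A" by (rule C_compact_closed[OF C])
  have irr: "irreducible_closed tower_order A" by (rule C_compact_irreducible[OF dcpo_tower_order C ne])
  have le: "tower_le p b" if "p \<in> A" for p using below that by (auto simp: under_def tower_order_iff)
  show "\<exists>a\<in>A. A = under tower_order a"
  proof (cases "\<exists>c. (Top c, \<infinity>) \<in> A")
    case True
    then obtain c where c: "(Top c, \<infinity>) \<in> A" by blast
    then have "b = (Top c, \<infinity>)" using tower_top_le[OF le[OF c]] by simp
    moreover have "under tower_order (Top c, \<infinity>) \<subseteq> A" using A c by (simp add: scott_closed_def)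
    ultimately show ?thesis using below c by blast
  next
    case False
    then have no: "(Top c, \<infinity>) \<notin> A" for c by blast
    have slim: "(\<exists>k. A \<subseteq> level k) \<or> (\<exists>y. \<forall>p\<in>A. fan_le (fst p) y)"
    proof (cases "\<exists>c. b = (Top c, \<infinity>)")
      case True
      then obtain c where c: "b = (Top c, \<infinity>)" by blast
      \<comment> \<open>The two ways of lying below (Top c, \<infinity>), as two closed parts of A
        of which irreducibility selects one. Closedness of the first relies on A avoiding the points
        where jumps end.\<close>
      let ?L = "A \<inter> {p. fan_le (fst p) (Top c)}" and ?R = "A \<inter> level (nat_part c)"
      have "scott_closed tower_order ?L"
      proof (rule scott_closedI)
        fix p q assume p: "p \<in> ?L" and qp: "(q, p) \<in> tower_order"
        have "q \<in> A" using scott_closed_lower[OF A _ qp] p by blast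
        moreover have "p \<noteq> (Top d, \<infinity>)" for d using p no by blast
        then have "fan_le (fst q) (fst p)" using tower_le_prodD qp by (simp add: tower_order_iff)
        then have "fan_le (fst q) (Top c)" using p fan_le_trans by blast
        ultimately show "q \<in> ?L" by blast
      next
        fix D p assume D: "directed tower_order D" "D \<subseteq> ?L" "is_sup tower_order D p"
        have "(Top d, \<infinity>) \<notin> D" for d using D(2) no by blast
        then obtain x where x: "is_sup fan_order (fst ` D) x" "is_sup tower_order D (x, Sup (snd ` D))"
          using directed_tower_product[OF D(1)] by metis
        have p: "p = (x, Sup (snd ` D))" by (rule is_sup_unique[OF po_tower_order D(3) x(2)])
        have "(x, Top c) \<in> fan_order"
          using D(2) by (intro is_sup_least[OF x(1)]) (auto simp: Field_fan_order fan_order_iff)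
        moreover have "p \<in> A" using scott_closed_sup[OF A D(1) _ D(3)] D(2) by blast
        ultimately show "p \<in> ?L" by (simp add: p fan_order_iff)
      qed (simp add: Field_tower_order)
      moreover have "scott_closed tower_order ?R" by (intro scott_closed_Int A scott_closed_level)
      moreover have "A \<subseteq> ?L \<union> ?R" using le unfolding c tower_le_top by (auto simp: level_def)
      ultimately have "A \<subseteq> ?L \<or> A \<subseteq> ?R" by (rule irreducible_cases[OF irr])
      then show ?thesis by blast
    next
      case False
      then have "fan_le (fst p) (fst b)" if "p \<in> A" for p using tower_le_prodD le[OF that] by blast
      then show ?thesis by blast
    qed
    show ?thesis
    proof (rule C_compact_principal[OF dcpo_tower_order C ne])
      fix S assume S: "S \<subseteq> A"
        and fin: "\<And>S0. finite S0 \<Longrightarrow> S0 \<subseteq> S \<Longrightarrow> \<exists>a\<in>A. \<forall>x\<in>S0. (x, a) \<in> tower_order"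
      show "\<exists>a\<in>A. \<forall>x\<in>S. (x, a) \<in> tower_order"
        using tower_bounded[OF A ne no slim S] fin unfolding tower_order_iff by blast
    qed
  qed
qed

subsection \<open>Encodings into \<open>nat set set\<close>\<close>

text \<open>Pairing merges a sequence of sets into one set of numbers; the outer singleton only
  adjusts the type.\<close>

definition flatten :: "(nat \<Rightarrow> nat set) \<Rightarrow> nat set set" where
  "flatten s = {{prod_encode (k, n) | k n. n \<in> s k}}"

lemma flatten_eq: "flatten s = flatten s' \<longleftrightarrow> s = s'"
proof
  assume "flatten s = flatten s'"
  then have eq: "{prod_encode (k, n) | k n. n \<in> s k} = {prod_encode (k, n) | k n. n \<in> s' k}"
    by (simp add: flatten_def)
  have mem: "prod_encode (k, n) \<in> {prod_encode (k, n) | k n. n \<in> u k} \<longleftrightarrow> n \<in> u k"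
    for k n and u :: "nat \<Rightarrow> nat set" by (auto simp: prod_encode_eq)
  show "s = s'"
  proof (intro ext set_eqI)
    fix k n show "n \<in> s k \<longleftrightarrow> n \<in> s' k" using mem[of k n s] mem[of k n s'] eq by simp
  qed
qed simp

definition graph_code :: "(nat \<Rightarrow> nat) \<Rightarrow> nat set" where
  "graph_code f = {prod_encode (i, f i) | i. True}"

lemma graph_code_eq: "graph_code f = graph_code g \<longleftrightarrow> f = g"
proof
  assume eq: "graph_code f = graph_code g"
  show "f = g"
  proof
    fix i
    have "prod_encode (i, f i) \<in> graph_code g" unfolding eq[symmetric] by (auto simp: graph_code_def)
    then show "f i = g i" by (auto simp: graph_code_def prod_encode_eq)
  qed
qed simp

text \<open>Codes of functions and singletons are nonempty, so the empty components reveal the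
  constructor. Component 4 is kept free for the height.\<close>

fun encode_fan :: "fan \<Rightarrow> nat \<Rightarrow> nat set" where
  "encode_fan (Top c) = (\<lambda>_. {})(0 := graph_code c)"
| "encode_fan (Spine c (Inl n) m) = (\<lambda>_. {})(0 := graph_code c, 1 := {n}, 3 := {m})"
| "encode_fan (Spine c (Inr f) m) = (\<lambda>_. {})(0 := graph_code c, 2 := graph_code f, 3 := {m})"

lemma encode_fan_eq: "encode_fan x = encode_fan y \<longleftrightarrow> x = y"
proof
  assume eq: "encode_fan x = encode_fan y"
  have "encode_fan x k = encode_fan y k" for k using eq by simp
  from this[of 0] this[of 1] this[of 2] this[of 3] show "x = y"
    by (cases x rule: encode_fan.cases; cases y rule: encode_fan.cases) (auto simp: graph_code_eq)
qed simp

lemma encode_fan_4: "encode_fan x 4 = {}"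
  by (cases x rule: encode_fan.cases) auto

definition encode_tower :: "fan \<times> enat \<Rightarrow> nat set set" where
  "encode_tower p = flatten ((encode_fan (fst p))(4 := {i. enat i < snd p}))"

lemma enat_segment_le:
  assumes "{i. enat i < r} \<subseteq> {i. enat i < s}"
  shows "r \<le> s"
proof (rule ccontr)
  assume "\<not> r \<le> s"
  then obtain k where "s = enat k" "enat k < r" by (cases s) auto
  then show False using assms by auto
qed

lemma inj_encode_tower: "inj encode_tower"
proof (rule injI)
  fix p q assume "encode_tower p = encode_tower q"
  then have eq: "(encode_fan (fst p))(4 := {i. enat i < snd p}) = (encode_fan (fst q))(4 := {i. enat i < snd q})"
    by (simp add: encode_tower_def flatten_eq)
  have "encode_fan (fst p) k = encode_fan (fst q) k" for k
    using fun_cong[OF eq, of k] encode_fan_4 by (cases "k = 4") auto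
  then have "fst p = fst q" using encode_fan_eq by blast
  moreover have "{i. enat i < snd p} = {i. enat i < snd q}" using fun_cong[OF eq, of 4] by simp
  then have "snd p = snd q" using enat_segment_le by (intro order_antisym) blast+
  ultimately show "p = q" by (rule prod_eqI)
qed

definition encode_triple :: "triple \<Rightarrow> nat set set" where
  "encode_triple = (\<lambda>(a, h, r). flatten ((\<lambda>_. {})(0 := prod_encode ` a, 1 := prod_encode ` h, 2 := prod_encode ` r)))"

lemma inj_encode_triple: "inj encode_triple"
proof (rule injI)
  fix x y assume eq: "encode_triple x = encode_triple y"
  obtain a h r where x: "x = (a, h, r)" by (cases x)
  obtain a' h' r' where y: "y = (a', h', r')" by (cases y)
  from eq have eq': "(\<lambda>_ :: nat. {})(0 := prod_encode ` a, 1 := prod_encode ` h, 2 := prod_encode ` r) =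
      (\<lambda>_ :: nat. {})(0 := prod_encode ` a', 1 := prod_encode ` h', 2 := prod_encode ` r')"
    unfolding x y encode_triple_def prod.case flatten_eq .
  have inj: "prod_encode ` s = prod_encode ` t \<longleftrightarrow> s = t" for s t
    by (rule inj_image_eq_iff) (rule inj_prod_encode)
  from fun_cong[OF eq', of 0] fun_cong[OF eq', of 1] fun_cong[OF eq', of 2]
  show "x = y" by (simp add: x y inj)
qed

theorem theorem6p22:
  shows "((DOMI :: 'a rel set) \<subseteq> WDomi \<and> (WDomi :: 'a rel set) \<subseteq> R2 \<and> (R2 :: 'a rel set) \<subseteq> DCPO) \<and>
    ((DOMI :: nat set set rel set) \<subset> WDomi \<and> (WDomi :: nat set set rel set) \<subset> R2 \<and>
     (R2 :: nat set set rel set) \<subset> DCPO)"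
proof -
  \<comment> \<open>Stated for a fresh type variable, so that each inclusion can be used at both
    types of the goal.\<close>
  have DW: "(DOMI :: 'b rel set) \<subseteq> WDomi"
    using dominated_imp_weakly_dominated by (auto simp: DOMI_def WDomi_def)
  have WR: "(WDomi :: 'b rel set) \<subseteq> R2"
    using weakly_dominated_orthogonal
    by (auto simp: WDomi_def R2_def two_complete_def weakly_dominated_def)
  have RD: "(R2 :: 'b rel set) \<subseteq> DCPO"
    by (auto simp: R2_def DCPO_def two_complete_def)
  let ?tower = "relabel encode_tower tower_order"
  have "?tower \<in> WDomi \<and> ?tower \<notin> DOMI"
    using weakly_dominated_tower not_dominated_tower
    by (simp_all add: WDomi_def DOMI_def weakly_dominated_relabel[OF inj_encode_tower]
        dominated_relabel[OF inj_encode_tower])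
  then have D: "(DOMI :: nat set set rel set) \<subset> WDomi" by (intro psubsetI DW) metis
  \<comment> \<open>Finitely many blocks for the rank argument, and two of them: one to cut and one
    that stays complete.\<close>
  let ?two = "relabel encode_triple (column_order {0, 1} False)"
  have "\<not> weakly_dominated ?two"
    unfolding weakly_dominated_relabel[OF inj_encode_triple]
    by (rule not_weakly_dominated_column_order[of 0 _ 1]) simp_all
  then have "?two \<in> R2 \<and> ?two \<notin> WDomi"
    using two_complete_column_order[OF _ inj_encode_triple, of "{0, 1}"]
    by (simp_all add: R2_def WDomi_def)
  then have W: "(WDomi :: nat set set rel set) \<subset> R2" by (intro psubsetI WR) metis
  let ?all = "relabel encode_triple (column_order UNIV False)"
  have "?all \<in> DCPO \<and> ?all \<notin> R2"
    using dcpo_relabel[OF inj_encode_triple dcpo_column_order]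
      not_two_complete_column_order[OF infinite_UNIV_nat inj_encode_triple]
    by (simp_all add: DCPO_def R2_def)
  then have R: "(R2 :: nat set set rel set) \<subset> DCPO" by (intro psubsetI RD) metis
  show ?thesis by (intro conjI DW WR RD D W R)
qed

end
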